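(* Let $n$ be a positive integer, let $\mathsf D$ be the vector field on $\mathsf T=\mathsf T_n$ given either by Option 1 or by Option 2, and let $\widetilde{\mathcal M}=\bigoplus_{r\in\mathbb Z}\widetilde{\mathcal M}_r$ and $\mathcal M=\bigoplus_{r\in\mathbb Z}\mathcal M_r$ be the associated graded algebras of Calabi-Yau quasi-modular forms and Calabi-Yau modular forms for the Dwork family, with $\mathcal D$ the derivation of $\widetilde{\mathcal M}$ induced by $\mathsf D$ (all as defined in the context). For non-negative integers $r,s,k$ and $f\in\widetilde{\mathcal M}_r$, $g\in\widetilde{\mathcal M}_s$ let $$[f,g]_{\mathcal D,k}:=\sum_{i+j=k}(-1)^j\binom{k+r-1}{i}\binom{k+s-1}{j}\,\mathcal D^jf\cdot\mathcal D^ig .$$ Then for all non-negative integers $r,s,k$ and all $f\in\mathcal M_r$, $g\in\mathcal M_s$ one has $[f,g]_{\mathcal D,k}\in\mathcal M_{r+s+2k}$.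
   Context: Binomial coefficients are $\binom ai=\frac{a(a-1)\cdots(a-i+1)}{i!}$, so $\binom{a}{0}=1$ for every integer $a$. **The moduli space $\mathsf T$.** Fix $n\ge 1$. Put $m=\frac{n+1}2$ if $n$ is odd, $m=\frac n2$ if $n$ is even; $d=\frac{(n+1)(n+3)}4+1$ if $n$ is odd, $d=\frac{n(n+2)}4+1$ if $n$ is even. $\mathsf T=\mathsf T_n$ is the moduli space of pairs $(X,[\alpha_1,\dots,\alpha_{n+1}])$, where $X$ is a mirror $n$-fold of the Dwork family (desingularized quotient of $t_{n+2}x_0^{n+2}+x_1^{n+2}+\dots+x_{n+1}^{n+2}-(n+2)t_1x_0\cdots x_{n+1}=0$ by the group of $(\zeta_0,\dots,\zeta_{n+1})$ with $\zeta_i^{n+2}=1$, $\prod\zeta_i=1$) and $\alpha_1,\dots,\alpha_{n+1}$ is a basis of $H^n_{\rm dR}(X)$ with $\alpha_i\in F^{n+1-i}\setminus F^{n+2-i}$ (Hodge filtration) and intersection matrix $(\langle\alpha_i,\alpha_j\rangle)=\Phi$, where $\Phi=\begin{pmatrix}0&J_m\\-J_m&0\end{pmatrix}$ for $n$ odd, $\Phi=J_{n+1}$ for $n$ even, $J_k$ being the $k\times k$ matrix with $1$'s on the antidiagonal and $0$ elsewhere. It has the following explicit description. Let $B$ be the $(n+1)\times(n+1)$ matrix of $1$-forms in $t_1,t_{n+2}$ (Gauss-Manin matrix in a basis $\omega=(\omega_1,\dots,\omega_{n+1})^{\rm tr}$) with entries: $B[i,i]=-\frac{i}{(n+2)t_{n+2}}dt_{n+2}$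 and $B[i,i+1]=dt_1-\frac{t_1}{(n+2)t_{n+2}}dt_{n+2}$ for $1\le i\le n$; $B[n+1,j]=\frac{-S_2(n+2,j)t_1^j}{t_1^{n+2}-t_{n+2}}dt_1+\frac{S_2(n+2,j)t_1^{j+1}}{(n+2)t_{n+2}(t_1^{n+2}-t_{n+2})}dt_{n+2}$ for $1\le j\le n$; $B[n+1,n+1]=\frac{-S_2(n+2,n+1)t_1^{n+1}}{t_1^{n+2}-t_{n+2}}dt_1+\frac{\frac{n(n+1)}2t_1^{n+2}+(n+1)t_{n+2}}{(n+2)t_{n+2}(t_1^{n+2}-t_{n+2})}dt_{n+2}$; all other entries $0$. Here $S_2$ denotes Stirling numbers of the second kind. Let $\Omega=(\langle\omega_i,\omega_j\rangle)$ be the $(-1)^n$-symmetric matrix determined by $\Omega_{ij}=0$ for $i+j\le n+1$, $\Omega_{1,n+1}=(-(n+2))^n\frac{c_n}{t_1^{n+2}-t_{n+2}}$ ($c_n$ a fixed nonzero constant), $\Omega_{j,n+2-j}=(-1)^{j-1}\Omega_{1,n+1}$, and $d\Omega=B\Omega+\Omega B^{\rm tr}$. Points of $\mathsf T$ are given by $(t_1,t_{n+2})$ with $t_{n+2}(t_1^{n+2}-t_{n+2})\ne0$ and an invertible lower triangular matrix $S=(s_{ij})$ with $s_{11}=1$ and $S\Omega S^{\rm tr}=\Phi$; then $\alpha=S\omega$. Independent coordinates: the entries $s_{ij}$, $i\ge j$, $(i,j)\neq(1,1)$, with $i+j\le n+2$ ($n$ odd) or $i+j<n+2$ ($n$ even),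 read from left to right and top to bottom, are named $t_2,t_3,\dots$ in order, skipping the index $n+2$ (already used). So $t_2=s_{21}$. Let $I=\{1,\dots,d\}$ if $n\ne2$, $I=\{1,2,4\}$ if $n=2$; $(t_j)_{j\in I}$ is the chart. For $n$ even let in addition $u=s_{\frac{n+2}2\frac{n+2}2}$, so $u^2=\frac{(-1)^{n/2}}{c_n(n+2)^n}(t_1^{n+2}-t_{n+2})$ ($u$ is called $t_{d+1}$, and $t_3$ when $n=2$). All other entries of $S$ are regular functions of these, and $\mathcal O_{\mathsf T}=\mathbb C\big[t_j\,(j\in I),\,u,\,\frac1{t_{n+2}(t_{n+2}-t_1^{n+2})\check t}\big]$ ($u$ present only for $n$ even, subject to its quadratic relation), where $\check t$ is the product of the $m-1$ coordinates $t_j$ lying on the main diagonal of $S$. Vector fields on $\mathsf T$ are $\mathbb C$-derivations of $\mathcal O_{\mathsf T}$, written $\sum_{j\in I}E^j\frac{\partial}{\partial t_j}$ ($\frac{\partial}{\partial t_j}$ extends uniquely to $u$). **Vector fields.** For a vector field $E$ its Gauss-Manin matrix $A_E$ (i.e. $\nabla_E\alpha=A_E\alpha$) is determined by $E(S)=A_ES-S\,B(E)$, with $E(S)$ taken entrywise; $E$ is determined by $A_E$. - The modular vector field $\mathsf R$ is the unique vector field for which there are regular functions $\mathsf Y_1,\dots,\mathsf Y_{n-2}$ such that $A_{\mathsf R}=\mathsf Y$, where $\mathsf Y$ has superdiagonal $(1,\mathsf Y_1,\dots,\mathsf Y_{n-2},-1)$ (for $n=2$: $(1,-1)$; for $n=1$: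 $(1)$) and zeros elsewhere, and $\mathsf Y\Phi+\Phi\mathsf Y^{\rm tr}=0$. - For $\mathfrak g$ upper triangular with $\mathfrak g^{\rm tr}\Phi+\Phi\mathfrak g=0$, $\mathsf R_{\mathfrak g}$ is the unique vector field with $A_{\mathsf R_{\mathfrak g}}=\mathfrak g^{\rm tr}$. With $E_{ij}$ the matrix units put $\mathfrak g_{11}=E_{11}-E_{n+1,n+1}$ and, for $n\ge3$, $\mathfrak g_{22}=E_{22}-E_{nn}$. - $\mathsf H:=-\mathsf R_{\mathfrak g_{11}}$ if $n=1$, $\mathsf H:=-2\mathsf R_{\mathfrak g_{11}}$ if $n=2$, $\mathsf H:=\mathsf R_{\mathfrak g_{22}}-\mathsf R_{\mathfrak g_{11}}$ if $n\ge3$. One has $\mathsf H=\sum_{j\in I}w_jt_j\frac{\partial}{\partial t_j}$ with non-negative integers $w_j$: for $n=1$, $(w_1,w_2,w_3)=(1,2,3)$; for $n=2$, $(w_1,w_2,w_4)=(2,2,8)$; for $n\ge3$, $w_1=1$, $w_{n+2}=n+2$, and if $t_j=s_{ik}$ then $w_j=k+1$ for $i\in\{2,n+1\}$, $w_j=k$ for $3\le i\le n-1$, $w_j=k-1$ for $i=n$. **Weights.** $\deg t_j=w_j$, and for $n$ even $\deg u=\frac{n+2}2$ if $n\ge4$, $\deg u=4$ if $n=2$. This makes $\mathcal O_{\mathsf T}$ $\mathbb Z$-graded. **The vector field $\mathsf D$.** Let $\delta_2^n$ be the Kronecker delta. Option 1: $\mathsf D:=\mathsf R$, but for odd $n\ge3$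 the coordinate $t_d$ of the chart is replaced by $\tilde t_d:=t_7+t_2t_4$ if $n=3$ (here $d=7$), $\tilde t_d:=t_d+t_2t_{d-2}$ if $n\ge5$; $\tilde t_d$ has weight $w_d=2$ and is again denoted $t_d$, and all partial derivatives $\frac{\partial}{\partial t_j}$ are with respect to the new chart. Option 2: the original chart is kept and $\mathsf D:=\mathsf R+t_2\big([\mathsf R,(1+\delta_2^n)\frac{\partial}{\partial t_2}]-\mathsf H\big)$. **Calabi-Yau (quasi-)modular forms.** Let $\mathsf t_j$ ($j\in I$; and $\mathsf u$ for $n$ even) be the components of a solution of $\mathsf D$, $\mathsf t_j$ corresponding to the coordinate $t_j$ of the chart used in the chosen option, with $\deg\mathsf t_j=w_j$ (and $\deg \mathsf u=\deg u$). $\widetilde{\mathcal M}$ is the $\mathbb C$-algebra $\mathbb C\big[\mathsf t_j\,(j\in I),\,\mathsf u,\,\frac1{\mathsf t_{n+2}(\mathsf t_{n+2}-\mathsf t_1^{n+2})\check{\mathsf t}}\big]$ and $\mathcal M$ is its subalgebra generated by the same elements with $\mathsf t_2$ omitted, so $\widetilde{\mathcal M}=\mathcal M[\mathsf t_2]$; $\check{\mathsf t}$ corresponds to $\check t$. The $\mathsf t_j$ are treated as independent variables, i.e. $\widetilde{\mathcal M}$ is identified with $\mathcal O_{\mathsf T}$ as a graded algebra via $\mathsf t_j\leftrightarrow t_j$, $\mathsf u\leftrightarrow u$. $\widetilde{\mathcal M}_r$, $\mathcal M_r$ ($r\in\mathbb Z$) denote the weight $r$ parts. $\mathcal D$ is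 the derivation of $\widetilde{\mathcal M}$ obtained from $\mathsf D$ by replacing $t_j$ by $\mathsf t_j$ and $\frac{\partial}{\partial t_j}$ by $\frac{\partial}{\partial\mathsf t_j}$. *)

theory Defs
  imports Complex_Main "HOL-Combinatorics.Stirling" "Jordan_Normal_Form.Matrix"
begin

section \<open>Matrices with entries numbered from 1\<close>

definition mat1 :: "nat \<Rightarrow> (nat \<Rightarrow> nat \<Rightarrow> 'a) \<Rightarrow> 'a mat" where
  "mat1 N a = mat N N (\<lambda>(i, j). a (i + 1) (j + 1))"

definition entry :: "'a mat \<Rightarrow> nat \<Rightarrow> nat \<Rightarrow> 'a" where
  "entry A i j = A $$ (i - 1, j - 1)"

definition mat_unit :: "nat \<Rightarrow> nat \<Rightarrow> nat \<Rightarrow> complex mat" where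
  "mat_unit N k l = mat1 N (\<lambda>i j. if i = k \<and> j = l then 1 else 0)"

definition antidiag :: "nat \<Rightarrow> complex mat" where
  "antidiag k = mat1 k (\<lambda>i j. if i + j = k + 1 then 1 else 0)"

section \<open>The moduli space and its regular functions\<close>

definition half_dim :: "nat \<Rightarrow> nat" where
  "half_dim n = (if odd n then (n + 1) div 2 else n div 2)"

definition top_index :: "nat \<Rightarrow> nat" where
  "top_index n = (if odd n then (n + 1) * (n + 3) div 4 + 1 else n * (n + 2) div 4 + 1)"

definition Phi :: "nat \<Rightarrow> complex mat" where
  "Phi n = (if odd n
     then (let m = half_dim n in
            four_block_mat (0\<^sub>m m m) (antidiag m) (- antidiag m) (0\<^sub>m m m))
     else antidiag (n + 1))"

text \<open>The Gauss-Manin matrix is \<open>GM1 n x y dt\<^sub>1 + GM2 n x y dt\<^bsub>n+2\<^esub>\<close>, where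
  \<open>x\<close> and \<open>y\<close> stand for \<open>t\<^sub>1\<close> and \<open>t\<^bsub>n+2\<^esub>\<close>.\<close>

definition GM1 :: "nat \<Rightarrow> complex \<Rightarrow> complex \<Rightarrow> complex mat" where
  "GM1 n x y = mat1 (n + 1) (\<lambda>i j.
     if i \<le> n then (if j = i + 1 then 1 else 0)
     else - of_nat (Stirling (n + 2) j) * x ^ j / (x ^ (n + 2) - y))"

definition GM2 :: "nat \<Rightarrow> complex \<Rightarrow> complex \<Rightarrow> complex mat" where
  "GM2 n x y = mat1 (n + 1) (\<lambda>i j.
     if i \<le> n then
       (if j = i then - of_nat i / (of_nat (n + 2) * y)
        else if j = i + 1 then - x / (of_nat (n + 2) * y)
        else 0)
     else if j \<le> n then
       of_nat (Stirling (n + 2) j) * x ^ (j + 1) / (of_nat (n + 2) * y * (x ^ (n + 2) - y))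
     else
       (of_nat (n * (n + 1)) / 2 * x ^ (n + 2) + of_nat (n + 1) * y)
         / (of_nat (n + 2) * y * (x ^ (n + 2) - y)))"

definition good_param :: "nat \<Rightarrow> complex \<Rightarrow> complex \<Rightarrow> bool" where
  "good_param n x y \<longleftrightarrow> y * (x ^ (n + 2) - y) \<noteq> 0"

text \<open>\<open>W x y\<close> is the intersection matrix \<open>\<Omega>\<close>; the last two conjuncts are the two components
  of \<open>d\<Omega> = B \<Omega> + \<Omega> B\<^sup>t\<^sup>r\<close>. Together the conditions determine \<open>W\<close> at all good parameters:
  the \<open>dt\<^sub>1\<close> component computes each antidiagonal from the preceding ones.\<close>

definition is_intersection_matrix ::
  "nat \<Rightarrow> complex \<Rightarrow> (complex \<Rightarrow> complex \<Rightarrow> complex mat) \<Rightarrow> bool" where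
  "is_intersection_matrix n c W \<longleftrightarrow>
     (\<forall>x y. good_param n x y \<longrightarrow>
        W x y \<in> carrier_mat (n + 1) (n + 1) \<and>
        transpose_mat (W x y) = (- 1) ^ n \<cdot>\<^sub>m W x y \<and>
        (\<forall>i\<in>{1..n+1}. \<forall>j\<in>{1..n+1}. i + j \<le> n + 1 \<longrightarrow> entry (W x y) i j = 0) \<and>
        entry (W x y) 1 (n + 1) = (- of_nat (n + 2)) ^ n * (c / (x ^ (n + 2) - y)) \<and>
        (\<forall>j\<in>{1..n+1}.
           entry (W x y) j (n + 2 - j) = (- 1) ^ (j - 1) * entry (W x y) 1 (n + 1)) \<and>
        (\<forall>i\<in>{1..n+1}. \<forall>j\<in>{1..n+1}.
           ((\<lambda>z. entry (W z y) i j) has_field_derivative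
              entry (GM1 n x y * W x y + W x y * transpose_mat (GM1 n x y)) i j) (at x)) \<and>
        (\<forall>i\<in>{1..n+1}. \<forall>j\<in>{1..n+1}.
           ((\<lambda>z. entry (W x z) i j) has_field_derivative
              entry (GM2 n x y * W x y + W x y * transpose_mat (GM2 n x y)) i j) (at y)))"

type_synonym pt = "complex \<times> complex \<times> complex mat"
type_synonym fn = "pt \<Rightarrow> complex"

definition moduli ::
  "nat \<Rightarrow> (complex \<Rightarrow> complex \<Rightarrow> complex mat) \<Rightarrow> pt set" where
  "moduli n W = {(x, y, S). good_param n x y \<and>
     S \<in> carrier_mat (n + 1) (n + 1) \<and> invertible_mat S \<and>
     (\<forall>i\<in>{1..n+1}. \<forall>j\<in>{1..n+1}. i < j \<longrightarrow> entry S i j = 0) \<and>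
     entry S 1 1 = 1 \<and>
     S * W x y * transpose_mat S = Phi n}"

fun t_one :: fn where "t_one (x, y, S) = x"
fun t_disc :: fn where "t_disc (x, y, S) = y"
fun s_entry :: "nat \<Rightarrow> nat \<Rightarrow> fn" where "s_entry i j (x, y, S) = entry S i j"

text \<open>Functions on a set \<open>X\<close> of points are represented by functions vanishing off \<open>X\<close>.\<close>

definition on :: "pt set \<Rightarrow> fn \<Rightarrow> fn" where
  "on X f = (\<lambda>p. if p \<in> X then f p else 0)"

inductive_set alg_gen :: "pt set \<Rightarrow> fn set \<Rightarrow> fn set" for X :: "pt set" and G :: "fn set" where
  const: "on X (\<lambda>p. c) \<in> alg_gen X G"
| gen: "g \<in> G \<Longrightarrow> on X g \<in> alg_gen X G"
| add: "f \<in> alg_gen X G \<Longrightarrow> g \<in> alg_gen X G \<Longrightarrow> (\<lambda>p. f p + g p) \<in> alg_gen X G"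
| mult: "f \<in> alg_gen X G \<Longrightarrow> g \<in> alg_gen X G \<Longrightarrow> (\<lambda>p. f p * g p) \<in> alg_gen X G"

text \<open>The weight \<open>r\<close> part of the algebra generated by the functions \<open>g\<close> of weight \<open>w\<close>,
  \<open>(g, w) \<in> G\<close>.\<close>

inductive wt_part :: "pt set \<Rightarrow> (fn \<times> int) set \<Rightarrow> int \<Rightarrow> fn \<Rightarrow> bool"
  for X :: "pt set" and G :: "(fn \<times> int) set" where
  zero: "wt_part X G r (\<lambda>p. 0)"
| const: "wt_part X G 0 (on X (\<lambda>p. c))"
| gen: "(g, w) \<in> G \<Longrightarrow> wt_part X G w (on X g)"
| add: "wt_part X G r f \<Longrightarrow> wt_part X G r g \<Longrightarrow> wt_part X G r (\<lambda>p. f p + g p)"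
| mult: "wt_part X G r f \<Longrightarrow> wt_part X G s g \<Longrightarrow> wt_part X G (r + s) (\<lambda>p. f p * g p)"

section \<open>Charts and weights\<close>

text \<open>Positions \<open>(i, k)\<close> of the independent entries of \<open>S\<close>, left to right and top to bottom;
  they are named \<open>t\<^sub>2, t\<^sub>3, \<dots>\<close> with the name \<open>t\<^bsub>n+2\<^esub>\<close> skipped.\<close>

definition positions :: "nat \<Rightarrow> (nat \<times> nat) list" where
  "positions n = [(i, k). i \<leftarrow> [1..<n+2], k \<leftarrow> [1..<i+1],
     (i, k) \<noteq> (1, 1) \<and> (if odd n then i + k \<le> n + 2 else i + k < n + 2)]"

definition position :: "nat \<Rightarrow> nat \<Rightarrow> nat \<times> nat" where
  "position n j = positions n ! (if j < n + 2 then j - 2 else j - 3)"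

definition index_set :: "nat \<Rightarrow> nat set" where
  "index_set n = (if n = 2 then {1, 2, 4} else {1..top_index n})"

definition coord :: "nat \<Rightarrow> nat \<Rightarrow> fn" where
  "coord n j =
     (if j = 1 then t_one
      else if j = n + 2 then t_disc
      else s_entry (fst (position n j)) (snd (position n j)))"

datatype version = Option1 | Option2

definition chart :: "version \<Rightarrow> nat \<Rightarrow> nat \<Rightarrow> fn" where
  "chart v n j =
     (if v = Option1 \<and> odd n \<and> n \<ge> 3 \<and> j = top_index n
      then (\<lambda>p. coord n j p + coord n 2 p * coord n (if n = 3 then 4 else j - 2) p)
      else coord n j)"

text \<open>The function \<open>u\<close>, for even \<open>n\<close> only.\<close>

definition u_fn :: "nat \<Rightarrow> fn" where
  "u_fn n = s_entry ((n + 2) div 2) ((n + 2) div 2)"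

text \<open>The coordinates on the main diagonal of \<open>S\<close> are the \<open>s\<^sub>i\<^sub>i\<close> with \<open>2 \<le> i \<le> m\<close>.\<close>

definition t_check :: "nat \<Rightarrow> fn" where
  "t_check n p = (\<Prod>i\<in>{2..half_dim n}. s_entry i i p)"

definition inv_fn :: "nat \<Rightarrow> fn" where
  "inv_fn n p = 1 / (t_disc p * (t_disc p - t_one p ^ (n + 2)) * t_check n p)"

text \<open>The weight of the coordinate \<open>s\<^sub>i\<^sub>k\<close>, for \<open>n \<ge> 3\<close>.\<close>

definition pos_weight :: "nat \<Rightarrow> nat \<Rightarrow> nat \<Rightarrow> int" where
  "pos_weight n i k =
     (if i = 2 \<or> i = n + 1 then int k + 1 else if i = n then int k - 1 else int k)"

definition weight :: "nat \<Rightarrow> nat \<Rightarrow> int" where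
  "weight n j =
     (if n = 1 then int j
      else if n = 2 then (if j = 4 then 8 else 2)
      else if j = 1 then 1
      else if j = n + 2 then int n + 2
      else pos_weight n (fst (position n j)) (snd (position n j)))"

definition u_weight :: "nat \<Rightarrow> int" where
  "u_weight n = (if n = 2 then 4 else (int n + 2) div 2)"

definition inv_weight :: "nat \<Rightarrow> int" where
  "inv_weight n = - (2 * weight n (n + 2) + (\<Sum>i\<in>{2..half_dim n}. pos_weight n i i))"

definition wt_gens :: "version \<Rightarrow> nat \<Rightarrow> nat set \<Rightarrow> (fn \<times> int) set" where
  "wt_gens v n J = {(chart v n j, weight n j) | j. j \<in> J}
     \<union> (if even n then {(u_fn n, u_weight n)} else {})
     \<union> {(inv_fn n, inv_weight n)}"

definition gens :: "version \<Rightarrow> nat \<Rightarrow> nat set \<Rightarrow> fn set" where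
  "gens v n J = fst ` wt_gens v n J"

definition regular_fns :: "nat \<Rightarrow> (complex \<Rightarrow> complex \<Rightarrow> complex mat) \<Rightarrow> fn set" where
  "regular_fns n W = alg_gen (moduli n W) (gens Option2 n (index_set n))"

section \<open>Vector fields\<close>

text \<open>Only the restriction of \<open>E\<close> to \<open>regular_fns n W\<close> matters.\<close>

definition vector_field ::
  "nat \<Rightarrow> (complex \<Rightarrow> complex \<Rightarrow> complex mat) \<Rightarrow> (fn \<Rightarrow> fn) \<Rightarrow> bool" where
  "vector_field n W E \<longleftrightarrow>
     (\<forall>f\<in>regular_fns n W. E f \<in> regular_fns n W) \<and>
     (\<forall>f\<in>regular_fns n W. \<forall>g\<in>regular_fns n W.
        E (\<lambda>p. f p + g p) = (\<lambda>p. E f p + E g p)) \<and>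
     (\<forall>f\<in>regular_fns n W. \<forall>c. E (\<lambda>p. c * f p) = (\<lambda>p. c * E f p)) \<and>
     (\<forall>f\<in>regular_fns n W. \<forall>g\<in>regular_fns n W.
        E (\<lambda>p. f p * g p) = (\<lambda>p. f p * E g p + g p * E f p))"

definition is_partial ::
  "nat \<Rightarrow> (complex \<Rightarrow> complex \<Rightarrow> complex mat) \<Rightarrow> nat \<Rightarrow> (fn \<Rightarrow> fn) \<Rightarrow> bool" where
  "is_partial n W k P \<longleftrightarrow> vector_field n W P \<and>
     (\<forall>j\<in>index_set n. P (on (moduli n W) (coord n j))
        = on (moduli n W) (\<lambda>p. if j = k then 1 else 0))"

text \<open>\<open>A\<close> is the Gauss-Manin matrix of \<open>E\<close>: \<open>E(S) = A S - S B(E)\<close> on the moduli space.\<close>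

definition has_GM_matrix ::
  "nat \<Rightarrow> (complex \<Rightarrow> complex \<Rightarrow> complex mat) \<Rightarrow> (fn \<Rightarrow> fn) \<Rightarrow> (pt \<Rightarrow> complex mat) \<Rightarrow> bool" where
  "has_GM_matrix n W E A \<longleftrightarrow>
     (\<forall>x y S. (x, y, S) \<in> moduli n W \<longrightarrow>
        mat1 (n + 1) (\<lambda>i j. E (on (moduli n W) (s_entry i j)) (x, y, S)) =
        A (x, y, S) * S -
        S * (E (on (moduli n W) t_one) (x, y, S) \<cdot>\<^sub>m GM1 n x y
             + E (on (moduli n W) t_disc) (x, y, S) \<cdot>\<^sub>m GM2 n x y))"

text \<open>\<open>Y_mat n Y\<close> has superdiagonal \<open>(1, Y\<^sub>1, \<dots>, Y\<^bsub>n-2\<^esub>, -1)\<close>, which is \<open>(1)\<close> for \<open>n = 1\<close>.\<close>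

definition Y_mat :: "nat \<Rightarrow> (nat \<Rightarrow> fn) \<Rightarrow> pt \<Rightarrow> complex mat" where
  "Y_mat n Y p = mat1 (n + 1) (\<lambda>i j.
     if j = i + 1 then (if i = 1 then 1 else if i = n then - 1 else Y (i - 1) p) else 0)"

definition is_modular_vf ::
  "nat \<Rightarrow> (complex \<Rightarrow> complex \<Rightarrow> complex mat) \<Rightarrow> (fn \<Rightarrow> fn) \<Rightarrow> bool" where
  "is_modular_vf n W R \<longleftrightarrow> vector_field n W R \<and>
     (\<exists>Y. (\<forall>i. 1 \<le> i \<and> i + 2 \<le> n \<longrightarrow> Y i \<in> regular_fns n W) \<and>
        has_GM_matrix n W R (Y_mat n Y) \<and>
        (\<forall>p\<in>moduli n W.
           Y_mat n Y p * Phi n + Phi n * transpose_mat (Y_mat n Y p) = 0\<^sub>m (n + 1) (n + 1)))"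

definition is_Lie_vf ::
  "nat \<Rightarrow> (complex \<Rightarrow> complex \<Rightarrow> complex mat) \<Rightarrow> complex mat \<Rightarrow> (fn \<Rightarrow> fn) \<Rightarrow> bool" where
  "is_Lie_vf n W g E \<longleftrightarrow> vector_field n W E \<and> has_GM_matrix n W E (\<lambda>p. transpose_mat g)"

definition g11 :: "nat \<Rightarrow> complex mat" where
  "g11 n = mat_unit (n + 1) 1 1 - mat_unit (n + 1) (n + 1) (n + 1)"

definition g22 :: "nat \<Rightarrow> complex mat" where
  "g22 n = mat_unit (n + 1) 2 2 - mat_unit (n + 1) n n"

definition is_H ::
  "nat \<Rightarrow> (complex \<Rightarrow> complex \<Rightarrow> complex mat) \<Rightarrow> (fn \<Rightarrow> fn) \<Rightarrow> bool" where
  "is_H n W H \<longleftrightarrow>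
     (\<exists>R1. is_Lie_vf n W (g11 n) R1 \<and>
       (if n = 1 then \<forall>f\<in>regular_fns n W. H f = (\<lambda>p. - R1 f p)
        else if n = 2 then \<forall>f\<in>regular_fns n W. H f = (\<lambda>p. - 2 * R1 f p)
        else \<exists>R2. is_Lie_vf n W (g22 n) R2 \<and>
               (\<forall>f\<in>regular_fns n W. H f = (\<lambda>p. R2 f p - R1 f p))))"

text \<open>In the second case \<open>\<partial>/\<partial>t\<^sub>2\<close> refers to the original chart.\<close>

definition is_D ::
  "version \<Rightarrow> nat \<Rightarrow> (complex \<Rightarrow> complex \<Rightarrow> complex mat) \<Rightarrow> (fn \<Rightarrow> fn) \<Rightarrow> bool" where
  "is_D v n W D \<longleftrightarrow> (case v of
     Option1 \<Rightarrow> is_modular_vf n W D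
   | Option2 \<Rightarrow> (\<exists>R P H. is_modular_vf n W R \<and> is_partial n W 2 P \<and> is_H n W H \<and>
       (\<forall>f\<in>regular_fns n W. D f = (\<lambda>p. R f p + coord n 2 p *
          ((if n = 2 then 2 else 1) * (R (P f) p - P (R f) p) - H f p)))))"

section \<open>Calabi-Yau quasi-modular forms\<close>

text \<open>The algebra of quasi-modular forms is identified with \<open>regular_fns n W\<close>, so that the
  derivation it carries is the vector field itself.\<close>

definition QM :: "version \<Rightarrow> nat \<Rightarrow> (complex \<Rightarrow> complex \<Rightarrow> complex mat) \<Rightarrow> fn set" where
  "QM v n W = alg_gen (moduli n W) (gens v n (index_set n))"

definition MF :: "version \<Rightarrow> nat \<Rightarrow> (complex \<Rightarrow> complex \<Rightarrow> complex mat) \<Rightarrow> fn set" where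
  "MF v n W = alg_gen (moduli n W) (gens v n (index_set n - {2}))"

definition QM_wt ::
  "version \<Rightarrow> nat \<Rightarrow> (complex \<Rightarrow> complex \<Rightarrow> complex mat) \<Rightarrow> int \<Rightarrow> fn set" where
  "QM_wt v n W r =
     {f \<in> QM v n W. wt_part (moduli n W) (wt_gens v n (index_set n)) r f}"

definition MF_wt ::
  "version \<Rightarrow> nat \<Rightarrow> (complex \<Rightarrow> complex \<Rightarrow> complex mat) \<Rightarrow> int \<Rightarrow> fn set" where
  "MF_wt v n W r = MF v n W \<inter> QM_wt v n W r"

definition RC_bracket ::
  "(fn \<Rightarrow> fn) \<Rightarrow> nat \<Rightarrow> nat \<Rightarrow> nat \<Rightarrow> fn \<Rightarrow> fn \<Rightarrow> fn" where
  "RC_bracket D k r s f g = (\<lambda>p. \<Sum>(i, j)\<in>{(i, j). i + j = k}.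
     (- 1) ^ j * (of_int (int k + int r - 1) gchoose i) * (of_int (int k + int s - 1) gchoose j)
       * (D ^^ j) f p * (D ^^ i) g p)"

end

(*
The modular vector field R raises the weight by 2, and it is quadratic in t_2 in the same way in
which the Ramanujan vector field is quadratic in E_2: with a normalisation kappa (1/2 for n = 2
and 1 otherwise), D f + kappa r t_2 f is free of t_2 for every modular form f of weight r, and so
is D t_2 + kappa t_2^2. For n >= 3 this is seen by passing from S to q = exp(-t_2 e) S, where e, the
superdiagonal of the Gauss-Manin matrix of R and the weight matrix h span a copy of sl_2. The matrix
q satisfies the same relations as S, and solving these relations row by row shows that all entries
of q that matter are modular forms. In Option 2 the correction term t_2([R, d/dt_2] - H) vanishes on
all generators but two, where it restores the Ramanujan shape.

A derivation of this shape has Rankin-Cohen brackets free of t_2: expanding D^k f in powers of t_2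
(the Cohen-Kuznetsov series), the coefficient of each positive power of t_2 in the bracket is an
alternating sum of binomial coefficients, which vanishes.

Weights of functions are detected by a scaling action on the moduli space, which replaces any appeal
to algebraic independence of the coordinates.
*)
theory Submission
  imports Defs "HOL-Computational_Algebra.Polynomial"
begin

section \<open>Rankin-Cohen brackets of derivations of Ramanujan type\<close>

text \<open>For odd n >= 3 the form \<open>Phi\<close> is alternating, so the norm of a row of q
  carries no information and the relations do not reach the corner entry q_{n+1,1} = s_{n+1,1} + t_2
  s_{n,1}. It has to be a generator by decree, and it is exactly the coordinate that Option 1
  substitutes for t_d. Option 2 instead declares s_{n+1,1} itself modular; then R s_{n,1} and R
  s_{n+1,1} have the wrong coefficient at t_2. Writing R g = m + t_2 nu with m and nu free of t_2,
  the commutator [R, d/dt_2] maps g to -nu, so the correction erases t_2 nu and puts -r t_2 g in its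
  place, whatever nu was. For even n the norm relation yields the corner entry, and the two options
  have the same generators. The value kappa = 1/2 for n = 2 only reflects that H = -2 R_{g11}
  doubles all weights there.\<close>

definition rc_coeff :: "nat \<Rightarrow> nat \<Rightarrow> nat \<Rightarrow> complex" where
  "rc_coeff r k l = of_nat (k choose l) * pochhammer (of_nat r + of_nat l) (k - l)"

lemma rc_coeff_eq_0: "k < l \<Longrightarrow> rc_coeff r k l = 0"
  by (simp add: rc_coeff_def binomial_eq_0)

lemma rc_coeff_self [simp]: "rc_coeff r k k = 1"
  by (simp add: rc_coeff_def)

text \<open>Balances two terms of D^{k+1} f: the recursion of \<open>thetas\<close> lowers the index
  l + 1 to l, and the derivative of \<open>\<phi>\<close> contributes at l. This is what makes them
  cancel in \<open>D_iterate\<close>.\<close>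

lemma rc_coeff_shift:
  assumes "l < k"
  shows "rc_coeff r k (Suc l) * (of_nat (Suc l) * (of_nat r + of_nat l))
       = rc_coeff r k l * of_nat (k - l)"
proof -
  obtain m where k: "k = Suc (l + m)" using assms less_iff_Suc_add by auto
  have "Suc l * (k choose Suc l) = (k - l) * (k choose l)"
    by (metis binomial_absorb_comp binomial_absorption k mult.commute)
  then have b: "of_nat (Suc l) * (of_nat (k choose Suc l) :: complex) = of_nat (k - l) * of_nat (k choose l)"
    by (metis of_nat_mult)
  have p: "pochhammer (of_nat r + of_nat l :: complex) (k - l)
      = (of_nat r + of_nat l) * pochhammer (of_nat r + of_nat (Suc l)) (k - Suc l)"
    by (simp add: k pochhammer_rec add.assoc) (simp add: ac_simps)
  show ?thesis
    unfolding rc_coeff_def p using b by (simp add: ac_simps)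
qed

text \<open>The effect of one more application of D: \<open>thetas\<close> at l moves up to l + 1
  with factor 1, while the term at l + 1 keeps its index with the factor (k - (l + 1)) + (r + 2 (l +
  1)) from the power of \<open>\<phi>\<close> and from the weight.\<close>

lemma rc_coeff_Suc:
  assumes "l \<le> k"
  shows "rc_coeff r (Suc k) (Suc l) = rc_coeff r k l
     + rc_coeff r k (Suc l) * (of_nat r + of_nat k + of_nat (Suc l))"
proof (cases "l = k")
  case True then show ?thesis by (simp add: rc_coeff_eq_0)
next
  case False
  then obtain m where k: "k = Suc (l + m)" using assms less_iff_Suc_add le_neq_implies_less by metis
  define P where "P = pochhammer (of_nat r + of_nat (Suc l) :: complex) m"
  have "Suc l * (k choose Suc l) = (k - l) * (k choose l)"
    by (metis binomial_absorb_comp binomial_absorption k mult.commute)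
  then have b: "(of_nat l + 1) * (of_nat (k choose Suc l) :: complex) = of_nat (Suc m) * of_nat (k choose l)"
    using k by (metis Suc_diff_le add_diff_cancel_left' le_add1 of_nat_Suc of_nat_mult add.commute)
  have 1: "rc_coeff r k l = of_nat (k choose l) * (of_nat r + of_nat l) * P"
    by (simp add: k rc_coeff_def pochhammer_rec add.assoc P_def) (simp add: ac_simps)
  have 2: "rc_coeff r k (Suc l) = of_nat (k choose Suc l) * P"
    by (simp add: k rc_coeff_def P_def)
  have 3: "rc_coeff r (Suc k) (Suc l) = (of_nat (k choose l) + of_nat (k choose Suc l)) * P * (of_nat r + of_nat k)"
  proof -
    have "pochhammer (of_nat r + of_nat (Suc l) :: complex) (Suc k - Suc l) = P * (of_nat r + of_nat k)"
      by (simp add: k P_def pochhammer_Suc add.assoc)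
    then show ?thesis unfolding rc_coeff_def by (simp add: mult.assoc)
  qed
  have "of_nat (k choose l) * of_nat k + of_nat (k choose Suc l) * 0 + of_nat (k choose Suc l) * (0::complex)
     = of_nat (k choose l) * of_nat l + (of_nat l + 1) * of_nat (k choose Suc l)"
    unfolding b by (simp add: k algebra_simps)
  then have "(of_nat (k choose l) + of_nat (k choose Suc l)) * (of_nat r + of_nat k)
     = of_nat (k choose l) * (of_nat r + of_nat l)
     + (of_nat (k choose Suc l) :: complex) * (of_nat r + of_nat k + of_nat (Suc l))"
    by (simp add: algebra_simps)
  then have "(of_nat (k choose l) + of_nat (k choose Suc l)) * (of_nat r + of_nat k) * P
     = (of_nat (k choose l) * (of_nat r + of_nat l)
     + (of_nat (k choose Suc l) :: complex) * (of_nat r + of_nat k + of_nat (Suc l))) * P"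
    by simp
  then show ?thesis unfolding 1 2 3 by (simp add: algebra_simps)
qed

lemma rc_coeff_Suc_0: "rc_coeff r (Suc k) 0 = rc_coeff r k 0 * (of_nat r + of_nat k)"
  by (simp add: rc_coeff_def pochhammer_Suc)

text \<open>The binomial coefficient of the bracket is the missing tail of the Pochhammer symbol in
  \<open>rc_coeff\<close>. Together they give (r + l)_{k-l}, which no longer depends on j and can be
  taken out of the sum over j.\<close>

lemma rc_coeff_gbinomial:
  assumes "j \<le> k"
  shows "(of_int (int k + int r - 1) gchoose (k - j)) * rc_coeff r j l
       = pochhammer (of_nat r + of_nat l) (k - l) * of_nat (j choose l) / fact (k - j)"
proof (cases "l \<le> j")
  case True
  have "(of_int (int k + int r - 1) :: complex) - of_nat (k - j) + 1 = of_nat r + of_nat j"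
    using assms by (simp add: of_nat_diff)
  then have "(of_int (int k + int r - 1) :: complex) gchoose (k - j)
      = pochhammer (of_nat r + of_nat j) (k - j) / fact (k - j)"
    by (simp only: gbinomial_pochhammer')
  moreover have "pochhammer (of_nat r + of_nat l :: complex) (k - l)
     = pochhammer (of_nat r + of_nat l) (j - l) * pochhammer (of_nat r + of_nat j) (k - j)"
    using pochhammer_product[of "j - l" "k - l" "of_nat r + of_nat l :: complex"] True assms
    by (simp add: of_nat_diff)
  ultimately show ?thesis by (simp add: rc_coeff_def)
qed (simp add: rc_coeff_eq_0 binomial_eq_0)

text \<open>After cancelling factorials and putting j = l + t this is, up to sign, (1 - 1)^N / (l!
  m! N!) with N = k - l - m > 0.\<close>

lemma alternating_sum_inverse_fact:
  assumes "l + m < k"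
  shows "(\<Sum>j\<le>k. (-1) ^ j * (of_nat (j choose l) / fact j) * (of_nat ((k - j) choose m) / fact (k - j)))
     = (0 :: complex)"
proof -
  define N where "N = k - l - m"
  have N: "N > 0" "k = l + N + m" using assms by (auto simp: N_def)
  let ?f = "\<lambda>j. (-1) ^ j * (of_nat (j choose l) / fact j) * (of_nat ((k - j) choose m) / fact (k - j)) :: complex"
  have "(\<Sum>j\<le>k. ?f j) = (\<Sum>j\<in>{l..l+N}. ?f j)"
    by (rule sum.mono_neutral_right) (auto simp: N binomial_eq_0 not_le)
  also have "\<dots> = (\<Sum>t\<le>N. ?f (l + t))"
    by (rule sum.reindex_bij_witness[of _ "\<lambda>t. l + t" "\<lambda>j. j - l"]) auto
  also have "\<dots> = (\<Sum>t\<le>N. (-1) ^ l / (fact l * fact m * fact N) * ((-1) ^ t * of_nat (N choose t)))"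
  proof (rule sum.cong[OF refl])
    fix t assume "t \<in> {..N}"
    then have t: "t \<le> N" by simp
    have a: "of_nat (l + t choose l) / fact (l + t) = (1 / (fact l * fact t) :: complex)"
      by (simp add: binomial_fact)
    have "k - (l + t) = m + (N - t)" using t N by simp
    then have b: "of_nat ((k - (l + t)) choose m) / fact (k - (l + t)) = (1 / (fact m * fact (N - t)) :: complex)"
      by (simp add: binomial_fact)
    show "?f (l + t) = (-1) ^ l / (fact l * fact m * fact N) * ((-1) ^ t * of_nat (N choose t))"
      unfolding a b using t by (simp add: binomial_fact power_add)
  qed
  also have "\<dots> = 0"
    unfolding sum_distrib_left[symmetric] using choose_alternating_sum[OF N(1), where 'a=complex] by simp
  finally show ?thesis .
qed

text \<open>\<open>Q\<close> models quasi-modular forms and \<open>M i\<close> modular forms of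
  weight i. In the classical case \<open>\<phi>\<close> is -E_2/12: the last two axioms are then the
  modularity of the Serre derivative and Ramanujan's equation for E_2, with E_4/144 as the form of
  weight 4.\<close>

locale ramanujan_derivation =
  fixes D :: "('a \<Rightarrow> complex) \<Rightarrow> 'a \<Rightarrow> complex"
    and Q :: "('a \<Rightarrow> complex) set"
    and M :: "int \<Rightarrow> ('a \<Rightarrow> complex) set"
    and \<phi> :: "'a \<Rightarrow> complex"
  assumes Q_add: "f \<in> Q \<Longrightarrow> g \<in> Q \<Longrightarrow> (\<lambda>p. f p + g p) \<in> Q"
    and Q_mult: "f \<in> Q \<Longrightarrow> g \<in> Q \<Longrightarrow> (\<lambda>p. f p * g p) \<in> Q"
    and Q_scale: "f \<in> Q \<Longrightarrow> (\<lambda>p. a * f p) \<in> Q"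
    and D_add: "f \<in> Q \<Longrightarrow> g \<in> Q \<Longrightarrow> D (\<lambda>p. f p + g p) = (\<lambda>p. D f p + D g p)"
    and D_scale: "f \<in> Q \<Longrightarrow> D (\<lambda>p. a * f p) = (\<lambda>p. a * D f p)"
    and D_mult: "f \<in> Q \<Longrightarrow> g \<in> Q \<Longrightarrow> D (\<lambda>p. f p * g p) = (\<lambda>p. f p * D g p + g p * D f p)"
    and M_Q: "f \<in> M i \<Longrightarrow> f \<in> Q"
    and M_add: "f \<in> M i \<Longrightarrow> g \<in> M i \<Longrightarrow> (\<lambda>p. f p + g p) \<in> M i"
    and M_scale: "f \<in> M i \<Longrightarrow> (\<lambda>p. a * f p) \<in> M i"
    and M_mult: "f \<in> M i \<Longrightarrow> g \<in> M j \<Longrightarrow> (\<lambda>p. f p * g p) \<in> M (i + j)"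
    and phi_Q: "\<phi> \<in> Q"
    and D_M: "f \<in> M i \<Longrightarrow> (\<lambda>p. D f p + of_int i * \<phi> p * f p) \<in> M (i + 2)"
    and D_phi: "(\<lambda>p. D \<phi> p + \<phi> p * \<phi> p) \<in> M 4"
begin

definition \<beta> :: "'a \<Rightarrow> complex" where "\<beta> p = D \<phi> p + \<phi> p * \<phi> p"

definition theta :: "nat \<Rightarrow> ('a \<Rightarrow> complex) \<Rightarrow> 'a \<Rightarrow> complex" where
  "theta i f p = D f p + of_nat i * \<phi> p * f p"

text \<open>Zagier's modified iterates of the Serre derivative. The subtracted multiple of
  \<open>\<beta>\<close> absorbs the \<open>\<beta>\<close> that comes from D \<open>\<phi>\<close>,
  so that D^k f is a polynomial in -\<open>\<phi>\<close> whose coefficients are multiples of these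
  modular iterates.\<close>

fun thetas :: "nat \<Rightarrow> ('a \<Rightarrow> complex) \<Rightarrow> nat \<Rightarrow> 'a \<Rightarrow> complex" where
  "thetas r f 0 = f"
| "thetas r f (Suc 0) = theta r f"
| "thetas r f (Suc (Suc l)) = (\<lambda>p. theta (r + 2 * Suc l) (thetas r f (Suc l)) p
     - of_nat (Suc l) * (of_nat r + of_nat l) * (\<beta> p * thetas r f l p))"

lemma thetas_M: "f \<in> M (int r) \<Longrightarrow> thetas r f l \<in> M (int (r + 2 * l))"
proof (induction r f l rule: thetas.induct)
  case (1 r f) then show ?case by simp
next
  case (2 r f)
  show ?case using D_M[OF 2] by (simp add: theta_def[abs_def] add.commute)
next
  case (3 r f l)
  have a: "theta (r + 2 * Suc l) (thetas r f (Suc l)) \<in> M (int (r + 2 * Suc (Suc l)))"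
    using D_M[OF 3(1)[OF 3(3)]] by (simp add: theta_def[abs_def] algebra_simps)
  have "(\<lambda>p. \<beta> p * thetas r f l p) \<in> M (4 + int (r + 2 * l))"
    using M_mult[OF D_phi 3(2)[OF 3(3)]] by (simp add: \<beta>_def)
  moreover have "4 + int (r + 2 * l) = int (r + 2 * Suc (Suc l))" by simp
  ultimately have "(\<lambda>p. \<beta> p * thetas r f l p) \<in> M (int (r + 2 * Suc (Suc l)))" by simp
  from M_add[OF a M_scale[OF this, of "- (of_nat (Suc l) * (of_nat r + of_nat l))"]]
  show ?case by simp
qed

lemma D_thetas:
  "D (thetas r f l) p = thetas r f (Suc l) p - of_nat (r + 2 * l) * \<phi> p * thetas r f l p
     + (if l = 0 then 0 else of_nat l * (of_nat r + of_nat (l - 1)) * (\<beta> p * thetas r f (l - 1) p))"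
  by (cases l) (auto simp: theta_def)

lemma Q_pow: "f \<in> Q \<Longrightarrow> (\<lambda>p. (- \<phi> p) ^ m * f p) \<in> Q"
proof (induction m)
  case (Suc m)
  have "(\<lambda>p. (-1) * (\<phi> p * ((- \<phi> p) ^ m * f p))) \<in> Q"
    by (intro Q_scale Q_mult phi_Q Suc)
  then show ?case by (simp add: mult.assoc)
qed simp

lemma D_pow:
  assumes "f \<in> Q"
  shows "D (\<lambda>p. (- \<phi> p) ^ m * f p) = (\<lambda>p. (- \<phi> p) ^ m * D f p
     + of_nat m * ((- \<phi> p) ^ Suc m - \<beta> p * (- \<phi> p) ^ (m - 1)) * f p)"
proof (induction m)
  case (Suc m)
  let ?g = "\<lambda>p. (- \<phi> p) ^ m * f p"
  have g: "?g \<in> Q" by (rule Q_pow[OF assms])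
  have "(\<lambda>p. (- \<phi> p) ^ Suc m * f p) = (\<lambda>p. (-1) * (\<phi> p * ?g p))" by (simp add: fun_eq_iff)
  then have "D (\<lambda>p. (- \<phi> p) ^ Suc m * f p) = (\<lambda>p. (-1) * (\<phi> p * D ?g p + ?g p * D \<phi> p))"
    by (simp only: D_scale[OF Q_mult[OF phi_Q g]] D_mult[OF phi_Q g])
  moreover have "(-1) * (\<phi> p * D ?g p + ?g p * D \<phi> p) = (- \<phi> p) ^ Suc m * D f p
     + of_nat (Suc m) * ((- \<phi> p) ^ Suc (Suc m) - \<beta> p * (- \<phi> p) ^ (Suc m - 1)) * f p" for p
  proof -
    have "D \<phi> p = \<beta> p - \<phi> p * \<phi> p" by (simp add: \<beta>_def)
    show ?thesis unfolding Suc.IH \<open>D \<phi> p = _\<close>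
      by (cases m) (simp_all add: algebra_simps)
  qed
  ultimately show ?case by (simp only:)
qed simp

lemma zero_Q: "(\<lambda>p. 0) \<in> Q"
  using Q_scale[OF phi_Q, of 0] by simp

lemma D_zero: "D (\<lambda>p. 0) = (\<lambda>p. 0)"
  using D_scale[OF phi_Q, of 0] by simp

lemma Q_sum: "(\<And>i. i \<in> A \<Longrightarrow> h i \<in> Q) \<Longrightarrow> (\<lambda>p. \<Sum>i\<in>A. h i p) \<in> Q"
  by (induction A rule: infinite_finite_induct) (auto simp: zero_Q intro: Q_add)

lemma D_sum: "(\<And>i. i \<in> A \<Longrightarrow> h i \<in> Q) \<Longrightarrow> D (\<lambda>p. \<Sum>i\<in>A. h i p) = (\<lambda>p. \<Sum>i\<in>A. D (h i) p)"
proof (induction A rule: infinite_finite_induct)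
  case (insert x F)
  have "D (\<lambda>p. h x p + (\<Sum>i\<in>F. h i p)) = (\<lambda>p. D (h x) p + D (\<lambda>p. \<Sum>i\<in>F. h i p) p)"
    by (rule D_add) (auto intro: insert.prems Q_sum)
  then show ?case using insert by simp
qed (auto simp: D_zero)

text \<open>The index set is nonempty because no axiom puts the zero function into
  \<open>M r\<close>, which might be empty.\<close>

lemma M_sum: "finite A \<Longrightarrow> A \<noteq> {} \<Longrightarrow> (\<And>i. i \<in> A \<Longrightarrow> h i \<in> M r) \<Longrightarrow> (\<lambda>p. \<Sum>i\<in>A. h i p) \<in> M r"
  by (induction A rule: finite_ne_induct) (auto intro: M_add)

text \<open>This is the expansion behind the Cohen-Kuznetsov series.\<close>

lemma D_iterate:
  assumes f: "f \<in> M (int r)"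
  shows "(D ^^ k) f = (\<lambda>p. \<Sum>l\<le>k. rc_coeff r k l * ((- \<phi> p) ^ (k - l) * thetas r f l p))"
proof (induction k)
  case 0 then show ?case by simp
next
  case (Suc k)
  let ?F = "thetas r f"
  have FQ: "?F l \<in> Q" for l using M_Q[OF thetas_M[OF f]] .
  have "(D ^^ Suc k) f = D (\<lambda>p. \<Sum>l\<le>k. rc_coeff r k l * ((- \<phi> p) ^ (k - l) * ?F l p))"
    using Suc by simp
  also have "\<dots> = (\<lambda>p. \<Sum>l\<le>k. rc_coeff r k l * D (\<lambda>p. (- \<phi> p) ^ (k - l) * ?F l p) p)"
    by (subst D_sum) (auto simp: Q_scale Q_pow FQ D_scale)
  also have "\<dots> = (\<lambda>p. \<Sum>l\<le>Suc k. rc_coeff r (Suc k) l * ((- \<phi> p) ^ (Suc k - l) * ?F l p))"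
  proof
    fix p
    define c where "c = rc_coeff r k"
    define \<psi> where "\<psi> = - \<phi> p"
    \<comment> \<open>Leibniz gives four kinds of terms: l raised by one; l unchanged, where k - l
      from the power and r + 2 l from the weight add up to r + k + l; and two multiples of
      \<open>\<beta>\<close>, one from the recursion of \<open>thetas\<close> and one from D
      \<open>\<phi>\<close>.\<close>
    have term_eq: "rc_coeff r k l * D (\<lambda>p. (- \<phi> p) ^ (k - l) * ?F l p) p =
        c l * \<psi> ^ (k - l) * ?F (Suc l) p
        + c l * (of_nat r + of_nat k + of_nat l) * (\<psi> ^ (Suc k - l) * ?F l p)
        + \<beta> p * (if l = 0 then 0 else c l * (of_nat l * (of_nat r + of_nat (l - 1))) * \<psi> ^ (k - l) * ?F (l - 1) p)
        - \<beta> p * (c l * of_nat (k - l) * \<psi> ^ (k - l - 1) * ?F l p)" if l: "l \<le> k" for l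
    proof -
      define x where "x = \<psi> ^ (k - l - 1)"
      define y where "y = \<psi> ^ (k - l)"
      have e: "of_nat (k - l) = (of_nat k - of_nat l :: complex)" using l by (simp add: of_nat_diff)
      have s: "Suc k - l = Suc (k - l)" using l by simp
      show ?thesis
        unfolding D_pow[OF FQ] D_thetas \<psi>_def[symmetric] c_def[symmetric] x_def[symmetric] s power_Suc y_def[symmetric] e
        by (simp add: algebra_simps \<psi>_def)
    qed
    \<comment> \<open>The two multiples of \<open>\<beta>\<close> cancel: after an index shift by
      one, \<open>rc_coeff_shift\<close> matches them termwise.\<close>
    have b0: "(\<Sum>l\<le>k. (if l = 0 then 0 else c l * (of_nat l * (of_nat r + of_nat (l - 1))) * \<psi> ^ (k - l) * ?F (l - 1) p))
        = (\<Sum>l\<le>k. c l * of_nat (k - l) * \<psi> ^ (k - l - 1) * ?F l p)" (is "?L = ?R")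
    proof -
      have "?L = (\<Sum>l<k. c (Suc l) * (of_nat (Suc l) * (of_nat r + of_nat l)) * \<psi> ^ (k - Suc l) * ?F l p)"
        unfolding sum.atMost_shift by simp
      also have "\<dots> = (\<Sum>l<k. c l * of_nat (k - l) * \<psi> ^ (k - l - 1) * ?F l p)"
        by (rule sum.cong[OF refl]) (simp only: c_def rc_coeff_shift lessThan_iff, simp)
      also have "\<dots> = ?R" by (simp add: lessThan_Suc_atMost[symmetric])
      finally show ?thesis .
    qed
    have "(\<Sum>l\<le>k. rc_coeff r k l * D (\<lambda>p. (- \<phi> p) ^ (k - l) * ?F l p) p) =
       (\<Sum>l\<le>k. c l * \<psi> ^ (k - l) * ?F (Suc l) p)
       + (\<Sum>l\<le>k. c l * (of_nat r + of_nat k + of_nat l) * (\<psi> ^ (Suc k - l) * ?F l p))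
       + \<beta> p * ?L - \<beta> p * ?R"
      by (simp add: term_eq sum.distrib sum_subtractf sum_distrib_left)
    also have "\<dots> = (\<Sum>l\<le>k. c l * \<psi> ^ (k - l) * ?F (Suc l) p)
       + (\<Sum>l\<le>Suc k. c l * (of_nat r + of_nat k + of_nat l) * (\<psi> ^ (Suc k - l) * ?F l p))"
      unfolding b0 by (simp add: c_def rc_coeff_eq_0)
    also have "\<dots> = (\<Sum>l\<le>k. c l * \<psi> ^ (k - l) * ?F (Suc l) p)
       + (\<Sum>l\<le>k. c (Suc l) * (of_nat r + of_nat k + of_nat (Suc l)) * (\<psi> ^ (k - l) * ?F (Suc l) p))
       + c 0 * (of_nat r + of_nat k) * (\<psi> ^ Suc k * ?F 0 p)"
      unfolding sum.atMost_Suc_shift by simp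
    also have "\<dots> = (\<Sum>l\<le>k. rc_coeff r (Suc k) (Suc l) * (\<psi> ^ (k - l) * ?F (Suc l) p))
       + rc_coeff r (Suc k) 0 * (\<psi> ^ Suc k * ?F 0 p)"
      by (simp add: rc_coeff_Suc rc_coeff_Suc_0 c_def sum.distrib[symmetric] algebra_simps)
    also have "\<dots> = (\<Sum>l\<le>Suc k. rc_coeff r (Suc k) l * (\<psi> ^ (Suc k - l) * ?F l p))"
      unfolding sum.atMost_Suc_shift by simp
    finally show "(\<Sum>l\<le>k. rc_coeff r k l * D (\<lambda>p. (- \<phi> p) ^ (k - l) * ?F l p) p)
       = (\<Sum>l\<le>Suc k. rc_coeff r (Suc k) l * ((- \<phi> p) ^ (Suc k - l) * ?F l p))"
      by (simp only: \<psi>_def)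
  qed
  finally show ?case .
qed

text \<open>\<open>T l m\<close> collects the coefficient of (-\<open>\<phi>\<close>)^{k-l-m} times
  the l-th iterate of f and the m-th iterate of g. For l + m > k each summand has a zero
  coefficient, since D^j f involves only l <= j and D^{k-j} g only m <= k - j; for l + m < k the
  alternating sum vanishes. Only terms without \<open>\<phi>\<close> survive.\<close>

theorem bracket_M:
  assumes f: "f \<in> M (int r)" and g: "g \<in> M (int s)"
  shows "(\<lambda>p. \<Sum>j\<le>k. (-1) ^ j * (of_int (int k + int r - 1) gchoose (k - j))
      * (of_int (int k + int s - 1) gchoose j) * (D ^^ j) f p * (D ^^ (k - j)) g p)
    \<in> M (int (r + s + 2 * k))"
proof -
  let ?F = "thetas r f" and ?G = "thetas s g"
  define A where "A i = (of_int (int k + int r - 1) gchoose i :: complex)" for i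
  define B where "B i = (of_int (int k + int s - 1) gchoose i :: complex)" for i
  define T where "T l m = (\<Sum>j\<le>k. (-1) ^ j * A (k - j) * B j * rc_coeff r j l * rc_coeff s (k - j) m)" for l m
  have T: "T l m = 0" if "l + m \<noteq> k" for l m
  proof (cases "l + m < k")
    case True
    have "T l m = (\<Sum>j\<le>k. pochhammer (of_nat r + of_nat l) (k - l) * pochhammer (of_nat s + of_nat m) (k - m)
        * ((-1) ^ j * (of_nat (j choose l) / fact j) * (of_nat ((k - j) choose m) / fact (k - j))))"
      unfolding T_def
    proof (rule sum.cong[OF refl])
      fix j assume "j \<in> {..k}"
      then have j: "j \<le> k" by simp
      have 1: "A (k - j) * rc_coeff r j l = pochhammer (of_nat r + of_nat l) (k - l) * of_nat (j choose l) / fact (k - j)"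
        unfolding A_def by (rule rc_coeff_gbinomial[OF j])
      have 2: "B j * rc_coeff s (k - j) m = pochhammer (of_nat s + of_nat m) (k - m) * of_nat ((k - j) choose m) / fact j"
        unfolding B_def using rc_coeff_gbinomial[of "k - j" k s m] j by simp
      have "(-1) ^ j * A (k - j) * B j * rc_coeff r j l * rc_coeff s (k - j) m
         = (-1) ^ j * (A (k - j) * rc_coeff r j l) * (B j * rc_coeff s (k - j) m)"
        by (simp only: ac_simps)
      also have "\<dots> = pochhammer (of_nat r + of_nat l) (k - l) * pochhammer (of_nat s + of_nat m) (k - m)
        * ((-1) ^ j * (of_nat (j choose l) / fact j) * (of_nat ((k - j) choose m) / fact (k - j)))"
        unfolding 1 2 by (simp add: ac_simps)
      finally show "(-1) ^ j * A (k - j) * B j * rc_coeff r j l * rc_coeff s (k - j) m = \<dots>" .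
    qed
    then show ?thesis
      unfolding sum_distrib_left[symmetric] using alternating_sum_inverse_fact[OF True] by simp
  next
    case False
    then have "j < l \<or> k - j < m" if "j \<le> k" for j using that \<open>l + m \<noteq> k\<close> by auto
    then have "rc_coeff r j l * rc_coeff s (k - j) m = 0" if "j \<le> k" for j
      using rc_coeff_eq_0 that by (metis mult_eq_0_iff)
    then show ?thesis unfolding T_def by (intro sum.neutral) (auto simp: mult.assoc)
  qed
  have "(\<Sum>j\<le>k. (-1) ^ j * A (k - j) * B j * (D ^^ j) f p * (D ^^ (k - j)) g p)
      = (\<Sum>l\<le>k. T l (k - l) * (?F l p * ?G (k - l) p))" for p
  proof -
    define \<psi> where "\<psi> = - \<phi> p"
    have ext: "(\<Sum>l\<le>j. rc_coeff r j l * (\<psi> ^ (j - l) * h l)) = (\<Sum>l\<le>k. rc_coeff r j l * (\<psi> ^ (j - l) * h l))"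
      if "j \<le> k" for j r and h :: "nat \<Rightarrow> complex"
      using that by (intro sum.mono_neutral_left) (auto simp: rc_coeff_eq_0)
    have "(\<Sum>j\<le>k. (-1) ^ j * A (k - j) * B j * (D ^^ j) f p * (D ^^ (k - j)) g p)
      = (\<Sum>j\<le>k. (-1) ^ j * A (k - j) * B j * (\<Sum>l\<le>k. rc_coeff r j l * (\<psi> ^ (j - l) * ?F l p))
          * (\<Sum>m\<le>k. rc_coeff s (k - j) m * (\<psi> ^ (k - j - m) * ?G m p)))"
      by (rule sum.cong[OF refl]) (simp add: D_iterate[OF f] D_iterate[OF g] \<psi>_def[symmetric] ext del: diff_diff_left)
    also have "\<dots> = (\<Sum>j\<le>k. \<Sum>l\<le>k. \<Sum>m\<le>k. (-1) ^ j * A (k - j) * B j * rc_coeff r j l * rc_coeff s (k - j) m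
          * (\<psi> ^ (k - l - m) * ?F l p * ?G m p))"
    proof (rule sum.cong[OF refl])
      fix j assume "j \<in> {..k}"
      then have j: "j \<le> k" by simp
      \<comment> \<open>The exponents add up for l <= j and m <= k - j. Outside this range truncated
        subtraction may break the exponent identity, but there a coefficient is zero.\<close>
      have e: "rc_coeff r j l * \<psi> ^ (j - l) * (rc_coeff s (k - j) m * \<psi> ^ (k - j - m))
          = rc_coeff r j l * rc_coeff s (k - j) m * \<psi> ^ (k - l - m)" for l m
      proof (cases "l \<le> j \<and> m \<le> k - j")
        case True
        then have "k - l - m = (j - l) + (k - j - m)" using j by linarith
        then show ?thesis by (simp only: power_add ac_simps)
      next
        case False then show ?thesis by (auto simp: rc_coeff_eq_0)
      qed
      have "(-1) ^ j * A (k - j) * B j * (\<Sum>l\<le>k. rc_coeff r j l * (\<psi> ^ (j - l) * ?F l p))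
          * (\<Sum>m\<le>k. rc_coeff s (k - j) m * (\<psi> ^ (k - j - m) * ?G m p))
          = (\<Sum>l\<le>k. \<Sum>m\<le>k. (-1) ^ j * A (k - j) * B j * ?F l p * ?G m p *
             (rc_coeff r j l * \<psi> ^ (j - l) * (rc_coeff s (k - j) m * \<psi> ^ (k - j - m))))"
        by (simp add: sum_distrib_left sum_distrib_right ac_simps)
      also have "\<dots> = (\<Sum>l\<le>k. \<Sum>m\<le>k. (-1) ^ j * A (k - j) * B j * rc_coeff r j l * rc_coeff s (k - j) m
          * (\<psi> ^ (k - l - m) * ?F l p * ?G m p))"
        unfolding e by (simp add: ac_simps)
      finally show "(-1) ^ j * A (k - j) * B j * (\<Sum>l\<le>k. rc_coeff r j l * (\<psi> ^ (j - l) * ?F l p))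
          * (\<Sum>m\<le>k. rc_coeff s (k - j) m * (\<psi> ^ (k - j - m) * ?G m p)) = \<dots>" .
    qed
    also have "\<dots> = (\<Sum>l\<le>k. \<Sum>m\<le>k. T l m * (\<psi> ^ (k - l - m) * ?F l p * ?G m p))"
      unfolding T_def sum_distrib_right
      by (subst sum.swap) (intro sum.cong refl sum.swap)
    also have "\<dots> = (\<Sum>l\<le>k. \<Sum>m\<le>k. if m = k - l then T l m * (\<psi> ^ (k - l - m) * ?F l p * ?G m p) else 0)"
      by (intro sum.cong refl) (auto intro!: T)
    also have "\<dots> = (\<Sum>l\<le>k. T l (k - l) * (?F l p * ?G (k - l) p))"
      by (intro sum.cong refl) (subst sum.delta, auto)
    finally show ?thesis .
  qed
  moreover have "(\<lambda>p. \<Sum>l\<le>k. T l (k - l) * (?F l p * ?G (k - l) p)) \<in> M (int (r + s + 2 * k))"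
  proof (rule M_sum)
    fix l assume "l \<in> {..k}"
    then have e: "int (r + s + 2 * k) = int (r + 2 * l) + int (s + 2 * (k - l))" by simp
    show "(\<lambda>p. T l (k - l) * (?F l p * ?G (k - l) p)) \<in> M (int (r + s + 2 * k))"
      unfolding e by (rule M_scale[OF M_mult[OF thetas_M[OF f] thetas_M[OF g]]])
  qed auto
  ultimately show ?thesis by (simp add: A_def B_def)
qed

end

section \<open>Enumeration of the coordinates\<close>

definition row :: "nat \<Rightarrow> nat \<Rightarrow> nat list" where
  "row n i = filter (\<lambda>k. (i, k) \<noteq> (1, 1) \<and> (if odd n then i + k \<le> n + 2 else i + k < n + 2)) [1..<i+1]"

lemma concat_if_Pair:
  "concat (map (\<lambda>k. if P k then [(i, k)] else []) xs) = map (Pair i) (filter (\<lambda>k. P k) xs)"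
  by (induction xs) auto

lemma positions_eq: "positions n = concat (map (\<lambda>i. map (Pair i) (row n i)) [1..<n+2])"
proof -
  have "concat (map (\<lambda>k. if (i, k) \<noteq> (1, 1) \<and> (if odd n then i + k \<le> n + 2 else i + k < n + 2)
      then [(i, k)] else []) [1..<i+1]) = map (Pair i) (row n i)" for i
    unfolding row_def by (rule concat_if_Pair)
  then show ?thesis unfolding positions_def by (simp only:)
qed

lemma mem_concat_Pair:
  "(i, k) \<in> set (concat (map (\<lambda>i. map (Pair i) (f i)) is)) \<longleftrightarrow> i \<in> set is \<and> k \<in> set (f i)"
  by auto

lemma mem_positions:
  "(i, k) \<in> set (positions n) \<longleftrightarrow> 1 \<le> k \<and> k \<le> i \<and> i \<le> n + 1 \<and> (i, k) \<noteq> (1, 1) \<and>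
     (if odd n then i + k \<le> n + 2 else i + k < n + 2)"
proof -
  have "(i, k) \<in> set (positions n) \<longleftrightarrow> i \<in> {1..<n+2} \<and> k \<in> set (row n i)"
    unfolding positions_eq mem_concat_Pair set_upt ..
  then show ?thesis
    by (simp only: row_def set_filter set_upt mem_Collect_eq) auto
qed

lemma distinct_concat_Pair:
  "distinct is \<Longrightarrow> (\<And>i. distinct (f i)) \<Longrightarrow> distinct (concat (map (\<lambda>i. map (Pair i) (f i)) is))"
  by (induction "is") (auto simp: distinct_map inj_on_def)

lemma distinct_positions: "distinct (positions n)"
  unfolding positions_eq by (rule distinct_concat_Pair) (simp_all add: row_def)

lemma positions_row_2:
  assumes "n \<ge> 1"
  shows "positions n ! 0 = (2, 1)" "positions n \<noteq> []"
proof -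
  have r1: "row n 1 = []" by (simp add: row_def)
  have "[1..<n+2] = 1 # 2 # [3..<n+2]" using assms
    by (simp add: upt_conv_Cons numeral_eq_Suc)
  moreover have "\<exists>xs. row n 2 = 1 # xs"
    using assms by (auto simp: row_def numeral_eq_Suc elim!: oddE evenE)
  ultimately show "positions n ! 0 = (2, 1)" "positions n \<noteq> []"
    unfolding positions_eq using r1 by auto
qed

text \<open>The summands grow up to the middle and then decrease symmetrically, so reflection turns
  the second half into another 1 + ... + m.\<close>

lemma min_sum: "(\<Sum>i\<leftarrow>[1..<2 * m + 1]. min i (2 * m + 1 - i)) = m * (m + 1)"
proof -
  have "(\<Sum>i\<leftarrow>[1..<2 * m + 1]. min i (2 * m + 1 - i)) = (\<Sum>i\<in>{1..<2 * m + 1}. min i (2 * m + 1 - i))"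
    by (simp only: interv_sum_list_conv_sum_set_nat set_upt)
  also have "{1..<2 * m + 1} = {1..m} \<union> {m+1..2*m}" by auto
  also have "(\<Sum>i\<in>\<dots>. min i (2 * m + 1 - i)) =
      (\<Sum>i\<in>{1..m}. min i (2 * m + 1 - i)) + (\<Sum>i\<in>{m+1..2*m}. min i (2 * m + 1 - i))"
    by (rule sum.union_disjoint) auto
  also have "(\<Sum>i\<in>{1..m}. min i (2 * m + 1 - i)) = (\<Sum>i\<in>{1..m}. i)"
    by (rule sum.cong) auto
  also have "(\<Sum>i\<in>{m+1..2*m}. min i (2 * m + 1 - i)) = (\<Sum>i\<in>{1..m}. i)"
    by (rule sum.reindex_bij_witness[of _ "\<lambda>i. 2*m+1-i" "\<lambda>i. 2*m+1-i"]) auto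
  also have "(\<Sum>i\<in>{1..m}. i) + (\<Sum>i\<in>{1..m}. i) = m * (m + 1)"
    by (induction m) auto
  finally show ?thesis .
qed

lemma length_row:
  assumes "1 \<le> i" "i \<le> n + 1"
  shows "length (row n i) = (if i = 1 then 0 else if odd n then min i (n + 2 - i) else min i (n + 1 - i))"
proof -
  have "length (row n i) = card (set (row n i))"
    by (rule distinct_card[symmetric]) (simp add: row_def)
  also have "set (row n i) = (if i = 1 then {} else if odd n then {1..min i (n + 2 - i)} else {1..min i (n + 1 - i)})"
    using assms unfolding row_def by (auto split: if_splits)
  finally show ?thesis by auto
qed

text \<open>There are d coordinates, of which two, t_1 and t_{n+2}, are not entries of S.\<close>

lemma length_positions:
  assumes "n \<ge> 1"
  shows "length (positions n) = top_index n - 2"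
proof -
  define m where "m = (if odd n then (n + 1) div 2 else n div 2)"
  \<comment> \<open>\<open>c\<close> also counts the position (1, 1), whose entry is the constant 1;
    this is the 1 subtracted below.\<close>
  define c where "c i = (if odd n then min i (n + 2 - i) else min i (n + 1 - i))" for i
  have "length (positions n) = (\<Sum>i\<leftarrow>[1..<n+2]. length (row n i))"
    unfolding positions_eq by (simp add: length_concat comp_def)
  also have "[1..<n+2] = 1 # [2..<n+2]" using assms by (simp add: upt_conv_Cons numeral_eq_Suc)
  also have "(\<Sum>i\<leftarrow>\<dots>. length (row n i)) = (\<Sum>i\<leftarrow>[2..<n+2]. length (row n i))"
    by (simp add: row_def)
  also have "\<dots> = (\<Sum>i\<leftarrow>[2..<n+2]. c i)"
    by (intro arg_cong[where f = sum_list] map_cong refl) (auto simp: length_row c_def)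
  also have "\<dots> = (\<Sum>i\<leftarrow>[1..<n+2]. c i) - 1"
  proof -
    have "[1..<n+2] = 1 # [2..<n+2]" using assms by (simp add: upt_conv_Cons numeral_eq_Suc)
    moreover have "c 1 = 1" using assms by (auto simp: c_def)
    ultimately show ?thesis by simp
  qed
  also have "(\<Sum>i\<leftarrow>[1..<n+2]. c i) = m * (m + 1)"
  proof (cases "odd n")
    case True
    then have "n + 2 = 2 * m + 1" by (auto simp: m_def elim!: oddE)
    then show ?thesis using min_sum[of m] True by (simp add: c_def)
  next
    case False
    then have n: "n = 2 * m" by (auto simp: m_def elim!: evenE)
    have "(\<Sum>i\<leftarrow>[1..<n+2]. c i) = (\<Sum>i\<leftarrow>[1..<n+1]. c i)"
      using False by (simp add: c_def)
    also have "\<dots> = m * (m + 1)" using min_sum[of m] False by (simp add: c_def n)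
    finally show ?thesis .
  qed
  also have "m * (m + 1) - 1 = top_index n - 2"
  proof (cases "odd n")
    case True
    then obtain q where q: "n = 2 * q + 1" by (auto elim: oddE)
    then have "m = q + 1" by (simp add: m_def)
    then have "(n + 1) * (n + 3) = 4 * (m * (m + 1))" by (simp add: q algebra_simps)
    then show ?thesis using True by (simp add: top_index_def)
  next
    case False
    then have n: "n = 2 * m" by (auto simp: m_def elim!: evenE)
    have "n * (n + 2) = 4 * (m * (m + 1))" using n by (simp add: algebra_simps)
    then show ?thesis using False by (simp add: top_index_def)
  qed
  finally show ?thesis .
qed

text \<open>The name t_{n+2} therefore lies in the range up to d. For n = 2 it does not, as d = 3 <
  4, which is why \<open>index_set\<close> lists that case separately.\<close>

lemma top_index_ge:
  assumes "n \<ge> 1" "n \<noteq> 2"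
  shows "n + 2 \<le> top_index n"
proof (cases "odd n")
  case True
  then obtain m where m: "n = 2 * m + 1" by (auto elim: oddE)
  have "(n + 1) * (n + 3) = 4 * ((m + 1) * (m + 2))" by (simp add: m algebra_simps)
  then show ?thesis using True m by (simp add: top_index_def)
next
  case False
  then obtain m where m: "n = 2 * m" by (auto elim: evenE)
  then have "m \<ge> 2" using assms by simp
  then have "2 * m \<le> m * m" by simp
  have "n * (n + 2) = 4 * (m * m + m)" by (simp add: m algebra_simps)
  then have "top_index n = m * m + m + 1" using False by (simp add: top_index_def)
  then show ?thesis using \<open>2 * m \<le> m * m\<close> m \<open>m \<ge> 2\<close> by linarith
qed

section \<open>Names of the coordinates and their positions in S\<close>

lemma position_2: "n \<ge> 1 \<Longrightarrow> position n 2 = (2, 1)"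
  using positions_row_2 by (simp add: position_def)

lemma position_in_set:
  assumes "n \<ge> 1" "n \<noteq> 2" "j \<in> index_set n" "j \<noteq> 1" "j \<noteq> n + 2"
  shows "position n j \<in> set (positions n)" "j \<noteq> 2 \<Longrightarrow> position n j \<noteq> (2, 1)"
proof -
  define i where "i = (if j < n + 2 then j - 2 else j - 3)"
  have j: "2 \<le> j" "j \<le> top_index n" using assms by (auto simp: index_set_def)
  have i: "i < length (positions n)"
  proof (cases "j < n + 2")
    case True
    then show ?thesis using j top_index_ge[OF assms(1,2)] unfolding i_def length_positions[OF assms(1)] by simp
  next
    case False
    then have "j - 3 < top_index n - 2" using j assms(1) by linarith
    then show ?thesis using False unfolding i_def length_positions[OF assms(1)] by simp
  qed
  have p: "position n j = positions n ! i" by (simp only: position_def i_def)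
  show "position n j \<in> set (positions n)" unfolding p by (rule nth_mem[OF i])
  assume "j \<noteq> 2"
  then have i0: "i \<noteq> 0" using j assms(1,5) by (auto simp: i_def)
  have l: "0 < length (positions n)" using i by linarith
  have "positions n ! i \<noteq> positions n ! 0"
    unfolding nth_eq_iff_index_eq[OF distinct_positions i l] by (rule i0)
  then show "position n j \<noteq> (2, 1)"
    unfolding p positions_row_2(1)[OF assms(1)] .
qed

lemma position_inj:
  assumes n: "n \<ge> 1" "n \<noteq> 2"
    and j: "j \<in> index_set n" "j \<noteq> 1" "j \<noteq> n + 2" and k: "k \<in> index_set n" "k \<noteq> 1" "k \<noteq> n + 2"
    and eq: "position n j = position n k"
  shows "j = k"
proof -
  define f where "f i = (if i < n + 2 then i - 2 else i - 3)" for i :: nat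
  have f: "2 \<le> i \<and> f i < length (positions n)" if "i \<in> index_set n" "i \<noteq> 1" "i \<noteq> n + 2" for i
  proof -
    have i: "2 \<le> i" "i \<le> top_index n" using that n by (auto simp: index_set_def)
    then have "f i < top_index n - 2"
      using top_index_ge[OF n] that(3) n(1) unfolding f_def by (cases "i < n + 2") simp_all
    then show ?thesis using i length_positions[OF n(1)] by simp
  qed
  have "positions n ! f j = positions n ! f k" using eq by (simp only: position_def f_def)
  then have "f j = f k"
    using nth_eq_iff_index_eq[OF distinct_positions] f[OF j] f[OF k] by simp
  then show ?thesis using f[OF j] f[OF k] j k n by (auto simp: f_def split: if_splits)
qed

lemma ex_position:
  assumes "n \<ge> 1" "n \<noteq> 2" "p \<in> set (positions n)"
  obtains j where "j \<in> index_set n" "j \<noteq> 1" "j \<noteq> n + 2" "position n j = p"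
proof -
  obtain i where i: "i < length (positions n)" "positions n ! i = p"
    using assms(3) by (auto simp: in_set_conv_nth)
  define j where "j = (if i + 2 < n + 2 then i + 2 else i + 3)"
  have "j \<in> index_set n" "j \<noteq> 1" "j \<noteq> n + 2" "position n j = p"
    using i top_index_ge[OF assms(1,2)] assms
    unfolding length_positions[OF assms(1)] by (auto simp: j_def index_set_def position_def)
  then show ?thesis by (rule that)
qed

lemma last_rows:
  assumes "odd n" "n \<ge> 3"
  obtains ps where "positions n = ps @ [(n, 1), (n, 2), (n + 1, 1)]"
proof -
  have u: "[1..<n+2] = [1..<n] @ [n, n + 1]"
    using assms upt_add_eq_append[of 1 n 2] by (simp add: numeral_eq_Suc)
  have c: "[1..<n+1] = 1 # 2 # [3..<n+1]" "[1..<n+1+1] = 1 # [2..<n+1+1]"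
    using assms by (simp_all add: upt_conv_Cons numeral_eq_Suc)
  have "filter (\<lambda>k. k \<le> 2) [3..<n+1] = []" "filter (\<lambda>k. k \<le> 1) [2..<n+1+1] = []"
    by (auto simp: filter_empty_conv)
  then have "row n n = [1, 2]" "row n (n + 1) = [1]"
    using assms unfolding row_def c by simp_all
  then have "positions n = concat (map (\<lambda>i. map (Pair i) (row n i)) [1..<n]) @ [(n, 1), (n, 2), (n + 1, 1)]"
    unfolding positions_eq u by simp
  then show ?thesis by (rule that)
qed

text \<open>The enumeration ends with s_{n,1}, s_{n,2}, s_{n+1,1}, so these are named t_{d-2},
  t_{d-1}, t_d. For n = 3 the skipped name t_5 falls between s_{31} and s_{32}, and s_{31} is t_4
  instead.\<close>

lemma position_top:
  assumes "odd n" "n \<ge> 3"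
  shows "position n (top_index n) = (n + 1, 1)"
    "position n (if n = 3 then 4 else top_index n - 2) = (n, 1)"
    "(if n = 3 then 4 else top_index n - 2) \<noteq> n + 2"
    "(if n = 3 then 4 else top_index n - 2) \<noteq> 1"
    "top_index n \<noteq> n + 2" "top_index n \<in> index_set n" "top_index n \<noteq> 1" "top_index n \<noteq> 2"
    "(if n = 3 then 4 else top_index n - 2) \<in> index_set n"
proof -
  obtain ps where ps: "positions n = ps @ [(n, 1), (n, 2), (n + 1, 1)]"
    using last_rows[OF assms] .
  have l: "length ps + 3 = top_index n - 2"
    using length_positions[of n] assms unfolding ps by simp
  obtain m where m: "n = 2 * m + 1" "m \<ge> 1" using assms by (auto elim!: oddE)
  have t: "top_index n = (m + 1) * (m + 2) + 1"
  proof -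
    have "(n + 1) * (n + 3) = 4 * ((m + 1) * (m + 2))" by (simp add: m algebra_simps)
    then show ?thesis using assms by (simp add: top_index_def)
  qed
  have big: "top_index n > n + 4" if "n \<noteq> 3"
  proof -
    have "m \<ge> 2" using m that by auto
    then have "2 * m \<le> m * m" by simp
    moreover have "(m + 1) * (m + 2) + 1 = m * m + 3 * m + 3" by (simp add: algebra_simps)
    ultimately have "2 * m + 5 < (m + 1) * (m + 2) + 1" using \<open>m \<ge> 2\<close> by linarith
    then show ?thesis unfolding t using m by linarith
  qed
  have t3: "top_index 3 = 7" by (simp add: top_index_def)
  have gt: "top_index n > n + 2" using big t3 by (cases "n = 3") auto
  have i1: "top_index n - 3 = length ps + 2" using l by simp
  show "position n (top_index n) = (n + 1, 1)"
    using gt unfolding position_def i1 ps by (simp add: nth_append)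
  show "position n (if n = 3 then 4 else top_index n - 2) = (n, 1)"
  proof (cases "n = 3")
    case True
    then have "length ps = 2" using l t3 by simp
    then show ?thesis using True unfolding position_def ps by (simp add: nth_append)
  next
    case False
    have "top_index n - 2 - 3 = length ps" using l by simp
    moreover have "\<not> top_index n - 2 < n + 2" using big False by linarith
    ultimately show ?thesis using False unfolding position_def ps by (simp only: if_False nth_append_length)
  qed
  show "(if n = 3 then 4 else top_index n - 2) \<noteq> n + 2"
    "(if n = 3 then 4 else top_index n - 2) \<noteq> 1" using big by auto
  show "top_index n \<noteq> n + 2" "top_index n \<in> index_set n" "top_index n \<noteq> 1" "top_index n \<noteq> 2"
    using gt assms by (auto simp: index_set_def)
  show "(if n = 3 then 4 else top_index n - 2) \<in> index_set n"
    using gt t3 assms big by (auto simp: index_set_def)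
qed

section \<open>Graded algebras of functions and their derivations\<close>

lemma on_in [simp]: "p \<in> X \<Longrightarrow> on X f p = f p"
  by (simp add: on_def)

lemma on_out: "p \<notin> X \<Longrightarrow> on X f p = 0"
  by (simp add: on_def)

lemma on_cong: "(\<And>p. p \<in> X \<Longrightarrow> f p = g p) \<Longrightarrow> on X f = on X g"
  by (auto simp: on_def)

lemma on_zero: "on X (\<lambda>p. 0) = (\<lambda>p. 0)"
  by (auto simp: on_def)

lemma on_add: "on X (\<lambda>p. f p + g p) = (\<lambda>p. on X f p + on X g p)"
  by (auto simp: on_def)

lemma on_mult: "on X (\<lambda>p. f p * g p) = (\<lambda>p. on X f p * on X g p)"
  by (auto simp: on_def)

lemma on_on [simp]: "on X (on X f) = on X f"
  by (auto simp: on_def)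

lemma on_alg_gen: "f \<in> alg_gen X G \<Longrightarrow> on X f = f"
  by (induction rule: alg_gen.induct) (auto simp: on_add on_mult on_zero)

lemma on_wt_part: "wt_part X G r f \<Longrightarrow> on X f = f"
  by (induction rule: wt_part.induct) (auto simp: on_add on_mult on_zero)

text \<open>Elements of a weight part vanish off X, whereas natural functions such as
  \<open>s_entry i j\<close> do not. Restricting first lets weights be assigned to the latter, and
  only values on X matter.\<close>

definition wm :: "pt set \<Rightarrow> (fn \<times> int) set \<Rightarrow> int \<Rightarrow> fn \<Rightarrow> bool" where
  "wm X G r f \<longleftrightarrow> wt_part X G r (on X f)"

lemma wt_part_imp_wm: "wt_part X G r f \<Longrightarrow> wm X G r f"
  by (simp add: wm_def on_wt_part)

lemma wm_on [simp]: "wm X G r (on X f) = wm X G r f"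
  by (simp add: wm_def)

lemma wm_cong: "wm X G r f \<Longrightarrow> (\<And>p. p \<in> X \<Longrightarrow> g p = f p) \<Longrightarrow> r = r' \<Longrightarrow> wm X G r' g"
  unfolding wm_def by (simp cong: on_cong)

lemma wm_weight: "wm X G r f \<Longrightarrow> r = r' \<Longrightarrow> wm X G r' f"
  by simp

lemma wm_zero: "wm X G r (\<lambda>p. 0)"
  by (simp add: wm_def on_zero wt_part.zero)

lemma wm_const: "wm X G 0 (\<lambda>p. a)"
  unfolding wm_def by (rule wt_part.const)

lemma wm_gen: "(f, r) \<in> G \<Longrightarrow> wm X G r f"
  unfolding wm_def by (rule wt_part.gen)

lemma wm_add: "wm X G r f \<Longrightarrow> wm X G r g \<Longrightarrow> wm X G r (\<lambda>p. f p + g p)"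
  unfolding wm_def on_add by (rule wt_part.add)

lemma wm_mult: "wm X G r f \<Longrightarrow> wm X G s g \<Longrightarrow> wm X G (r + s) (\<lambda>p. f p * g p)"
  unfolding wm_def on_mult by (rule wt_part.mult)

lemma wm_scale: "wm X G r f \<Longrightarrow> wm X G r (\<lambda>p. a * f p)"
  using wm_mult[OF wm_const] by fastforce

lemma wm_minus: "wm X G r f \<Longrightarrow> wm X G r (\<lambda>p. - f p)"
  using wm_scale[of X G r f "-1"] by simp

lemma wm_diff: "wm X G r f \<Longrightarrow> wm X G r g \<Longrightarrow> wm X G r (\<lambda>p. f p - g p)"
  using wm_add[OF _ wm_minus] by fastforce

lemma wm_sum: "(\<And>i. i \<in> A \<Longrightarrow> wm X G r (f i)) \<Longrightarrow> wm X G r (\<lambda>p. \<Sum>i\<in>A. f i p)"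
  by (induction A rule: infinite_finite_induct) (auto intro: wm_zero wm_add)

lemma wm_prod: "finite A \<Longrightarrow> (\<And>i. i \<in> A \<Longrightarrow> wm X G (r i) (f i)) \<Longrightarrow> wm X G (\<Sum>i\<in>A. r i) (\<lambda>p. \<Prod>i\<in>A. f i p)"
  by (induction A rule: finite_induct) (auto intro: wm_const wm_mult)

lemma wm_power: "wm X G r f \<Longrightarrow> wm X G (int k * r) (\<lambda>p. f p ^ k)"
proof (induction k)
  case 0 then show ?case using wm_const[of X G 1] by simp
next
  case (Suc k)
  from wm_mult[OF Suc.prems Suc.IH[OF Suc.prems]] show ?case by (simp add: algebra_simps)
qed

section \<open>Homogeneous components of elements of the generated algebra\<close>

lemma wt_part_mono: "wt_part X G r f \<Longrightarrow> G \<subseteq> G' \<Longrightarrow> wt_part X G' r f"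
  by (induction rule: wt_part.induct) (auto intro: wt_part.intros)

lemma alg_gen_mono: "f \<in> alg_gen X G \<Longrightarrow> G \<subseteq> G' \<Longrightarrow> f \<in> alg_gen X G'"
  by (induction rule: alg_gen.induct) (auto intro: alg_gen.intros)

lemma alg_gen_zero: "(\<lambda>p. 0) \<in> alg_gen X G"
  using alg_gen.const[of X 0] by (simp add: on_zero)

lemma wt_part_alg_gen: "wt_part X G r f \<Longrightarrow> f \<in> alg_gen X (fst ` G)"
proof (induction rule: wt_part.induct)
  case (gen g w)
  then have "g \<in> fst ` G" by force
  then show ?case by (rule alg_gen.gen)
qed (auto intro: alg_gen.intros alg_gen_zero)

text \<open>A sum of weight parts with no claim of directness. Uniqueness of components comes from
  the scaling action instead.\<close>

inductive_set homog_sums :: "pt set \<Rightarrow> (fn \<times> int) set \<Rightarrow> fn set" for X G where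
  homog: "wt_part X G r f \<Longrightarrow> f \<in> homog_sums X G"
| add: "f \<in> homog_sums X G \<Longrightarrow> g \<in> homog_sums X G \<Longrightarrow> (\<lambda>p. f p + g p) \<in> homog_sums X G"

lemma homog_sums_mult:
  assumes "f \<in> homog_sums X G" "g \<in> homog_sums X G"
  shows "(\<lambda>p. f p * g p) \<in> homog_sums X G"
proof -
  have *: "(\<lambda>p. f p * g p) \<in> homog_sums X G" if "wt_part X G r f" "g \<in> homog_sums X G" for f g r
    using that(2)
  proof induction
    case (homog s g)
    then show ?case by (intro homog_sums.homog[OF wt_part.mult[OF that(1)]])
  next
    case (add g h)
    from homog_sums.add[OF add.IH] show ?case by (simp add: distrib_left)
  qed
  show ?thesis using assms(1)
  proof induction
    case (homog r f)
    then show ?case using * assms(2) by blast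
  next
    case (add f h)
    from homog_sums.add[OF add.IH] show ?case by (simp add: distrib_right)
  qed
qed

lemma alg_gen_homog_sums: "f \<in> alg_gen X (fst ` G) \<Longrightarrow> f \<in> homog_sums X G"
proof (induction rule: alg_gen.induct)
  case (const c) show ?case by (rule homog_sums.homog[OF wt_part.const])
next
  case (gen g)
  then obtain r where "(g, r) \<in> G" by force
  then show ?case by (rule homog_sums.homog[OF wt_part.gen])
next
  case (add f g) then show ?case by (auto intro: homog_sums.add)
next
  case (mult f g) then show ?case by (auto intro: homog_sums_mult)
qed

lemma homog_sums_decompose:
  assumes "f \<in> homog_sums X G"
  obtains A F where "finite A" "\<And>i. wt_part X G i (F i)" "\<And>p. f p = (\<Sum>i\<in>A. F i p)"
    "\<And>i p. i \<notin> A \<Longrightarrow> F i p = 0"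
proof -
  have "\<exists>A F. finite A \<and> (\<forall>i. wt_part X G i (F i)) \<and> (\<forall>p. f p = (\<Sum>i\<in>A. F i p)) \<and> (\<forall>i p. i \<notin> A \<longrightarrow> F i p = 0)"
    using assms
  proof induction
    case (homog r f)
    let ?F = "\<lambda>i. if i = r then f else (\<lambda>p. 0)"
    show ?case
      using homog by (intro exI[of _ "{r}"] exI[of _ ?F]) (auto intro: wt_part.zero)
  next
    case (add f g)
    then obtain A F B H where *: "finite A" "\<forall>i. wt_part X G i (F i)" "\<forall>p. f p = (\<Sum>i\<in>A. F i p)" "\<forall>i p. i \<notin> A \<longrightarrow> F i p = 0"
      "finite B" "\<forall>i. wt_part X G i (H i)" "\<forall>p. g p = (\<Sum>i\<in>B. H i p)" "\<forall>i p. i \<notin> B \<longrightarrow> H i p = 0"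
      by (elim exE conjE)
    have F0: "F i p = 0" if "i \<notin> A" for i p using *(4) that by blast
    have H0: "H i p = 0" if "i \<notin> B" for i p using *(8) that by blast
    have s: "(\<Sum>i\<in>A. F i p) = (\<Sum>i\<in>A \<union> B. F i p)" "(\<Sum>i\<in>B. H i p) = (\<Sum>i\<in>A \<union> B. H i p)" for p
      using *(1,5) by (auto intro!: sum.mono_neutral_left F0 H0)
    show ?case
    proof (intro exI[of _ "A \<union> B"] exI[of _ "\<lambda>i p. F i p + H i p"] conjI allI impI)
      show "wt_part X G i (\<lambda>p. F i p + H i p)" for i using *(2,6) by (intro wt_part.add) blast+
      show "f p + g p = (\<Sum>i\<in>A \<union> B. F i p + H i p)" for p
        using *(3)[rule_format, of p] *(7)[rule_format, of p] s[of p] by (simp add: sum.distrib)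
    qed (use * F0 H0 in auto)
  qed
  then obtain A F where d: "finite A" "\<forall>i. wt_part X G i (F i)" "\<forall>p. f p = (\<Sum>i\<in>A. F i p)"
    "\<forall>i p. i \<notin> A \<longrightarrow> F i p = 0" by (elim exE conjE)
  show ?thesis
    by (rule that[of A F]) (use d in blast)+
qed

text \<open>Multiplying the Laurent polynomial by z^N gives a polynomial that vanishes on all
  nonzero complex numbers, hence has infinitely many roots.\<close>

lemma powi_sum_zero:
  fixes a :: "int \<Rightarrow> complex"
  assumes "finite A" "\<And>z. z \<noteq> 0 \<Longrightarrow> (\<Sum>i\<in>A. a i * z powi i) = 0" "i \<in> A"
  shows "a i = 0"
proof -
  obtain N where N: "\<And>i. i \<in> A \<Longrightarrow> i + int N \<ge> 0"
  proof
    fix i assume i: "i \<in> A"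
    have "\<bar>i\<bar> \<le> (\<Sum>i\<in>A. \<bar>i\<bar>)" using member_le_sum[OF i, of "\<lambda>i. \<bar>i\<bar>"] assms(1) by simp
    then show "i + int (nat (\<Sum>i\<in>A. \<bar>i\<bar>)) \<ge> 0" by linarith
  qed
  define P where "P = (\<Sum>i\<in>A. monom (a i) (nat (i + int N)))"
  have "poly P z = 0" if z: "z \<noteq> 0" for z
  proof -
    have "poly P z = (\<Sum>i\<in>A. a i * z ^ nat (i + int N))" by (simp add: P_def poly_sum poly_monom)
    also have "\<dots> = (\<Sum>i\<in>A. z ^ N * (a i * z powi i))"
    proof (rule sum.cong[OF refl])
      fix i assume "i \<in> A"
      have "z ^ nat (i + int N) = z powi (i + int N)" using N[OF \<open>i \<in> A\<close>] by (simp add: power_int_def)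
      also have "\<dots> = z powi i * z ^ N" using z by (simp add: power_int_add)
      finally show "a i * z ^ nat (i + int N) = z ^ N * (a i * z powi i)" by simp
    qed
    also have "\<dots> = 0" using assms(2)[OF z] by (simp add: sum_distrib_left[symmetric])
    finally show ?thesis .
  qed
  then have "UNIV - {0} \<subseteq> {z. poly P z = 0}" by auto
  moreover have "infinite (UNIV - {0::complex})" by (simp add: infinite_UNIV_char_0)
  ultimately have "infinite {z. poly P z = 0}" using finite_subset by blast
  then have P: "P = 0" using poly_roots_finite by blast
  have "coeff P (nat (i + int N)) = (\<Sum>k\<in>A. if k = i then a k else 0)"
    unfolding P_def coeff_sum using N assms(3)
    by (intro sum.cong refl) (auto simp: nat_eq_iff2)
  then show ?thesis using P assms by simp
qed

text \<open>The weight of an element can be read off from a group action that scales the generators,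
  so that no algebraic independence of the generators is needed.\<close>

lemma wt_part_of_subalgebra:
  fixes act :: "complex \<Rightarrow> pt \<Rightarrow> pt"
  assumes sub: "G' \<subseteq> G"
    and act: "\<And>z p. z \<noteq> 0 \<Longrightarrow> p \<in> X \<Longrightarrow> act z p \<in> X"
    and gens: "\<And>g w z p. (g, w) \<in> G \<Longrightarrow> z \<noteq> 0 \<Longrightarrow> p \<in> X \<Longrightarrow> g (act z p) = z powi w * g p"
    and f: "f \<in> alg_gen X (fst ` G')" "wt_part X G r f"
  shows "wt_part X G' r f"
proof -
  have hom: "h (act z p) = z powi s * h p" if "wt_part X G s h" "z \<noteq> 0" "p \<in> X" for h s z p
    using that
    by (induction rule: wt_part.induct) (auto simp: act gens algebra_simps power_int_add)
  obtain A F where A: "finite A" "\<And>i. wt_part X G' i (F i)" "\<And>p. f p = (\<Sum>i\<in>A. F i p)"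
    "\<And>i p. i \<notin> A \<Longrightarrow> F i p = 0"
    by (rule homog_sums_decompose[OF alg_gen_homog_sums[OF f(1)]]) (rule that, assumption+)
  have "f p = F r p" for p
  proof (cases "p \<in> X")
    case False
    then show ?thesis using on_wt_part[OF f(2)] on_wt_part[OF A(2)] by (metis on_out)
  next
    case True
    \<comment> \<open>Along the orbit of p, f is z^r f(p) by its weight and the sum of z^i F_i(p) by
      its decomposition. \<open>a\<close> holds the coefficients of the difference; the vanishing of
      the one at z^r is the claim.\<close>
    define a where "a i = F i p - (if i = r then f p else 0)" for i
    have "(\<Sum>i\<in>insert r A. a i * z powi i) = 0" if z: "z \<noteq> 0" for z
    proof -
      have "(\<Sum>i\<in>insert r A. z powi i * F i p) = (\<Sum>i\<in>insert r A. F i (act z p))"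
        using hom[OF wt_part_mono[OF A(2) sub] z True] by simp
      also have "\<dots> = (\<Sum>i\<in>A. F i (act z p))" using A by (cases "r \<in> A") (auto simp: insert_absorb)
      also have "\<dots> = z powi r * f p" using A(3) hom[OF f(2) z True] by metis
      finally have "(\<Sum>i\<in>insert r A. z powi i * F i p) = z powi r * f p" .
      moreover have "(\<Sum>i\<in>insert r A. a i * z powi i)
          = (\<Sum>i\<in>insert r A. z powi i * F i p) - (\<Sum>i\<in>insert r A. if i = r then z powi i * f p else 0)"
        unfolding sum_subtractf[symmetric] by (intro sum.cong refl) (auto simp: a_def algebra_simps)
      ultimately show ?thesis using A(1) by (simp add: sum.delta del: sum.insert)
    qed
    then have "a r = 0" using powi_sum_zero[of "insert r A" a r] A(1) by blast
    then show ?thesis by (simp add: a_def)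
  qed
  then have "f = F r" by auto
  then show ?thesis using A(2) by metis
qed

section \<open>Calculus of vector fields on regular functions\<close>

lemma regular_on: "f \<in> regular_fns n W \<Longrightarrow> on (moduli n W) f = f"
  unfolding regular_fns_def by (rule on_alg_gen)

definition reg :: "nat \<Rightarrow> (complex \<Rightarrow> complex \<Rightarrow> complex mat) \<Rightarrow> fn \<Rightarrow> bool" where
  "reg n W f \<longleftrightarrow> on (moduli n W) f \<in> regular_fns n W"

lemma reg_const: "reg n W (\<lambda>p. a)"
  unfolding reg_def regular_fns_def by (rule alg_gen.const)

lemma reg_on [simp]: "reg n W (on (moduli n W) f) = reg n W f"
  by (simp add: reg_def)

lemma reg_gen: "f \<in> gens Option2 n (index_set n) \<Longrightarrow> reg n W f"
  unfolding reg_def regular_fns_def by (rule alg_gen.gen)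

lemma reg_add: "reg n W f \<Longrightarrow> reg n W g \<Longrightarrow> reg n W (\<lambda>p. f p + g p)"
  unfolding reg_def regular_fns_def on_add by (rule alg_gen.add)

lemma reg_mult: "reg n W f \<Longrightarrow> reg n W g \<Longrightarrow> reg n W (\<lambda>p. f p * g p)"
  unfolding reg_def regular_fns_def on_mult by (rule alg_gen.mult)

lemma reg_scale: "reg n W f \<Longrightarrow> reg n W (\<lambda>p. a * f p)"
  by (intro reg_mult reg_const)

lemma reg_power: "reg n W f \<Longrightarrow> reg n W (\<lambda>p. f p ^ k)"
  by (induction k) (auto intro: reg_const reg_mult)

lemma reg_prod: "(\<And>i. i \<in> A \<Longrightarrow> reg n W (f i)) \<Longrightarrow> reg n W (\<lambda>p. \<Prod>i\<in>A. f i p)"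
  by (induction A rule: infinite_finite_induct) (auto intro: reg_const reg_mult)

lemma reg_diff: "reg n W f \<Longrightarrow> reg n W g \<Longrightarrow> reg n W (\<lambda>p. f p - g p)"
  using reg_add[OF _ reg_scale[where a = "-1"]] by fastforce

lemma reg_wm: "wm (moduli n W) G r f \<Longrightarrow> (\<And>g w. (g, w) \<in> G \<Longrightarrow> reg n W g) \<Longrightarrow> reg n W f"
proof -
  assume "wm (moduli n W) G r f" and g: "\<And>g w. (g, w) \<in> G \<Longrightarrow> reg n W g"
  then have "wt_part (moduli n W) G r (on (moduli n W) f)" by (simp add: wm_def)
  then have "reg n W (on (moduli n W) f)"
  proof (induction rule: wt_part.induct)
    case (gen h w)
    then show ?case using g by simp
  next
    case (add r f h)
    then show ?case by (intro reg_add)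
  next
    case (mult r f s h)
    then show ?case by (intro reg_mult)
  qed (simp_all add: reg_const)
  then show ?thesis by simp
qed

text \<open>Elements of \<open>regular_fns\<close> vanish off the moduli space, so vector fields have to be applied to
  restrictions; \<open>reg\<close> and \<open>ap\<close> hide these restrictions.\<close>

definition ap :: "nat \<Rightarrow> (complex \<Rightarrow> complex \<Rightarrow> complex mat) \<Rightarrow> (fn \<Rightarrow> fn) \<Rightarrow> fn \<Rightarrow> fn" where
  "ap n W E f = E (on (moduli n W) f)"

lemma ap_cong: "(\<And>p. p \<in> moduli n W \<Longrightarrow> f p = g p) \<Longrightarrow> ap n W E f = ap n W E g"
  unfolding ap_def by (simp cong: on_cong)

context
  fixes n W E
  assumes E: "vector_field n W E"
begin

lemma vf_closed: "f \<in> regular_fns n W \<Longrightarrow> E f \<in> regular_fns n W"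
  using E unfolding vector_field_def by (elim conjE) (erule bspec)

lemma vf_add: "f \<in> regular_fns n W \<Longrightarrow> g \<in> regular_fns n W \<Longrightarrow> E (\<lambda>p. f p + g p) = (\<lambda>p. E f p + E g p)"
  using E unfolding vector_field_def by (elim conjE) (drule (1) bspec, drule (1) bspec)

lemma vf_scale: "f \<in> regular_fns n W \<Longrightarrow> E (\<lambda>p. a * f p) = (\<lambda>p. a * E f p)"
  using E unfolding vector_field_def by (elim conjE) (drule (1) bspec, erule spec)

lemma vf_mult: "f \<in> regular_fns n W \<Longrightarrow> g \<in> regular_fns n W \<Longrightarrow>
    E (\<lambda>p. f p * g p) = (\<lambda>p. f p * E g p + g p * E f p)"
  using E unfolding vector_field_def by (elim conjE) (drule (1) bspec, drule (1) bspec)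

lemma ap_add: "reg n W f \<Longrightarrow> reg n W g \<Longrightarrow> ap n W E (\<lambda>p. f p + g p) p = ap n W E f p + ap n W E g p"
  unfolding reg_def ap_def on_add by (simp only: vf_add)

lemma ap_scale: 
  assumes "reg n W f" shows "ap n W E (\<lambda>p. a * f p) p = a * ap n W E f p"
proof -
  have "on (moduli n W) (\<lambda>p. a * f p) = (\<lambda>p. a * on (moduli n W) f p)" by (auto simp: on_def)
  then show ?thesis using assms unfolding reg_def ap_def by (simp only: vf_scale)
qed

lemma ap_diff: "reg n W f \<Longrightarrow> reg n W g \<Longrightarrow> ap n W E (\<lambda>p. f p - g p) p = ap n W E f p - ap n W E g p"
  using ap_add[of f "\<lambda>p. -1 * g p" p] ap_scale[of g "-1" p] reg_scale[of n W g "-1"] by simp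

lemma ap_mult:
  assumes "reg n W f" "reg n W g" "p \<in> moduli n W"
  shows "ap n W E (\<lambda>p. f p * g p) p = f p * ap n W E g p + g p * ap n W E f p"
proof -
  have "ap n W E (\<lambda>p. f p * g p) = (\<lambda>p. on (moduli n W) f p * ap n W E g p + on (moduli n W) g p * ap n W E f p)"
    using assms(1,2) unfolding reg_def ap_def on_mult by (simp only: vf_mult)
  then show ?thesis using assms(3) by simp
qed

lemma ap_const:
  assumes "p \<in> moduli n W" shows "ap n W E (\<lambda>p. a) p = 0"
proof -
  have "ap n W E (\<lambda>p. 1) p = 0"
    using ap_mult[OF reg_const reg_const assms, of 1 1] by simp
  then show ?thesis using ap_scale[OF reg_const, of a 1 p] by simp
qed

lemma ap_power:
  assumes "reg n W f" "p \<in> moduli n W"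
  shows "ap n W E (\<lambda>p. f p ^ k) p = of_nat k * f p ^ (k - 1) * ap n W E f p"
proof (induction k)
  case 0 then show ?case using ap_const[OF assms(2)] by simp
next
  case (Suc k)
  then show ?case using ap_mult[OF assms(1) reg_power[OF assms(1)] assms(2), of k]
    by (cases k) (simp_all add: algebra_simps)
qed

lemma ap_out: "reg n W f \<Longrightarrow> p \<notin> moduli n W \<Longrightarrow> ap n W E f p = 0"
  using regular_on[OF vf_closed[of "on (moduli n W) f"]] on_out[of p "moduli n W"] unfolding reg_def ap_def by metis

end

section \<open>The intersection matrix\<close>

lemma entry_mat1 [simp]: "1 \<le> i \<Longrightarrow> i \<le> N \<Longrightarrow> 1 \<le> j \<Longrightarrow> j \<le> N \<Longrightarrow> entry (mat1 N a) i j = a i j"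
  by (auto simp: entry_def mat1_def)

lemma mat1_carrier [simp]: "mat1 N a \<in> carrier_mat N N"
  by (simp add: mat1_def)

lemma entry_mult:
  assumes "A \<in> carrier_mat N N" "B \<in> carrier_mat N N" "1 \<le> i" "i \<le> N" "1 \<le> j" "j \<le> N"
  shows "entry (A * B) i j = (\<Sum>k\<in>{1..N}. entry A i k * entry B k j)"
proof -
  have "entry (A * B) i j = (\<Sum>k\<in>{0..<N}. A $$ (i - 1, k) * B $$ (k, j - 1))"
    using assms by (simp add: entry_def scalar_prod_def)
  also have "\<dots> = (\<Sum>k\<in>{1..N}. entry A i k * entry B k j)"
    unfolding entry_def by (rule sum.reindex_bij_witness[of _ "\<lambda>k. k - 1" "\<lambda>k. k + 1"]) auto
  finally show ?thesis .
qed

lemma entry_add: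
  assumes "A \<in> carrier_mat N N" "B \<in> carrier_mat N N" "1 \<le> i" "i \<le> N" "1 \<le> j" "j \<le> N"
  shows "entry (A + B) i j = entry A i j + entry B i j"
  using assms by (simp add: entry_def)

lemma entry_minus:
  assumes "A \<in> carrier_mat N N" "B \<in> carrier_mat N N" "1 \<le> i" "i \<le> N" "1 \<le> j" "j \<le> N"
  shows "entry (A - B) i j = entry A i j - entry B i j"
  using assms by (simp add: entry_def)

lemma entry_smult:
  assumes "A \<in> carrier_mat N N" "1 \<le> i" "i \<le> N" "1 \<le> j" "j \<le> N"
  shows "entry (a \<cdot>\<^sub>m A) i j = a * entry A i j"
  using assms by (simp add: entry_def)

lemma entry_transpose:
  assumes "A \<in> carrier_mat N N" "1 \<le> i" "i \<le> N" "1 \<le> j" "j \<le> N"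
  shows "entry (transpose_mat A) i j = entry A j i"
  using assms by (simp add: entry_def)

lemma entry_eqI:
  assumes "A \<in> carrier_mat N N" "B \<in> carrier_mat N N"
    and "\<And>i j. 1 \<le> i \<Longrightarrow> i \<le> N \<Longrightarrow> 1 \<le> j \<Longrightarrow> j \<le> N \<Longrightarrow> entry A i j = entry B i j"
  shows "A = B"
proof (rule eq_matI)
  fix i j assume "i < dim_row B" "j < dim_col B"
  then show "A $$ (i, j) = B $$ (i, j)"
    using assms(3)[of "i + 1" "j + 1"] assms(2) by (simp add: entry_def)
qed (use assms in auto)

lemma GM1_carrier [simp]: "GM1 n x y \<in> carrier_mat (n + 1) (n + 1)"
  and GM2_carrier [simp]: "GM2 n x y \<in> carrier_mat (n + 1) (n + 1)"
  by (simp_all only: GM1_def GM2_def mat1_carrier)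

lemmas GM_carrier_Suc [simp] = GM1_carrier[simplified] GM2_carrier[simplified]

text \<open>Shifted by one, it gives S_2(n+2, n+1) = (n+1)(n+2)/2, which relates the coefficient
  n(n+1)/2 in the last entry of \<open>GM2\<close> to the Stirling number in
  \<open>GM1\<close>.\<close>

lemma Stirling_top: "2 * Stirling (Suc n) n = Suc n * n"
proof (induction n)
  case (Suc n)
  have "Stirling (Suc (Suc n)) (Suc n) = Suc n * Stirling (Suc n) (Suc n) + Stirling (Suc n) n" by simp
  then show ?case using Suc by simp
qed simp

definition phi_sign :: "nat \<Rightarrow> nat \<Rightarrow> complex" where
  "phi_sign n i = (if odd n \<and> half_dim n < i then - 1 else 1)"

lemma Phi_carrier: "Phi n \<in> carrier_mat (n + 1) (n + 1)"
proof (cases "odd n")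
  case True
  then have "half_dim n + half_dim n = n + 1" by (auto simp: half_dim_def elim: oddE)
  moreover have "Phi n \<in> carrier_mat (half_dim n + half_dim n) (half_dim n + half_dim n)"
    using True unfolding Phi_def Let_def by (simp only: if_True not_False_eq_True) (rule four_block_carrier_mat; simp)
  ultimately show ?thesis by simp
qed (simp add: Phi_def antidiag_def)

lemma entry_Phi:
  assumes "1 \<le> i" "i \<le> n + 1" "1 \<le> j" "j \<le> n + 1"
  shows "entry (Phi n) i j = (if i + j = n + 2 then phi_sign n i else 0)"
proof (cases "odd n")
  case True
  define m where "m = half_dim n"
  have m: "m + m = n + 1" using True by (auto simp: m_def half_dim_def elim: oddE)
  have ad: "antidiag m $$ (k, l) = (if k + l + 1 = m then 1 else 0)" if "k < m" "l < m" for k l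
    using that by (simp add: antidiag_def mat1_def)
  have dim: "dim_row (antidiag m) = m" "dim_col (antidiag m) = m" by (simp_all add: antidiag_def mat1_def)
  have "entry (Phi n) i j = four_block_mat (0\<^sub>m m m) (antidiag m) (- antidiag m) (0\<^sub>m m m) $$ (i - 1, j - 1)"
    using True by (simp add: Phi_def entry_def m_def Let_def)
  also have "\<dots> = (if i \<le> m then if j \<le> m then 0 else antidiag m $$ (i - 1, j - 1 - m)
      else if j \<le> m then (- antidiag m) $$ (i - 1 - m, j - 1) else 0)"
    using assms m by (subst index_mat_four_block(1)) auto
  also have "\<dots> = (if i + j = n + 2 then (if m < i then - 1 else 1) else 0)"
  proof (cases "i \<le> m")
    case True
    then show ?thesis using assms m by (cases "j \<le> m") (simp_all add: ad, linarith?)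
  next
    case False
    then show ?thesis using assms m by (cases "j \<le> m") (simp_all add: ad dim, linarith?)
  qed
  finally show ?thesis using True by (simp add: phi_sign_def m_def)
next
  case False
  then show ?thesis using assms by (simp add: Phi_def antidiag_def phi_sign_def)
qed

lemma phi_sign_square: "phi_sign n i * phi_sign n i = 1"
  by (simp add: phi_sign_def)

lemma phi_sign_nz: "phi_sign n i \<noteq> 0"
  by (simp add: phi_sign_def)

text \<open>Homogeneous elements of \<open>\<complex>[x, 1/(x\<^bsup>n+2\<^esup> - y)]\<close>, where \<open>y\<close> has weight \<open>n + 2\<close>.\<close>

inductive xform :: "nat \<Rightarrow> int \<Rightarrow> (complex \<Rightarrow> complex \<Rightarrow> complex) \<Rightarrow> bool" for n where
  zero: "xform n r (\<lambda>x y. 0)"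
| const: "xform n 0 (\<lambda>x y. a)"
| x: "xform n 1 (\<lambda>x y. x)"
| inv: "xform n (- (int n + 2)) (\<lambda>x y. 1 / (x ^ (n + 2) - y))"
| add: "xform n r F \<Longrightarrow> xform n r G \<Longrightarrow> xform n r (\<lambda>x y. F x y + G x y)"
| mult: "xform n r F \<Longrightarrow> xform n s G \<Longrightarrow> xform n (r + s) (\<lambda>x y. F x y * G x y)"

lemma xform_weight: "xform n r F \<Longrightarrow> r = s \<Longrightarrow> xform n s F"
  by simp

lemma xform_scale: "xform n r F \<Longrightarrow> xform n r (\<lambda>x y. a * F x y)"
  using xform.mult[OF xform.const] by fastforce

lemma xform_power: "xform n (int k) (\<lambda>x y. x ^ k)"
proof (induction k)
  case 0 show ?case using xform.const[of n 1] by simp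
next
  case (Suc k)
  from xform.mult[OF xform.x Suc] show ?case by (simp add: algebra_simps)
qed

lemma xform_diff: "xform n r F \<Longrightarrow> xform n r G \<Longrightarrow> xform n r (\<lambda>x y. F x y - G x y)"
  using xform.add[OF _ xform_scale[where a = "-1"]] by fastforce

lemma xform_sum: "(\<And>i. i \<in> A \<Longrightarrow> xform n r (F i)) \<Longrightarrow> xform n r (\<lambda>x y. \<Sum>i\<in>A. F i x y)"
  by (induction A rule: infinite_finite_induct) (auto intro: xform.intros)

text \<open>The derivative of 1/(x^{n+2} - y) is -(n+2) x^{n+1} times its square, so differentiation
  stays in the ring and lowers the weight by that of x.\<close>

lemma xform_deriv:
  assumes "xform n r F"
  shows "\<exists>F'. xform n (r - 1) F' \<and>
    (\<forall>x y. good_param n x y \<longrightarrow> ((\<lambda>z. F z y) has_field_derivative F' x y) (at x))"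
  using assms
proof induction
  case (zero r)
  show ?case by (intro exI[of _ "\<lambda>x y. 0"]) (auto intro: xform.intros)
next
  case (const a)
  show ?case by (intro exI[of _ "\<lambda>x y. 0"]) (auto intro: xform.intros)
next
  case x
  show ?case using xform.const[of n 1]
    by (intro exI[of _ "\<lambda>x y. 1"]) (auto intro!: derivative_eq_intros)
next
  case inv
  let ?F = "\<lambda>x y. - of_nat (n + 2) * (x ^ (n + 1) * (1 / (x ^ (n + 2) - y) * (1 / (x ^ (n + 2) - y)))) :: complex"
  have "xform n (- (int n + 2) - 1) ?F"
    by (rule xform_weight[OF xform_scale[OF xform.mult[OF xform_power xform.mult[OF xform.inv xform.inv]]]]) simp
  moreover have "((\<lambda>z. 1 / (z ^ (n + 2) - y)) has_field_derivative ?F x y) (at x)" if "good_param n x y" for x y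
  proof -
    have "x ^ (n + 2) - y \<noteq> 0" using that by (simp add: good_param_def)
    moreover have "((\<lambda>z. z ^ (n + 2) - y) has_field_derivative of_nat (n + 2) * x ^ (n + 1)) (at x)"
      using DERIV_diff[OF DERIV_power[OF DERIV_ident, of "n + 2" x UNIV] DERIV_const[of y]] by simp
    ultimately have "((\<lambda>z. inverse (z ^ (n + 2) - y)) has_field_derivative
        - (inverse (x ^ (n + 2) - y) * (of_nat (n + 2) * x ^ (n + 1)) * inverse (x ^ (n + 2) - y))) (at x)"
      by (intro DERIV_inverse')
    then show ?thesis by (simp only: inverse_eq_divide mult_minus_left mult_minus_right ac_simps)
  qed
  ultimately show ?case by blast
next
  case (add r F G)
  then obtain F' G' where "xform n (r - 1) F'" "xform n (r - 1) G'"
    "\<forall>x y. good_param n x y \<longrightarrow> ((\<lambda>z. F z y) has_field_derivative F' x y) (at x)"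
    "\<forall>x y. good_param n x y \<longrightarrow> ((\<lambda>z. G z y) has_field_derivative G' x y) (at x)" by blast
  then show ?case
    by (intro exI[of _ "\<lambda>x y. F' x y + G' x y"]) (auto intro!: xform.add derivative_intros)
next
  case (mult r F s G)
  then obtain F' G' where *: "xform n (r - 1) F'" "xform n (s - 1) G'"
    "\<forall>x y. good_param n x y \<longrightarrow> ((\<lambda>z. F z y) has_field_derivative F' x y) (at x)"
    "\<forall>x y. good_param n x y \<longrightarrow> ((\<lambda>z. G z y) has_field_derivative G' x y) (at x)" by blast
  have "xform n (r + s - 1) (\<lambda>x y. F' x y * G x y + F x y * G' x y)"
    using xform.mult[OF *(1) mult.hyps(2)] xform.mult[OF mult.hyps(1) *(2)]
    by (auto intro!: xform.add simp: algebra_simps)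
  then show ?case using *
    by (intro exI[of _ "\<lambda>x y. F' x y * G x y + F x y * G' x y"]) (auto intro!: derivative_eq_intros)
qed

lemma xform_scaling:
  assumes "xform n r F" "z \<noteq> 0"
  shows "F (z * x) (z ^ (n + 2) * y) = z powi r * F x y"
  using assms(1)
proof induction
  case inv
  have "(z * x) ^ (n + 2) - z ^ (n + 2) * y = z ^ (n + 2) * (x ^ (n + 2) - y)"
    unfolding power_mult_distrib by (simp only: right_diff_distrib)
  moreover have "z powi (- (int n + 2)) = 1 / z ^ (n + 2)"
  proof -
    have "z powi (int n + 2) = z ^ (n + 2)" using power_int_of_nat[of z "n + 2"] by (simp add: add.commute)
    then show ?thesis unfolding power_int_minus by (simp only: inverse_eq_divide)
  qed
  ultimately show ?case by simp
qed (use assms(2) in \<open>auto simp: power_int_add algebra_simps\<close>)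

section \<open>The entries of the intersection matrix as homogeneous functions of the
  parameters\<close>

locale dwork =
  fixes n :: nat and c :: complex and W :: "complex \<Rightarrow> complex \<Rightarrow> complex mat"
  assumes n1: "n \<ge> 1" and c0: "c \<noteq> 0" and W: "is_intersection_matrix n c W"
begin

abbreviation "X \<equiv> moduli n W"

definition w :: "nat \<Rightarrow> nat \<Rightarrow> complex \<Rightarrow> complex \<Rightarrow> complex" where
  "w i j x y = entry (W x y) i j"

lemma W_carrier: "good_param n x y \<Longrightarrow> W x y \<in> carrier_mat (n + 1) (n + 1)"
  using W unfolding is_intersection_matrix_def by blast

lemma w_low:
  "\<lbrakk>good_param n x y; 1 \<le> i; 1 \<le> j; i + j \<le> n + 1\<rbrakk> \<Longrightarrow> w i j x y = 0"
  using W unfolding is_intersection_matrix_def w_def by auto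

definition c' :: complex where "c' = (- of_nat (n + 2)) ^ n * c"

lemma c'0: "c' \<noteq> 0"
proof -
  have "(- of_nat (n + 2) :: complex) \<noteq> 0" unfolding neg_equal_0_iff_equal of_nat_eq_0_iff by simp
  then show ?thesis unfolding c'_def using c0 by (simp only: mult_eq_0_iff power_eq_0_iff) simp
qed

lemma w_anti:
  assumes "good_param n x y" "1 \<le> i" "i \<le> n + 1" "i + j = n + 2"
  shows "w i j x y = (- 1) ^ (i - 1) * (c' * (1 / (x ^ (n + 2) - y)))"
proof -
  have "entry (W x y) 1 (n + 1) = (- of_nat (n + 2)) ^ n * (c / (x ^ (n + 2) - y))"
    "entry (W x y) i (n + 2 - i) = (- 1) ^ (i - 1) * entry (W x y) 1 (n + 1)"
    using W assms unfolding is_intersection_matrix_def by auto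
  moreover have "j = n + 2 - i" using assms by simp
  ultimately show ?thesis by (simp add: w_def c'_def)
qed

lemma w_sym:
  assumes "good_param n x y" "1 \<le> i" "i \<le> n + 1" "1 \<le> j" "j \<le> n + 1"
  shows "w j i x y = (- 1) ^ n * w i j x y"
proof -
  have "transpose_mat (W x y) = (- 1) ^ n \<cdot>\<^sub>m W x y"
    using W assms(1) unfolding is_intersection_matrix_def by blast
  then have "entry (transpose_mat (W x y)) i j = entry ((- 1) ^ n \<cdot>\<^sub>m W x y) i j" by simp
  then show ?thesis
    unfolding w_def using entry_transpose[OF W_carrier[OF assms(1)]] entry_smult[OF W_carrier[OF assms(1)]] assms
    by simp
qed

text \<open>For i <= n row i of \<open>GM1\<close> is a unit vector, so w_{i+1,j} occurs with
  coefficient 1 and the equation can be solved for it.\<close>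

lemma w_deriv:
  assumes "good_param n x y" "1 \<le> i" "i \<le> n" "1 \<le> j" "j \<le> n + 1"
  shows "((\<lambda>z. w i j z y) has_field_derivative (w (i + 1) j x y +
    (if j \<le> n then w i (j + 1) x y
     else (\<Sum>l\<in>{1..n+1}. w i l x y * (- of_nat (Stirling (n + 2) l) * x ^ l / (x ^ (n + 2) - y)))))) (at x)"
proof -
  let ?G = "GM1 n x y"
  note Wc = W_carrier[OF assms(1)]
  have "((\<lambda>z. w i j z y) has_field_derivative
     entry (?G * W x y + W x y * transpose_mat ?G) i j) (at x)"
    using W assms unfolding is_intersection_matrix_def w_def by auto
  moreover have "entry (?G * W x y) i j = w (i + 1) j x y"
  proof -
    have "entry (?G * W x y) i j = (\<Sum>k\<in>{1..n+1}. entry ?G i k * w k j x y)"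
      unfolding w_def using assms Wc by (intro entry_mult) auto
    also have "\<dots> = (\<Sum>k\<in>{1..n+1}. if k = i + 1 then w k j x y else 0)"
      using assms by (intro sum.cong refl) (auto simp: GM1_def)
    finally show ?thesis using assms by simp
  qed
  moreover have "entry (W x y * transpose_mat ?G) i j = (if j \<le> n then w i (j + 1) x y
     else (\<Sum>l\<in>{1..n+1}. w i l x y * (- of_nat (Stirling (n + 2) l) * x ^ l / (x ^ (n + 2) - y))))"
  proof -
    have "entry (W x y * transpose_mat ?G) i j = (\<Sum>k\<in>{1..n+1}. w i k x y * entry (transpose_mat ?G) k j)"
      unfolding w_def using assms Wc by (intro entry_mult) auto
    also have "\<dots> = (\<Sum>k\<in>{1..n+1}. w i k x y * entry ?G j k)"
      using assms by (intro sum.cong refl) (simp add: entry_transpose[where N = "n + 1"])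
    also have "\<dots> = (\<Sum>k\<in>{1..n+1}. if j \<le> n then (if k = j + 1 then w i k x y else 0)
        else w i k x y * (- of_nat (Stirling (n + 2) k) * x ^ k / (x ^ (n + 2) - y)))"
      using assms by (intro sum.cong refl) (auto simp: GM1_def)
    finally show ?thesis using assms by (cases "j \<le> n") simp_all
  qed
  moreover have "?G * W x y \<in> carrier_mat (n + 1) (n + 1)" "W x y * transpose_mat ?G \<in> carrier_mat (n + 1) (n + 1)"
    using Wc mult_carrier_mat[OF GM1_carrier Wc] mult_carrier_mat[OF Wc, of "transpose_mat ?G"] by simp_all
  ultimately show ?thesis using assms by (simp add: entry_add[where N = "n + 1"])
qed

text \<open>Antidiagonal by antidiagonal, and by increasing row index on each antidiagonal, the
  \<open>dt\<^sub>1\<close> component of the differential equation expresses an entry by earlier ones.\<close>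

lemma w_xform:
  assumes "1 \<le> i" "i \<le> n + 1" "1 \<le> j" "j \<le> n + 1"
  shows "\<exists>F. xform n (- int (i + j)) F \<and> (\<forall>x y. good_param n x y \<longrightarrow> w i j x y = F x y)"
  using assms
proof (induction "i + j" arbitrary: i j rule: less_induct)
  case outer: less
  show ?case using outer.prems outer.hyps
  proof (induction i arbitrary: j rule: less_induct)
    case (less i)
    consider "i + j \<le> n + 1" | "i + j = n + 2" | "i + j > n + 2" by linarith
    then show ?case
    proof cases
      case 1
      then show ?thesis using w_low less.prems by (intro exI[of _ "\<lambda>x y. 0"]) (auto intro: xform.zero)
    next
      case 2
      show ?thesis
      proof (intro exI[of _ "\<lambda>x y. (- 1) ^ (i - 1) * (c' * (1 / (x ^ (n + 2) - y)))"] conjI allI impI)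
        show "xform n (- int (i + j)) (\<lambda>x y. (- 1) ^ (i - 1) * (c' * (1 / (x ^ (n + 2) - y))))"
          unfolding 2 by (rule xform_weight[OF xform_scale[OF xform_scale[OF xform.inv]]]) simp
      qed (use w_anti less.prems 2 in auto)
    next
      case 3
      \<comment> \<open>The equation for the derivative of w_{a,j}, one antidiagonal earlier, is
        solved for w_{a+1,j}.\<close>
      define a where "a = i - 1"
      have a: "i = a + 1" "1 \<le> a" "a \<le> n" using 3 less.prems by (auto simp: a_def)
      have "\<exists>F. xform n (- int (a + j)) F \<and> (\<forall>x y. good_param n x y \<longrightarrow> w a j x y = F x y)"
        using less.prems a by (intro less.prems(5)) auto
      then obtain F where F: "xform n (- int (a + j)) F" "\<And>x y. good_param n x y \<Longrightarrow> w a j x y = F x y"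
        by blast
      obtain F' where F': "xform n (- int (a + j) - 1) F'"
        "\<And>x y. good_param n x y \<Longrightarrow> ((\<lambda>z. F z y) has_field_derivative F' x y) (at x)"
        using xform_deriv[OF F(1)] by blast
      \<comment> \<open>\<open>F\<close> represents the entry only at good parameters. For fixed y
        these form an open set in x, so the two derivatives agree.\<close>
      have F'': "((\<lambda>z. w a j z y) has_field_derivative F' x y) (at x)" if g: "good_param n x y" for x y
      proof -
        have "open {z. y * (z ^ (n + 2) - y) \<noteq> 0}"
          by (intro open_Collect_neq continuous_intros)
        then have "\<forall>\<^sub>F z in nhds x. y * (z ^ (n + 2) - y) \<noteq> 0"
          using g by (auto simp: eventually_nhds good_param_def)
        then have "\<forall>\<^sub>F z in nhds x. w a j z y = F z y"
          by eventually_elim (use F(2) in \<open>auto simp: good_param_def\<close>)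
        then show ?thesis unfolding DERIV_cong_ev[OF refl \<open>\<forall>\<^sub>F z in nhds x. w a j z y = F z y\<close> refl]
          by (intro F'(2)[OF g])
      qed
      show ?thesis
      proof (cases "j \<le> n")
        case True
        \<comment> \<open>The entry (a, j + 1) lies on the same antidiagonal as (i, j) but in an
          earlier row, which is where the inner induction is used.\<close>
        have "\<exists>G. xform n (- int (a + (j + 1))) G \<and> (\<forall>x y. good_param n x y \<longrightarrow> w a (j + 1) x y = G x y)"
        proof (rule less.IH)
          fix i' j' :: nat assume "i' + j' < a + (j + 1)" "1 \<le> i'" "i' \<le> n + 1" "1 \<le> j'" "j' \<le> n + 1"
          then show "\<exists>F. xform n (- int (i' + j')) F \<and> (\<forall>x y. good_param n x y \<longrightarrow> w i' j' x y = F x y)"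
            using less.prems(5)[of i' j'] a by simp
        qed (use a True in auto)
        then obtain G where G: "xform n (- int (a + (j + 1))) G" "\<And>x y. good_param n x y \<Longrightarrow> w a (j + 1) x y = G x y"
          by blast
        have "xform n (- int (i + j)) (\<lambda>x y. F' x y - G x y)"
          using F'(1) G(1) a by (intro xform_diff) (auto elim!: xform_weight)
        moreover have "w i j x y = F' x y - G x y" if g: "good_param n x y" for x y
          using DERIV_unique[OF F''[OF g] w_deriv[OF g a(2,3)]] less.prems True G(2)[OF g] a by simp
        ultimately show ?thesis by blast
      next
        case False
        \<comment> \<open>In the last column the last row of \<open>GM1\<close> brings in the whole
          row a. Since j = n + 1, every entry of that row lies on an earlier antidiagonal.\<close>
        have "\<forall>l\<in>{1..n+1}. \<exists>G. xform n (- int (a + l)) G \<and> (\<forall>x y. good_param n x y \<longrightarrow> w a l x y = G x y)"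
          using less.prems a False by (intro ballI less.prems(5)) auto
        then obtain G where G: "\<And>l. l \<in> {1..n+1} \<Longrightarrow> xform n (- int (a + l)) (G l)"
          "\<And>l x y. l \<in> {1..n+1} \<Longrightarrow> good_param n x y \<Longrightarrow> w a l x y = G l x y"
          by metis
        define H where "H x y = F' x y - (\<Sum>l\<in>{1..n+1}. - of_nat (Stirling (n + 2) l) * (G l x y * (x ^ l * (1 / (x ^ (n + 2) - y)))))" for x y
        have j: "j = n + 1" using False less.prems by simp
        have "xform n (- int (i + j)) H"
          unfolding H_def
        proof (intro xform_diff xform_sum xform_scale)
          show "xform n (- int (i + j)) F'" using F'(1) a by (auto elim!: xform_weight)
          fix l assume l: "l \<in> {1..n+1}"
          show "xform n (- int (i + j)) (\<lambda>x y. G l x y * (x ^ l * (1 / (x ^ (n + 2) - y))))"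
            using xform.mult[OF G(1)[OF l] xform.mult[OF xform_power[of n l] xform.inv]] j a
            by (auto elim!: xform_weight)
        qed
        moreover have "w i j x y = H x y" if g: "good_param n x y" for x y
        proof -
          have "F' x y = w i j x y + (\<Sum>l\<in>{1..n+1}. w a l x y * (- of_nat (Stirling (n + 2) l) * x ^ l / (x ^ (n + 2) - y)))"
            using DERIV_unique[OF F''[OF g] w_deriv[OF g a(2,3)]] less.prems False a by simp
          moreover have "(\<Sum>l\<in>{1..n+1}. w a l x y * (- of_nat (Stirling (n + 2) l) * x ^ l / (x ^ (n + 2) - y)))
            = (\<Sum>l\<in>{1..n+1}. - of_nat (Stirling (n + 2) l) * (G l x y * (x ^ l * (1 / (x ^ (n + 2) - y)))))"
            by (intro sum.cong refl) (simp add: G(2)[OF _ g])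
          ultimately show ?thesis unfolding H_def by simp
        qed
        ultimately show ?thesis by blast
      qed
    qed
  qed
qed

end

section \<open>Vector fields and Gauss-Manin matrices\<close>

lemma vector_fieldI:
  assumes "\<And>f. f \<in> regular_fns n W \<Longrightarrow> E f \<in> regular_fns n W"
    and "\<And>f g. f \<in> regular_fns n W \<Longrightarrow> g \<in> regular_fns n W \<Longrightarrow> E (\<lambda>p. f p + g p) = (\<lambda>p. E f p + E g p)"
    and "\<And>f a. f \<in> regular_fns n W \<Longrightarrow> E (\<lambda>p. a * f p) = (\<lambda>p. a * E f p)"
    and "\<And>f g. f \<in> regular_fns n W \<Longrightarrow> g \<in> regular_fns n W \<Longrightarrow> E (\<lambda>p. f p * g p) = (\<lambda>p. f p * E g p + g p * E f p)"
  shows "vector_field n W E"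
  unfolding vector_field_def using assms by (intro conjI ballI allI)

lemma regular_add: "f \<in> regular_fns n W \<Longrightarrow> g \<in> regular_fns n W \<Longrightarrow> (\<lambda>p. f p + g p) \<in> regular_fns n W"
  unfolding regular_fns_def by (rule alg_gen.add)

lemma regular_mult: "f \<in> regular_fns n W \<Longrightarrow> g \<in> regular_fns n W \<Longrightarrow> (\<lambda>p. f p * g p) \<in> regular_fns n W"
  unfolding regular_fns_def by (rule alg_gen.mult)

lemma regular_scale: "f \<in> regular_fns n W \<Longrightarrow> (\<lambda>p. a * f p) \<in> regular_fns n W"
proof -
  assume f: "f \<in> regular_fns n W"
  have "(\<lambda>p. on (moduli n W) (\<lambda>p. a) p * f p) \<in> regular_fns n W"
    using f unfolding regular_fns_def by (intro alg_gen.mult alg_gen.const)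
  moreover have "(\<lambda>p. on (moduli n W) (\<lambda>p. a) p * f p) = (\<lambda>p. a * f p)"
    using regular_on[OF f] by (auto simp: fun_eq_iff on_def) metis
  ultimately show ?thesis by simp
qed

lemma regular_diff: "f \<in> regular_fns n W \<Longrightarrow> g \<in> regular_fns n W \<Longrightarrow> (\<lambda>p. f p - g p) \<in> regular_fns n W"
  using regular_add[OF _ regular_scale[where a = "-1"]] by fastforce

lemma reg_mult_regular: "reg n W t \<Longrightarrow> f \<in> regular_fns n W \<Longrightarrow> (\<lambda>p. t p * f p) \<in> regular_fns n W"
proof -
  assume t: "reg n W t" and f: "f \<in> regular_fns n W"
  have "(\<lambda>p. on (moduli n W) t p * f p) = (\<lambda>p. t p * f p)"
    using regular_on[OF f] by (auto simp: fun_eq_iff on_def) metis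
  then show ?thesis using regular_mult[OF t[unfolded reg_def] f] by simp
qed

text \<open>With constant t this covers H as a combination of Lie algebra fields, and with t = t_2
  the correction term of Option 2.\<close>

lemma vector_field_lincomb:
  assumes E: "vector_field n W E" and F: "vector_field n W F" and t: "reg n W t"
    and H: "\<And>f. f \<in> regular_fns n W \<Longrightarrow> H f = (\<lambda>p. a * E f p + t p * F f p)"
  shows "vector_field n W H"
proof (rule vector_fieldI, goal_cases)
  case (1 f)
  then show ?case
    by (simp add: H regular_add regular_scale reg_mult_regular[OF t] vf_closed[OF E] vf_closed[OF F])
next
  case (2 f g)
  then show ?case
    by (simp add: H regular_add vf_add[OF E] vf_add[OF F] algebra_simps)
next
  case (3 f b)
  then show ?case
    by (simp add: H regular_scale vf_scale[OF E] vf_scale[OF F] algebra_simps)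
next
  case (4 f g)
  then show ?case
    by (simp add: H regular_mult vf_mult[OF E] vf_mult[OF F] algebra_simps)
qed

lemma vector_field_commutator:
  assumes E: "vector_field n W E" and F: "vector_field n W F"
    and H: "\<And>f. f \<in> regular_fns n W \<Longrightarrow> H f = (\<lambda>p. E (F f) p - F (E f) p)"
  shows "vector_field n W H"
proof (rule vector_fieldI, goal_cases)
  case (1 f)
  then show ?case by (simp add: H regular_diff vf_closed[OF E] vf_closed[OF F])
next
  case (2 f g)
  then show ?case
    by (simp add: H regular_add vf_add[OF E] vf_add[OF F] vf_closed[OF E] vf_closed[OF F] algebra_simps)
next
  case (3 f b)
  then show ?case
    by (simp add: H regular_scale vf_scale[OF E] vf_scale[OF F] vf_closed[OF E] vf_closed[OF F] algebra_simps)
next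
  case (4 f g)
  then show ?case
    by (simp add: H regular_mult regular_add vf_add[OF E] vf_add[OF F] vf_mult[OF E] vf_mult[OF F]
        vf_closed[OF E] vf_closed[OF F] algebra_simps)
qed

lemma N_nz: "(of_nat (n + 2) :: complex) \<noteq> 0"
  unfolding of_nat_eq_0_iff by simp

text \<open>The entry \<open>s\<^sub>i\<^sub>k\<close> has weight \<open>scale n * (k + hw n i)\<close>; the numbers \<open>hw n i\<close> are the diagonal
  entries of the matrix \<open>h\<close> of the introduction.\<close>

definition hw :: "nat \<Rightarrow> nat \<Rightarrow> int" where
  "hw n i = (if i = 1 then - 1 else if i = n + 1 then 1 else if 3 \<le> n \<and> i = 2 then 1
     else if 3 \<le> n \<and> i = n then - 1 else 0)"

text \<open>The factor 2 in H = -2 R_{g11} for n = 2.\<close>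

definition scale :: "nat \<Rightarrow> int" where
  "scale n = (if n = 2 then 2 else 1)"

text \<open>Says that diag(\<open>hw n 1\<close>, ..., \<open>hw n (n + 1)\<close>) lies in the Lie
  algebra of \<open>Phi\<close>. Hence scaling row i by z^{hw n i} does not disturb S Omega S^tr =
  Phi.\<close>

lemma hw_dual: "n \<ge> 1 \<Longrightarrow> 1 \<le> i \<Longrightarrow> i + j = n + 2 \<Longrightarrow> hw n j = - hw n i"
  by (auto simp: hw_def)

context dwork
begin

section \<open>Relations between the entries of S, and Gauss-Manin matrices entrywise\<close>

definition wf :: "nat \<Rightarrow> nat \<Rightarrow> fn" where
  "wf i j p = w i j (t_one p) (t_disc p)"

definition disc :: fn where
  "disc p = t_one p ^ (n + 2) - t_disc p"

lemma X_good: "p \<in> X \<Longrightarrow> good_param n (t_one p) (t_disc p)"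
  by (cases p) (simp add: moduli_def)

lemma disc_nz: "p \<in> X \<Longrightarrow> disc p \<noteq> 0"
  and t_disc_nz: "p \<in> X \<Longrightarrow> t_disc p \<noteq> 0"
  using X_good by (auto simp: good_param_def disc_def)

lemma s_upper: "p \<in> X \<Longrightarrow> 1 \<le> i \<Longrightarrow> i < j \<Longrightarrow> j \<le> n + 1 \<Longrightarrow> s_entry i j p = 0"
  by (cases p) (auto simp: moduli_def)

lemma s_11: "p \<in> X \<Longrightarrow> s_entry 1 1 p = 1"
  by (cases p) (simp add: moduli_def)

lemma sum_swap_mult:
  "(\<Sum>l\<in>A. (\<Sum>k\<in>B. f k * g k l) * h l) = (\<Sum>k\<in>B. \<Sum>l\<in>A. f k * g k l * (h l :: complex))"
  unfolding sum_distrib_right by (rule sum.swap)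

lemma entry_congruence:
  assumes S: "S \<in> carrier_mat N N" and M: "M \<in> carrier_mat N N" and ab: "1 \<le> a" "a \<le> N" "1 \<le> b" "b \<le> N"
  shows "entry (S * M * transpose_mat S) a b
    = (\<Sum>k\<in>{1..N}. \<Sum>l\<in>{1..N}. entry S a k * entry M k l * (entry S b l :: complex))"
proof -
  have "entry (S * M * transpose_mat S) a b
      = (\<Sum>l\<in>{1..N}. entry (S * M) a l * entry (transpose_mat S) l b)"
    using S ab mult_carrier_mat[OF S M] by (intro entry_mult) auto
  also have "\<dots> = (\<Sum>l\<in>{1..N}. (\<Sum>k\<in>{1..N}. entry S a k * entry M k l) * entry S b l)"
    using ab by (intro sum.cong refl) (auto simp: entry_mult[OF S M] entry_transpose[OF S])
  finally show ?thesis unfolding sum_swap_mult .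
qed

lemma s_rel:
  assumes "p \<in> X" "1 \<le> a" "a \<le> n + 1" "1 \<le> b" "b \<le> n + 1"
  shows "(\<Sum>k\<in>{1..n+1}. \<Sum>l\<in>{1..n+1}. s_entry a k p * wf k l p * s_entry b l p)
     = (if a + b = n + 2 then phi_sign n a else 0)"
proof -
  obtain x y S where p: "p = (x, y, S)" by (cases p)
  have S: "S \<in> carrier_mat (n + 1) (n + 1)" "S * W x y * transpose_mat S = Phi n"
    using assms(1) by (auto simp: p moduli_def)
  have "W x y \<in> carrier_mat (n + 1) (n + 1)" using W_carrier[OF X_good[OF assms(1)]] by (simp add: p)
  from entry_congruence[OF S(1) this assms(2-)] show ?thesis
    unfolding S(2) entry_Phi[OF assms(2-)] by (simp add: p wf_def w_def)
qed

lemma wf_low: "p \<in> X \<Longrightarrow> 1 \<le> i \<Longrightarrow> 1 \<le> j \<Longrightarrow> i + j \<le> n + 1 \<Longrightarrow> wf i j p = 0"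
  using w_low[OF X_good] by (simp add: wf_def)

lemma wf_anti:
  "p \<in> X \<Longrightarrow> 1 \<le> i \<Longrightarrow> i \<le> n + 1 \<Longrightarrow> i + j = n + 2 \<Longrightarrow> wf i j p = (- 1) ^ (i - 1) * c' * (1 / disc p)"
  using w_anti[OF X_good] by (simp add: wf_def disc_def)

text \<open>S is lower triangular and Omega vanishes above its antidiagonal, so the relation between
  rows a and b = n + 2 - a reduces to a single term.\<close>

lemma s_diag:
  assumes "p \<in> X" "1 \<le> a" "a \<le> n + 1" "a + b = n + 2"
  shows "s_entry a a p * s_entry b b p * wf a b p = phi_sign n a"
proof -
  have "(if a + b = n + 2 then phi_sign n a else 0)
      = (\<Sum>k\<in>{1..n+1}. \<Sum>l\<in>{1..n+1}. s_entry a k p * wf k l p * s_entry b l p)"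
    using assms by (intro s_rel[symmetric]) auto
  also have "\<dots> = (\<Sum>k\<in>{1..n+1}. \<Sum>l\<in>{1..n+1}. if l = b then (if k = a then s_entry a a p * wf a b p * s_entry b b p else 0) else 0)"
  proof (intro sum.cong refl)
    fix k l assume kl: "k \<in> {1..n+1}" "l \<in> {1..n+1}"
    consider "a < k" | "b < l" | "k + l \<le> n + 1" | "k = a" "l = b" using assms(4) by linarith
    then show "s_entry a k p * wf k l p * s_entry b l p
        = (if l = b then (if k = a then s_entry a a p * wf a b p * s_entry b b p else 0) else 0)"
      using kl assms by cases (auto simp: s_upper wf_low)
  qed
  also have "\<dots> = s_entry a a p * wf a b p * s_entry b b p"
    using assms by simp
  finally show ?thesis using assms(4) by (simp add: ac_simps)
qed

lemma s_diag_nz: "p \<in> X \<Longrightarrow> 1 \<le> a \<Longrightarrow> a \<le> n + 1 \<Longrightarrow> s_entry a a p \<noteq> 0"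
  using s_diag[of p a "n + 2 - a"] phi_sign_nz[of n a] by auto

text \<open>The Gauss-Manin matrix evaluated at \<open>E\<close> is \<open>acoef E * C - bcoef E * K\<close>, where
  \<open>K = diag(1, \<dots>, n+1)\<close> and \<open>C\<close> has the superdiagonal of \<open>GM1\<close> and its last row.\<close>

definition bcoef :: "(fn \<Rightarrow> fn) \<Rightarrow> fn" where
  "bcoef E p = ap n W E t_disc p / (of_nat (n + 2) * t_disc p)"

definition acoef :: "(fn \<Rightarrow> fn) \<Rightarrow> fn" where
  "acoef E p = ap n W E t_one p - t_one p * bcoef E p"

lemma ap_t_disc: "p \<in> X \<Longrightarrow> ap n W E t_disc p = of_nat (n + 2) * t_disc p * bcoef E p"
  using t_disc_nz N_nz[of n] unfolding bcoef_def by (simp only: nonzero_mult_div_cancel_left times_divide_eq_right mult_eq_0_iff simp_thms)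

lemma ap_t_one: "ap n W E t_one p = acoef E p + t_one p * bcoef E p"
  unfolding acoef_def by simp

text \<open>The numbers \<open>acoef E\<close> and \<open>bcoef E\<close> are the values at E of
  dt_1 - t_1 dt_{n+2} / ((n+2) t_{n+2}) and of dt_{n+2} / ((n+2) t_{n+2}). In these two forms the
  dt_{n+2} part shrinks to a diagonal matrix.\<close>

lemma GM_entry:
  assumes "p \<in> X" "1 \<le> k" "k \<le> n + 1" "1 \<le> j" "j \<le> n + 1"
  shows "entry (ap n W E t_one p \<cdot>\<^sub>m GM1 n (t_one p) (t_disc p) + ap n W E t_disc p \<cdot>\<^sub>m GM2 n (t_one p) (t_disc p)) k j
    = (if k = j - 1 then acoef E p else 0) - (if k = j then of_nat j * bcoef E p else 0)
      - (if k = n + 1 then of_nat (Stirling (n + 2) j) * t_one p ^ j * acoef E p / disc p else 0)"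
proof -
  define x y where "x = t_one p" and "y = t_disc p"
  define a b where "a = acoef E p" and "b = bcoef E p"
  define N :: complex where "N = of_nat (n + 2)"
  have N: "N \<noteq> 0" unfolding N_def by (rule N_nz)
  have y0: "y \<noteq> 0" and d0: "x ^ (n + 2) - y \<noteq> 0" using t_disc_nz disc_nz assms(1) by (auto simp: x_def y_def disc_def)
  have d: "disc p = x ^ (n + 2) - y" by (simp add: disc_def x_def y_def)
  have e1: "ap n W E t_one p = a + x * b" by (simp add: ap_t_one a_def b_def x_def)
  have e2: "ap n W E t_disc p = N * y * b" using ap_t_disc[OF assms(1)] by (simp only: N_def y_def b_def)
  have "entry (ap n W E t_one p \<cdot>\<^sub>m GM1 n x y + ap n W E t_disc p \<cdot>\<^sub>m GM2 n x y) k j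
     = (a + x * b) * entry (GM1 n x y) k j + (N * y * b) * entry (GM2 n x y) k j"
    using assms unfolding e1 e2
    by (subst entry_add[where N = "n + 1"]) (auto simp: entry_smult[where N = "n + 1"])
  also have "\<dots> = (if k = j - 1 then a else 0) - (if k = j then of_nat j * b else 0)
      - (if k = n + 1 then of_nat (Stirling (n + 2) j) * x ^ j * a / (x ^ (n + 2) - y) else 0)"
  proof (cases "k \<le> n")
    case True
    have g1: "entry (GM1 n x y) k j = (if k = j - 1 then 1 else 0)"
      using assms True unfolding GM1_def by (subst entry_mat1) auto
    have g2: "entry (GM2 n x y) k j = (if k = j then - of_nat k / (N * y) else if k = j - 1 then - x / (N * y) else 0)"
      using assms True unfolding GM2_def N_def by (subst entry_mat1) auto
    show ?thesis unfolding g1 g2 using True N y0 assms(4) by (auto simp: field_simps)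
  next
    case False
    then have k: "k = n + 1" using assms by simp
    have g1: "entry (GM1 n x y) k j = - of_nat (Stirling (n + 2) j) * x ^ j / (x ^ (n + 2) - y)"
      using assms k unfolding GM1_def by (subst entry_mat1) auto
    show ?thesis
    proof (cases "j \<le> n")
      case True
      have g2: "entry (GM2 n x y) k j = of_nat (Stirling (n + 2) j) * x ^ (j + 1) / (N * y * (x ^ (n + 2) - y))"
        using assms k True unfolding GM2_def N_def by (subst entry_mat1) auto
      show ?thesis unfolding g1 g2 using True k N y0 d0 by (simp add: divide_simps) (simp add: algebra_simps)
    next
      case False
      then have j: "j = n + 1" using assms by simp
      \<comment> \<open>In the corner the two terms with x^{n+2} combine to -(n+1) x^{n+2}, thanks
        to this value. With (n+1) y this gives -(n+1) times the discriminant, cancelling the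
        denominator.\<close>
      have "2 * Stirling (n + 2) (n + 1) = (n + 2) * (n + 1)" using Stirling_top[of "n + 1"] by simp
      then have "of_nat (2 * Stirling (n + 2) (n + 1)) = N * of_nat (n + 1)"
        by (simp only: N_def of_nat_mult)
      then have St: "of_nat (Stirling (n + 2) (n + 1)) = N * of_nat (n + 1) / (2 :: complex)"
        by (simp add: mult.commute del: of_nat_add Stirling.simps)
      have g2: "entry (GM2 n x y) k j = (of_nat (n * (n + 1)) / 2 * x ^ (n + 2) + of_nat (n + 1) * y) / (N * y * (x ^ (n + 2) - y))"
        using assms k j unfolding GM2_def N_def by (subst entry_mat1) auto
      define D where "D = x ^ (n + 2) - y"
      define M :: complex where "M = of_nat (n + 1)"
      have NM: "N = M + 1" by (simp add: N_def M_def)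
      have nM: "of_nat (n * (n + 1)) = (M - 1) * M" unfolding of_nat_mult by (simp add: M_def)
      have xx: "x * x ^ (n + 1) = D + y" by (simp add: D_def)
      have x2: "x ^ (n + 2) = D + y" by (simp add: D_def)
      define z where "z = x ^ (n + 1)"
      have xz: "x * z = D + y" using xx z_def by simp
      have "(a + x * b) * (- (N * M / 2) * z / D) + N * y * b * (((M - 1) * M / 2 * (D + y) + M * y) / (N * y * D))
          = - (M * b) - N * M / 2 * z * a / D"
      proof -
        have D0: "D \<noteq> 0" using d0 by (simp add: D_def)
        have "N * y * b * (((M - 1) * M / 2 * (D + y) + M * y) / (N * y * D)) = b * ((M - 1) * M / 2 * (D + y) + M * y) / D"
          using N y0 by (simp add: divide_simps)
        moreover have "(a + x * b) * (- (N * M / 2) * z / D) = - (N * M / 2 * z * a / D) - N * M / 2 * (x * z) * b / D"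
          using D0 by (simp add: divide_simps) (simp add: algebra_simps)
        ultimately show ?thesis unfolding xz NM using D0 by (simp add: divide_simps) (simp add: algebra_simps)
      qed
      then show ?thesis
        unfolding g1 g2 unfolding j St nM x2 z_def[symmetric] M_def[symmetric]
        using k by simp
    qed
  qed
  finally show ?thesis by (simp only: x_def y_def a_def b_def d)
qed

lemma ap_s_entry:
  assumes E: "has_GM_matrix n W E A" and A: "A p \<in> carrier_mat (n + 1) (n + 1)"
    and p: "p \<in> X" and ij: "1 \<le> i" "i \<le> n + 1" "1 \<le> j" "j \<le> n + 1"
  shows "ap n W E (s_entry i j) p = (\<Sum>k\<in>{1..n+1}. entry (A p) i k * s_entry k j p)
     - (if 2 \<le> j then acoef E p * s_entry i (j - 1) p else 0) + of_nat j * bcoef E p * s_entry i j p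
     + (if i = n + 1 then s_entry (n + 1) (n + 1) p * (of_nat (Stirling (n + 2) j) * t_one p ^ j * acoef E p / disc p) else 0)"
proof -
  obtain x y S where pe: "p = (x, y, S)" by (cases p)
  have S: "S \<in> carrier_mat (n + 1) (n + 1)" using p by (auto simp: pe moduli_def)
  define B where "B = ap n W E t_one p \<cdot>\<^sub>m GM1 n x y + ap n W E t_disc p \<cdot>\<^sub>m GM2 n x y"
  have B: "B \<in> carrier_mat (n + 1) (n + 1)" by (simp add: B_def)
  have "mat1 (n + 1) (\<lambda>i j. ap n W E (s_entry i j) p) = A p * S - S * B"
    using E p unfolding has_GM_matrix_def B_def pe ap_def by blast
  then have "entry (mat1 (n + 1) (\<lambda>i j. ap n W E (s_entry i j) p)) i j = entry (A p * S - S * B) i j" by simp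
  then have "ap n W E (s_entry i j) p = entry (A p * S - S * B) i j" using ij by simp
  also have "\<dots> = entry (A p * S) i j - entry (S * B) i j"
    using ij mult_carrier_mat[OF A S] mult_carrier_mat[OF S B] by (intro entry_minus) auto
  also have "entry (A p * S) i j = (\<Sum>k\<in>{1..n+1}. entry (A p) i k * s_entry k j p)"
    using entry_mult[OF A S] ij by (simp add: pe)
  also have "entry (S * B) i j = (\<Sum>k\<in>{1..n+1}. s_entry i k p * entry B k j)"
    using entry_mult[OF S B] ij by (simp add: pe)
  also have "\<dots> = (\<Sum>k\<in>{1..n+1}. (if k = j - 1 then s_entry i k p * acoef E p else 0)
      - (if k = j then s_entry i k p * (of_nat j * bcoef E p) else 0)
      - (if k = n + 1 then s_entry i k p * (of_nat (Stirling (n + 2) j) * t_one p ^ j * acoef E p / disc p) else 0))"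
  proof (intro sum.cong refl)
    fix k assume k: "k \<in> {1..n+1}"
    have "entry B k j = (if k = j - 1 then acoef E p else 0) - (if k = j then of_nat j * bcoef E p else 0)
      - (if k = n + 1 then of_nat (Stirling (n + 2) j) * t_one p ^ j * acoef E p / disc p else 0)"
      using GM_entry[OF p, of k j E] k ij unfolding B_def by (simp add: pe)
    then show "s_entry i k p * entry B k j = (if k = j - 1 then s_entry i k p * acoef E p else 0)
      - (if k = j then s_entry i k p * (of_nat j * bcoef E p) else 0)
      - (if k = n + 1 then s_entry i k p * (of_nat (Stirling (n + 2) j) * t_one p ^ j * acoef E p / disc p) else 0)"
      by (simp add: right_diff_distrib)
  qed
  also have "\<dots> = (if 2 \<le> j then s_entry i (j - 1) p * acoef E p else 0) - s_entry i j p * (of_nat j * bcoef E p)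
      - s_entry i (n + 1) p * (of_nat (Stirling (n + 2) j) * t_one p ^ j * acoef E p / disc p)"
    unfolding sum_subtractf using ij by (simp add: sum.delta) auto
  finally show ?thesis using ij p by (cases "i = n + 1"; cases "2 \<le> j") (simp_all add: s_upper algebra_simps)
qed

definition yv :: "(nat \<Rightarrow> fn) \<Rightarrow> nat \<Rightarrow> fn" where
  "yv Y i p = (if i = 1 then 1 else if i = n then - 1 else Y (i - 1) p)"

lemma Y_mat_sum:
  assumes "1 \<le> i" "i \<le> n + 1"
  shows "(\<Sum>k\<in>{1..n+1}. entry (Y_mat n Y p) i k * f k) = (if i \<le> n then yv Y i p * f (i + 1) else 0)"
proof -
  have "(\<Sum>k\<in>{1..n+1}. entry (Y_mat n Y p) i k * f k) = (\<Sum>k\<in>{1..n+1}. if k = i + 1 then yv Y i p * f k else 0)"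
    using assms by (intro sum.cong refl) (auto simp: Y_mat_def yv_def)
  then show ?thesis using assms by (simp del: sum.cl_ivl_Suc)
qed

lemma ap_s_upper:
  assumes "vector_field n W E" "p \<in> X"
  shows "1 \<le> i \<Longrightarrow> i < j \<Longrightarrow> j \<le> n + 1 \<Longrightarrow> ap n W E (s_entry i j) p = 0" "ap n W E (s_entry 1 1) p = 0"
proof -
  show "ap n W E (s_entry i j) p = 0" if "1 \<le> i" "i < j" "j \<le> n + 1"
    using ap_const[OF assms, of 0] ap_cong[of n W "s_entry i j" "\<lambda>p. 0" E] that by (simp add: s_upper)
  show "ap n W E (s_entry 1 1) p = 0"
    using ap_const[OF assms, of 1] ap_cong[of n W "s_entry 1 1" "\<lambda>p. 1" E] by (simp only: s_11)
qed

section \<open>The modular vector field in coordinates\<close>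

context
  fixes R Y
  assumes R: "vector_field n W R" and RY: "has_GM_matrix n W R (Y_mat n Y)"
begin

lemma ap_R_s:
  assumes p: "p \<in> X" and ij: "1 \<le> i" "i \<le> n + 1" "1 \<le> j" "j \<le> n + 1"
  shows "ap n W R (s_entry i j) p = (if i \<le> n then yv Y i p * s_entry (i + 1) j p else 0)
     - (if 2 \<le> j then acoef R p * s_entry i (j - 1) p else 0) + of_nat j * bcoef R p * s_entry i j p
     + (if i = n + 1 then s_entry (n + 1) (n + 1) p * (of_nat (Stirling (n + 2) j) * t_one p ^ j * acoef R p / disc p) else 0)"
  using ap_s_entry[OF RY _ p ij] Y_mat_sum[OF ij(1,2), of Y p "\<lambda>k. s_entry k j p"]
  by (simp only: Y_mat_def mat1_carrier)

text \<open>The entries of S at (1, 1) and above the diagonal are constant. Their derivatives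
  vanish, and the resulting equations at (1, 1), (1, 2) and (i, i + 1) give \<open>bcoef\<close>,
  \<open>acoef\<close> and the unknown functions Y_i of R in turn.\<close>

lemma bcoef_R: "p \<in> X \<Longrightarrow> bcoef R p = - s_entry 2 1 p"
  using ap_R_s[of p 1 1] ap_s_upper(2)[OF R, of p] s_11[of p] n1 by (simp add: yv_def numeral_2_eq_2 eq_neg_iff_add_eq_0 add.commute)

lemma acoef_R: "p \<in> X \<Longrightarrow> acoef R p = s_entry 2 2 p"
  using ap_R_s[of p 1 2] ap_s_upper(1)[OF R, of p 1 2] s_11[of p] s_upper[of p 1 2] n1 by (simp add: yv_def numeral_2_eq_2)

lemma yv_R:
  assumes p: "p \<in> X" and i: "1 \<le> i" "i \<le> n"
  shows "yv Y i p * s_entry (i + 1) (i + 1) p = s_entry 2 2 p * s_entry i i p"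
  using ap_R_s[OF p, of i "i + 1"] ap_s_upper(1)[OF R p, of i "i + 1"] s_upper[OF p, of i "i + 1"] i acoef_R[OF p]
  by simp

lemma ap_R_t_disc: "p \<in> X \<Longrightarrow> ap n W R t_disc p = - of_nat (n + 2) * s_entry 2 1 p * t_disc p"
  using ap_t_disc[of p R] bcoef_R[of p] by (simp add: algebra_simps)

lemma ap_R_t_one: "p \<in> X \<Longrightarrow> ap n W R t_one p = s_entry 2 2 p - s_entry 2 1 p * t_one p"
  using ap_t_one[of R p] acoef_R[of p] bcoef_R[of p] by simp

end

section \<open>Vector fields of diagonal Lie algebra elements, and the field H\<close>

lemma Lie_diag:
  assumes E: "is_Lie_vf n W g E" and g: "g \<in> carrier_mat (n + 1) (n + 1)"
    and d: "\<forall>i\<in>{1..n+1}. \<forall>k\<in>{1..n+1}. entry g i k = (if i = k then d i else 0)"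
    and p: "p \<in> X"
  shows "ap n W E t_disc p = - of_nat (n + 2) * d 1 * t_disc p" "ap n W E t_one p = - d 1 * t_one p"
    "\<And>i j. 1 \<le> i \<Longrightarrow> i \<le> n + 1 \<Longrightarrow> 1 \<le> j \<Longrightarrow> j \<le> n + 1 \<Longrightarrow>
      ap n W E (s_entry i j) p = (d i - of_nat j * d 1) * s_entry i j p"
proof -
  have vf: "vector_field n W E" and GM: "has_GM_matrix n W E (\<lambda>p. transpose_mat g)"
    using E by (auto simp: is_Lie_vf_def)
  have s: "(\<Sum>k\<in>{1..n+1}. entry (transpose_mat g) i k * s_entry k j p) = d i * s_entry i j p" if "1 \<le> i" "i \<le> n + 1" for i j
  proof -
    have "(\<Sum>k\<in>{1..n+1}. entry (transpose_mat g) i k * s_entry k j p) = (\<Sum>k\<in>{1..n+1}. if k = i then d i * s_entry k j p else 0)"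
      using that by (intro sum.cong refl) (auto simp: entry_transpose[OF g] bspec[OF bspec[OF d]])
    then show ?thesis using that by simp
  qed
  have tg: "transpose_mat g \<in> carrier_mat (n + 1) (n + 1)" using g by simp
  note e = ap_s_entry[OF GM tg p]
  \<comment> \<open>As for R, the constant entries s_{11} and s_{12} determine the action on t_{n+2}
    and t_1.\<close>
  have b: "bcoef E p = - d 1"
    using e[of 1 1] s[of 1 1] ap_s_upper(2)[OF vf p] s_11[OF p] n1 by (simp add: eq_neg_iff_add_eq_0 add.commute)
  have a: "acoef E p = 0"
    using e[of 1 2] s[of 1 2] ap_s_upper(1)[OF vf p, of 1 2] s_11[OF p] s_upper[OF p, of 1 2] n1 by simp
  show "ap n W E t_disc p = - of_nat (n + 2) * d 1 * t_disc p" using ap_t_disc[OF p, of E] b by (simp add: algebra_simps)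
  show "ap n W E t_one p = - d 1 * t_one p" using ap_t_one[of E p] a b by simp
  show "ap n W E (s_entry i j) p = (d i - of_nat j * d 1) * s_entry i j p"
    if "1 \<le> i" "i \<le> n + 1" "1 \<le> j" "j \<le> n + 1" for i j
    using e[OF that] unfolding s[OF that(1,2)] a b mult_zero_left mult_zero_right div_0 if_cancel
    by (simp add: algebra_simps)
qed

lemma g11_entry:
  "1 \<le> i \<Longrightarrow> i \<le> n + 1 \<Longrightarrow> 1 \<le> k \<Longrightarrow> k \<le> n + 1 \<Longrightarrow>
    entry (g11 n) i k = (if i = k then (if i = 1 then 1 else if i = n + 1 then - 1 else 0) else 0)"
  and g22_entry:
  "3 \<le> n \<Longrightarrow> 1 \<le> i \<Longrightarrow> i \<le> n + 1 \<Longrightarrow> 1 \<le> k \<Longrightarrow> k \<le> n + 1 \<Longrightarrow>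
    entry (g22 n) i k = (if i = k then (if i = 2 then 1 else if i = n then - 1 else 0) else 0)"
  using n1 unfolding g11_def g22_def mat_unit_def
  by (subst entry_minus[where N = "n + 1"]; auto)+

lemma g_carrier: "g11 n \<in> carrier_mat (n + 1) (n + 1)" "g22 n \<in> carrier_mat (n + 1) (n + 1)"
  unfolding g11_def g22_def mat_unit_def by (intro minus_carrier_mat mat1_carrier)+

lemma index_1: "1 \<in> index_set n" and index_N: "n + 2 \<in> index_set n"
  using top_index_ge[of n] n1 by (auto simp: index_set_def)

lemma chart_reg: "j \<in> index_set n \<Longrightarrow> reg n W (coord n j)"
  by (rule reg_gen) (force simp: gens_def wt_gens_def chart_def image_iff)

lemma reg_t_one: "reg n W t_one" and reg_t_disc: "reg n W t_disc"
  using chart_reg[OF index_1] chart_reg[OF index_N] by (simp_all add: coord_def)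

text \<open>H is the Euler field of the grading. Regularity of the entry is assumed in the last
  claim because \<open>is_H\<close> fixes H only on regular functions.\<close>

lemma H_vals:
  assumes "is_H n W H"
  shows "vector_field n W H" (is ?vf)
    "p \<in> X \<Longrightarrow> ap n W H t_one p = of_int (scale n) * t_one p"
    "p \<in> X \<Longrightarrow> ap n W H t_disc p = of_int (scale n * (int n + 2)) * t_disc p"
    "p \<in> X \<Longrightarrow> 1 \<le> i \<Longrightarrow> i \<le> n + 1 \<Longrightarrow> 1 \<le> j \<Longrightarrow> j \<le> n + 1 \<Longrightarrow> reg n W (s_entry i j) \<Longrightarrow>
      ap n W H (s_entry i j) p = of_int (scale n * (int j + hw n i)) * s_entry i j p"
proof -
  obtain R1 where R1: "is_Lie_vf n W (g11 n) R1" and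
    H: "if n = 1 then \<forall>f\<in>regular_fns n W. H f = (\<lambda>p. - R1 f p)
        else if n = 2 then \<forall>f\<in>regular_fns n W. H f = (\<lambda>p. - 2 * R1 f p)
        else \<exists>R2. is_Lie_vf n W (g22 n) R2 \<and> (\<forall>f\<in>regular_fns n W. H f = (\<lambda>p. R2 f p - R1 f p))"
    using assms unfolding is_H_def by blast
  define d1 :: "nat \<Rightarrow> complex" where "d1 i = (if i = 1 then 1 else if i = n + 1 then - 1 else 0)" for i
  have "entry (g11 n) i k = (if i = k then d1 i else 0)" if "i \<in> {1..n+1}" "k \<in> {1..n+1}" for i k
    unfolding d1_def using that by (intro g11_entry) auto
  then have "\<forall>i\<in>{1..n+1}. \<forall>k\<in>{1..n+1}. entry (g11 n) i k = (if i = k then d1 i else 0)" by blast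
  note L1 = Lie_diag[OF R1 g_carrier(1) this]
  have vf1: "vector_field n W R1" using R1 by (simp add: is_Lie_vf_def)
  have "?vf \<and> (\<forall>p\<in>X. ap n W H t_one p = of_int (scale n) * t_one p \<and>
      ap n W H t_disc p = of_int (scale n * (int n + 2)) * t_disc p \<and>
      (\<forall>i j. 1 \<le> i \<longrightarrow> i \<le> n + 1 \<longrightarrow> 1 \<le> j \<longrightarrow> j \<le> n + 1 \<longrightarrow> reg n W (s_entry i j) \<longrightarrow>
        ap n W H (s_entry i j) p = of_int (scale n * (int j + hw n i)) * s_entry i j p))"
  proof (cases "n \<le> 2")
    case True
    define a :: complex where "a = - of_int (scale n)"
    have H': "H f = (\<lambda>p. a * R1 f p)" if "f \<in> regular_fns n W" for f
      using H that True n1 by (cases "n = 1") (auto simp: a_def scale_def)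
    have apH: "ap n W H f p = a * ap n W R1 f p" if "reg n W f" for f p
      using H'[OF that[unfolded reg_def]] by (simp add: ap_def)
    have ?vf
      by (rule vector_field_lincomb[OF vf1 vf1 reg_const[of n W 0], where a = a]) (simp add: H')
    moreover have "ap n W H t_one p = of_int (scale n) * t_one p" if "p \<in> X" for p
      unfolding apH[OF reg_t_one] L1(2)[OF that] by (simp add: a_def d1_def)
    moreover have "ap n W H t_disc p = of_int (scale n * (int n + 2)) * t_disc p" if "p \<in> X" for p
      unfolding apH[OF reg_t_disc] L1(1)[OF that] by (simp add: a_def d1_def algebra_simps)
    moreover have "ap n W H (s_entry i j) p = of_int (scale n * (int j + hw n i)) * s_entry i j p"
      if "p \<in> X" and ij: "1 \<le> i" "i \<le> n + 1" "1 \<le> j" "j \<le> n + 1" and "reg n W (s_entry i j)" for i j p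
    proof -
      have "of_int (hw n i) = - d1 i" using True by (simp add: hw_def d1_def)
      moreover have "d1 1 = 1" by (simp add: d1_def)
      ultimately show ?thesis
        unfolding apH[OF that(6)] L1(3)[OF that(1) ij] by (simp add: a_def algebra_simps)
    qed
    ultimately show ?thesis by blast
  next
    case False
    then obtain R2 where R2: "is_Lie_vf n W (g22 n) R2"
      and H': "\<And>f. f \<in> regular_fns n W \<Longrightarrow> H f = (\<lambda>p. R2 f p - R1 f p)"
      using H by auto
    have n3: "3 \<le> n" using False by simp
    define d2 :: "nat \<Rightarrow> complex" where "d2 i = (if i = 2 then 1 else if i = n then - 1 else 0)" for i
    have "entry (g22 n) i k = (if i = k then d2 i else 0)" if "i \<in> {1..n+1}" "k \<in> {1..n+1}" for i k
      unfolding d2_def using that by (intro g22_entry n3) auto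
    then have "\<forall>i\<in>{1..n+1}. \<forall>k\<in>{1..n+1}. entry (g22 n) i k = (if i = k then d2 i else 0)" by blast
    note L2 = Lie_diag[OF R2 g_carrier(2) this]
    have vf2: "vector_field n W R2" using R2 by (simp add: is_Lie_vf_def)
    have apH: "ap n W H f p = ap n W R2 f p - ap n W R1 f p" if "reg n W f" for f p
      using H'[OF that[unfolded reg_def]] by (simp add: ap_def)
    have ?vf
      by (rule vector_field_lincomb[OF vf2 vf1 reg_const[of n W "-1"], where a = 1]) (simp add: H')
    moreover have "ap n W H t_one p = of_int (scale n) * t_one p" if "p \<in> X" for p
      unfolding apH[OF reg_t_one] L1(2)[OF that] L2(2)[OF that] using n3 by (simp add: scale_def d1_def d2_def)
    moreover have "ap n W H t_disc p = of_int (scale n * (int n + 2)) * t_disc p" if "p \<in> X" for p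
      unfolding apH[OF reg_t_disc] L1(1)[OF that] L2(1)[OF that] using n3
      by (simp add: scale_def d1_def d2_def algebra_simps)
    moreover have "ap n W H (s_entry i j) p = of_int (scale n * (int j + hw n i)) * s_entry i j p"
      if "p \<in> X" and ij: "1 \<le> i" "i \<le> n + 1" "1 \<le> j" "j \<le> n + 1" and "reg n W (s_entry i j)" for i j p
    proof -
      have "of_int (hw n i) = d2 i - d1 i" using n3 by (simp add: hw_def d1_def d2_def)
      moreover have "d1 1 = 1" "d2 1 = 0" using n3 by (simp_all add: d1_def d2_def)
      moreover have "scale n = 1" using n3 by (simp add: scale_def)
      ultimately show ?thesis
        unfolding apH[OF that(6)] L1(3)[OF that(1) ij] L2(3)[OF that(1) ij] of_int_mult of_int_add
          \<open>of_int (hw n i) = d2 i - d1 i\<close> by (simp add: algebra_simps)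
    qed
    ultimately show ?thesis by blast
  qed
  then show ?vf "p \<in> X \<Longrightarrow> ap n W H t_one p = of_int (scale n) * t_one p"
    "p \<in> X \<Longrightarrow> ap n W H t_disc p = of_int (scale n * (int n + 2)) * t_disc p"
    "p \<in> X \<Longrightarrow> 1 \<le> i \<Longrightarrow> i \<le> n + 1 \<Longrightarrow> 1 \<le> j \<Longrightarrow> j \<le> n + 1 \<Longrightarrow> reg n W (s_entry i j) \<Longrightarrow>
      ap n W H (s_entry i j) p = of_int (scale n * (int j + hw n i)) * s_entry i j p"
    by blast+
qed

end

section \<open>The scaling action\<close>

context dwork
begin

lemma wf_scaling:
  assumes "good_param n x y" "z \<noteq> 0" "1 \<le> i" "i \<le> n + 1" "1 \<le> j" "j \<le> n + 1"
  shows "good_param n (z * x) (z ^ (n + 2) * y)"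
    "w i j (z * x) (z ^ (n + 2) * y) = z powi (- int (i + j)) * w i j x y"
proof -
  have "(z * x) ^ (n + 2) - z ^ (n + 2) * y = z ^ (n + 2) * (x ^ (n + 2) - y)"
    unfolding power_mult_distrib by (simp only: right_diff_distrib)
  then show g: "good_param n (z * x) (z ^ (n + 2) * y)"
    using assms(1,2) unfolding good_param_def by (simp only: mult_eq_0_iff power_eq_0_iff simp_thms)
  obtain F where F: "xform n (- int (i + j)) F" "\<And>x y. good_param n x y \<Longrightarrow> w i j x y = F x y"
    using w_xform[OF assms(3-6)] by blast
  show "w i j (z * x) (z ^ (n + 2) * y) = z powi (- int (i + j)) * w i j x y"
    using xform_scaling[OF F(1) assms(2)] F(2)[OF assms(1)] F(2)[OF g] by simp
qed

text \<open>On S this is z^h S z^K with h = diag(hw) and K = diag(1, ..., n+1). Under (t_1, t_{n+2})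
  -> (z t_1, z^{n+2} t_{n+2}) Omega becomes z^{-K} Omega z^{-K}, and z^h preserves
  \<open>Phi\<close>, so the moduli space is mapped to itself.\<close>

definition torus1 :: "complex \<Rightarrow> pt \<Rightarrow> pt" where
  "torus1 z p = (case p of (x, y, S) \<Rightarrow>
     (z * x, z ^ (n + 2) * y, mat1 (n + 1) (\<lambda>i j. z powi (hw n i + int j) * entry S i j)))"

lemma torus1_X:
  assumes z: "z \<noteq> 0" and p: "p \<in> X"
  shows "torus1 z p \<in> X"
proof -
  obtain x y S where pe: "p = (x, y, S)" by (cases p)
  define N where "N = n + 1"
  define S' where "S' = mat1 N (\<lambda>i j. z powi (hw n i + int j) * entry S i j)"
  have S: "S \<in> carrier_mat N N" "S * W x y * transpose_mat S = Phi n" "invertible_mat S" "good_param n x y"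
    "entry S 1 1 = 1" "\<And>i j. 1 \<le> i \<Longrightarrow> i < j \<Longrightarrow> j \<le> N \<Longrightarrow> entry S i j = 0"
    using p by (auto simp: pe moduli_def N_def)
  have S'c: "S' \<in> carrier_mat N N" by (simp add: S'_def)
  have good: "good_param n (z * x) (z ^ (n + 2) * y)" using wf_scaling(1)[OF S(4) z] n1 by simp
  obtain T where T: "inverts_mat S T" "inverts_mat T S" using S(3) by (auto simp: invertible_mat_def)
  have dimT: "T \<in> carrier_mat N N"
  proof
    have "dim_col (S * T) = N" "dim_col (T * S) = dim_row T"
      using T S(1) by (auto simp: inverts_mat_def)
    then show "dim_col T = N" "dim_row T = N" using S(1) by auto
  qed
  have ST: "S * T = 1\<^sub>m N" "T * S = 1\<^sub>m N" using T S(1) dimT by (auto simp: inverts_mat_def)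
  \<comment> \<open>z^{-K} T z^{-h}, the inverse of z^h S z^K.\<close>
  define T' where "T' = mat1 N (\<lambda>i j. z powi (- int i - hw n j) * entry T i j)"
  have T'c: "T' \<in> carrier_mat N N" by (simp add: T'_def)
  have one: "entry (1\<^sub>m N) i j = (if i = j then 1 else 0 :: complex)" if "1 \<le> i" "i \<le> N" "1 \<le> j" "j \<le> N" for i j
    using that by (auto simp: entry_def)
  have onec: "1\<^sub>m N \<in> carrier_mat N N" by simp
  have "S' * T' = 1\<^sub>m N"
  proof (rule entry_eqI[OF mult_carrier_mat[OF S'c T'c] onec])
    fix i j assume ij: "1 \<le> i" "i \<le> N" "1 \<le> j" "j \<le> N"
    have "entry (S' * T') i j = (\<Sum>k\<in>{1..N}. entry S' i k * entry T' k j)"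
      using ij by (rule entry_mult[OF S'c T'c])
    also have "\<dots> = (\<Sum>k\<in>{1..N}. z powi (hw n i - hw n j) * (entry S i k * entry T k j))"
    proof (intro sum.cong refl)
      fix k assume k: "k \<in> {1..N}"
      have "z powi (hw n i + int k) * z powi (- int k - hw n j) = z powi (hw n i - hw n j)"
        using z by (simp add: power_int_add[symmetric])
      then show "entry S' i k * entry T' k j = z powi (hw n i - hw n j) * (entry S i k * entry T k j)"
        using ij k by (simp add: S'_def T'_def)
    qed
    also have "\<dots> = z powi (hw n i - hw n j) * entry (S * T) i j"
      using entry_mult[OF S(1) dimT ij] by (simp add: sum_distrib_left)
    also have "\<dots> = entry (1\<^sub>m N) i j" unfolding ST one[OF ij] by simp
    finally show "entry (S' * T') i j = entry (1\<^sub>m N) i j" .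
  qed
  moreover have "T' * S' = 1\<^sub>m N"
  proof (rule entry_eqI[OF mult_carrier_mat[OF T'c S'c] onec])
    fix i j assume ij: "1 \<le> i" "i \<le> N" "1 \<le> j" "j \<le> N"
    have "entry (T' * S') i j = (\<Sum>k\<in>{1..N}. entry T' i k * entry S' k j)"
      using ij by (rule entry_mult[OF T'c S'c])
    also have "\<dots> = (\<Sum>k\<in>{1..N}. z powi (int j - int i) * (entry T i k * entry S k j))"
    proof (intro sum.cong refl)
      fix k assume k: "k \<in> {1..N}"
      have "z powi (- int i - hw n k) * z powi (hw n k + int j) = z powi (int j - int i)"
        using z by (simp add: power_int_add[symmetric])
      then show "entry T' i k * entry S' k j = z powi (int j - int i) * (entry T i k * entry S k j)"
        using ij k by (simp add: S'_def T'_def)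
    qed
    also have "\<dots> = z powi (int j - int i) * entry (T * S) i j"
      using entry_mult[OF dimT S(1) ij] by (simp add: sum_distrib_left)
    also have "\<dots> = entry (1\<^sub>m N) i j" unfolding ST one[OF ij] by simp
    finally show "entry (T' * S') i j = entry (1\<^sub>m N) i j" .
  qed
  ultimately have "inverts_mat S' T'" "inverts_mat T' S'"
    using S'c T'c by (auto simp: inverts_mat_def)
  then have inv: "invertible_mat S'" using S'c by (auto simp: invertible_mat_def)
  have Wc: "W (z * x) (z ^ (n + 2) * y) \<in> carrier_mat N N" using W_carrier[OF good] by (simp add: N_def)
  have rel: "S' * W (z * x) (z ^ (n + 2) * y) * transpose_mat S' = Phi n"
  proof (rule entry_eqI[where N = N])
    have tS: "transpose_mat S' \<in> carrier_mat N N" using S'c by simp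
    show "S' * W (z * x) (z ^ (n + 2) * y) * transpose_mat S' \<in> carrier_mat N N"
      by (rule mult_carrier_mat[OF mult_carrier_mat[OF S'c Wc] tS])
    show "Phi n \<in> carrier_mat N N" using Phi_carrier by (simp add: N_def)
    fix a b assume ab: "1 \<le> a" "a \<le> N" "1 \<le> b" "b \<le> N"
    have "entry (S' * W (z * x) (z ^ (n + 2) * y) * transpose_mat S') a b
      = (\<Sum>k\<in>{1..N}. \<Sum>l\<in>{1..N}. entry S' a k * w k l (z * x) (z ^ (n + 2) * y) * entry S' b l)"
      unfolding w_def using ab by (rule entry_congruence[OF S'c Wc])
    also have "\<dots> = (\<Sum>k\<in>{1..N}. \<Sum>l\<in>{1..N}. z powi (hw n a + hw n b) * (s_entry a k p * wf k l p * s_entry b l p))"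
    proof (intro sum.cong refl)
      fix k l assume kl: "k \<in> {1..N}" "l \<in> {1..N}"
      have "w k l (z * x) (z ^ (n + 2) * y) = z powi (- int (k + l)) * w k l x y"
        using kl by (intro wf_scaling(2)[OF S(4) z]) (auto simp: N_def)
      moreover have "z powi (hw n a + int k) * z powi (- int (k + l)) * z powi (hw n b + int l) = z powi (hw n a + hw n b)"
        using z by (simp add: power_int_add[symmetric])
      ultimately show "entry S' a k * w k l (z * x) (z ^ (n + 2) * y) * entry S' b l
          = z powi (hw n a + hw n b) * (s_entry a k p * wf k l p * s_entry b l p)"
        using ab kl by (simp add: S'_def pe wf_def mult.assoc mult.left_commute)
    qed
    also have "\<dots> = z powi (hw n a + hw n b) * (if a + b = n + 2 then phi_sign n a else 0)"
      using s_rel[OF p, of a b] ab by (simp only: sum_distrib_left[symmetric] N_def)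
    also have "\<dots> = entry (Phi n) a b"
      using ab hw_dual[OF n1 ab(1), of b] by (auto simp: entry_Phi N_def)
    finally show "entry (S' * W (z * x) (z ^ (n + 2) * y) * transpose_mat S') a b = entry (Phi n) a b" .
  qed
  \<comment> \<open>The normalisation s_{11} = 1 survives because \<open>hw n 1\<close> = -1 makes
    the exponent at (1, 1) zero.\<close>
  have "(z * x, z ^ (n + 2) * y, S') \<in> X"
    using S'c inv rel good S(5,6) unfolding moduli_def
    by (auto simp: S'_def N_def hw_def)
  then show ?thesis by (simp add: torus1_def pe S'_def N_def)
qed

definition torus :: "complex \<Rightarrow> pt \<Rightarrow> pt" where
  "torus z = torus1 (z powi scale n)"

lemma torus_X: "z \<noteq> 0 \<Longrightarrow> p \<in> X \<Longrightarrow> torus z p \<in> X"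
  unfolding torus_def by (rule torus1_X) simp_all

lemma powi_scale: "z \<noteq> 0 \<Longrightarrow> (z powi scale n) powi r = z powi (scale n * r)" for z :: complex
  by (simp add: power_int_mult)

lemma torus_t_one: "z \<noteq> 0 \<Longrightarrow> t_one (torus z p) = z powi scale n * t_one p"
  by (cases p) (simp add: torus_def torus1_def)

lemma torus_t_disc: "z \<noteq> 0 \<Longrightarrow> t_disc (torus z p) = z powi (scale n * (int n + 2)) * t_disc p"
proof -
  assume z: "z \<noteq> 0"
  have "(z powi scale n) ^ (n + 2) = z powi (scale n * (int n + 2))"
    using powi_scale[OF z, of "int (n + 2)"] unfolding power_int_of_nat by (simp add: add.commute)
  then show ?thesis by (cases p) (simp add: torus_def torus1_def del: power_Suc add_2_eq_Suc')
qed

lemma torus_s: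
  "z \<noteq> 0 \<Longrightarrow> 1 \<le> i \<Longrightarrow> i \<le> n + 1 \<Longrightarrow> 1 \<le> j \<Longrightarrow> j \<le> n + 1 \<Longrightarrow>
    s_entry i j (torus z p) = z powi (scale n * (int j + hw n i)) * s_entry i j p"
  by (cases p) (simp add: torus_def torus1_def powi_scale[symmetric] add.commute)

end

section \<open>Generators of the algebra of modular forms\<close>

text \<open>Positions whose entry is a modular generator in both options. It leaves out t_2 and the
  last row, whose only coordinate, for odd n, is the corner entry, treated differently by the two
  options when n >= 3.\<close>

definition free_pos :: "nat \<Rightarrow> nat \<Rightarrow> nat \<Rightarrow> bool" where
  "free_pos n i k \<longleftrightarrow> 2 \<le> i \<and> i \<le> n \<and> 1 \<le> k \<and> k \<le> i \<and> (i, k) \<noteq> (2, 1) \<and>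
     (if odd n then i + k \<le> n + 2 else i + k < n + 2)"

lemma wt_gens_chart: "j \<in> J \<Longrightarrow> (chart v n j, weight n j) \<in> wt_gens v n J"
  unfolding wt_gens_def by blast

lemma pos_weight_hw: "3 \<le> n \<Longrightarrow> 2 \<le> i \<Longrightarrow> i \<le> n + 1 \<Longrightarrow> pos_weight n i k = int k + hw n i"
  by (auto simp: pos_weight_def hw_def)

context dwork
begin

abbreviation t2 :: fn where "t2 \<equiv> s_entry 2 1"

abbreviation modular_gens :: "version \<Rightarrow> (fn \<times> int) set" where
  "modular_gens v \<equiv> wt_gens v n (index_set n - {2})"

lemma coord_2: "coord n 2 = t2"
  using n1 position_2[OF n1] by (auto simp: coord_def)

lemma two_in_index: "2 \<in> index_set n"
  using top_index_ge[of n] n1 by (auto simp: index_set_def)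

lemma reg_t2: "reg n W t2"
  using chart_reg[OF two_in_index] coord_2 by simp

lemma chart_2: "chart v n 2 = t2"
  using coord_2 position_top(8)[of n] by (auto simp: chart_def)

lemma weight_2: "weight n 2 = scale n * (1 + hw n 2)" "weight n 2 = 2"
  using n1 position_2[OF n1] by (auto simp: weight_def scale_def hw_def pos_weight_def)

lemma u_reg: "even n \<Longrightarrow> reg n W (u_fn n)" and inv_reg: "reg n W (inv_fn n)"
  by (rule reg_gen, force simp: gens_def wt_gens_def)+

lemma chart_1: "chart v n 1 = t_one" "weight n 1 = scale n"
  using n1 position_top(7)[of n] by (auto simp: chart_def coord_def weight_def scale_def)

lemma chart_N: "chart v n (n + 2) = t_disc" "weight n (n + 2) = scale n * (int n + 2)"
  using n1 position_top(5)[of n] by (auto simp: chart_def coord_def weight_def scale_def)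

lemma gens_t_one: "(t_one, scale n) \<in> modular_gens v"
proof -
  have "1 \<in> index_set n - {2}" using index_1 by simp
  from wt_gens_chart[OF this, of v n] show ?thesis unfolding chart_1 .
qed

lemma gens_t_disc: "(t_disc, scale n * (int n + 2)) \<in> modular_gens v"
proof -
  have "n + 2 \<in> index_set n - {2}" using index_N n1 by simp
  from wt_gens_chart[OF this, of v n] show ?thesis unfolding chart_N .
qed

lemma gens_u: "even n \<Longrightarrow> (u_fn n, u_weight n) \<in> modular_gens v"
  and gens_inv: "(inv_fn n, inv_weight n) \<in> modular_gens v"
  unfolding wt_gens_def by auto

lemma gens_s:
  assumes n3: "3 \<le> n" and f: "free_pos n i k"
  shows "(s_entry i k, int k + hw n i) \<in> modular_gens v"
proof -
  have m: "(i, k) \<in> set (positions n)" using f by (auto simp: mem_positions free_pos_def)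
  have n2: "n \<noteq> 2" using n3 by simp
  obtain j where j: "j \<in> index_set n" "j \<noteq> 1" "j \<noteq> n + 2" "position n j = (i, k)"
    by (rule ex_position[OF n1 n2 m])
  have "j \<noteq> 2" using j(4) position_2[OF n1] f by (auto simp: free_pos_def)
  moreover have "chart v n j = s_entry i k"
  proof -
    have "j \<noteq> top_index n" if "odd n"
      using j(4) position_top(1)[OF that n3] f by (auto simp: free_pos_def)
    then show ?thesis using j by (auto simp: chart_def coord_def)
  qed
  moreover have "weight n j = int k + hw n i"
    using j n3 pos_weight_hw[OF n3, of i k] f by (simp add: weight_def free_pos_def)
  ultimately show ?thesis using wt_gens_chart[of j "index_set n - {2}" v n] j(1) by simp
qed

text \<open>In Option 1 this generator is the corner entry \<open>q (n + 1) 1\<close>, in Option 2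
  it is s_{n+1,1}. Both have weight 2, since s_{n,1} has weight 0.\<close>

lemma gens_last:
  assumes n3: "3 \<le> n" and n: "odd n"
  shows "(\<lambda>p. s_entry (n + 1) 1 p + (if v = Option1 then t2 p * s_entry n 1 p else 0), 2) \<in> modular_gens v"
proof -
  let ?d = "top_index n"
  note T = position_top[OF n n3]
  have c: "coord n ?d = s_entry (n + 1) 1" using T(1,5,7) by (simp add: coord_def)
  have c': "coord n (if n = 3 then 4 else ?d - 2) = s_entry n 1"
    unfolding coord_def T(2) using T(3,4) by simp
  have "chart v n ?d = (\<lambda>p. s_entry (n + 1) 1 p + (if v = Option1 then t2 p * s_entry n 1 p else 0))"
    unfolding chart_def using c c' coord_2 n n3 by (cases v) auto
  moreover have "weight n ?d = 2" using T(1,5,7) n3 by (simp add: weight_def pos_weight_def)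
  moreover have "?d \<in> index_set n - {2}" using T(6,8) by simp
  ultimately show ?thesis using wt_gens_chart[of ?d "index_set n - {2}" v n] by simp
qed

lemma gens_cases:
  assumes n3: "3 \<le> n" and g: "(g, r) \<in> modular_gens v"
  obtains "g = t_one" "r = 1" | "g = t_disc" "r = int n + 2"
    | i k where "free_pos n i k" "g = s_entry i k" "r = int k + hw n i"
    | "odd n" "g = (\<lambda>p. s_entry (n + 1) 1 p + (if v = Option1 then t2 p * s_entry n 1 p else 0))" "r = 2"
    | "even n" "g = u_fn n" "r = u_weight n"
    | "g = inv_fn n" "r = inv_weight n"
proof -
  consider j where "j \<in> index_set n" "j \<noteq> 2" "g = chart v n j" "r = weight n j"
    | "even n" "g = u_fn n" "r = u_weight n" | "g = inv_fn n" "r = inv_weight n"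
    using g unfolding wt_gens_def by (auto split: if_splits)
  then show ?thesis
  proof cases
    case (1 j)
    consider "j = 1" | "j = n + 2" | "odd n" "j = top_index n"
      | "j \<noteq> 1" "j \<noteq> n + 2" "odd n \<longrightarrow> j \<noteq> top_index n" by blast
    then show ?thesis
    proof cases
      assume "j = 1"
      then show ?thesis using 1 n3 chart_1(1)[of v] chart_1(2) that(1) by (simp add: scale_def)
    next
      assume "j = n + 2"
      then show ?thesis using 1 n3 chart_N(1)[of v] chart_N(2) that(2) by (simp add: scale_def)
    next
      assume o: "odd n" "j = top_index n"
      note T = position_top[OF o(1) n3]
      have c: "coord n j = s_entry (n + 1) 1" using T(1,5,7) o(2) by (simp add: coord_def)
      have c': "coord n (if n = 3 then 4 else j - 2) = s_entry n 1"
        unfolding coord_def o(2) T(2) using T(3,4) by simp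
      have "chart v n j = (\<lambda>p. s_entry (n + 1) 1 p + (if v = Option1 then t2 p * s_entry n 1 p else 0))"
        unfolding chart_def using c c' coord_2 o n3 by (cases v) auto
      moreover have "weight n j = 2" using T(1,5,7) n3 o(2) by (simp add: weight_def pos_weight_def)
      ultimately show ?thesis using that(4) 1 o(1) by simp
    next
      assume j: "j \<noteq> 1" "j \<noteq> n + 2" "odd n \<longrightarrow> j \<noteq> top_index n"
      obtain i k where ik: "position n j = (i, k)" by (cases "position n j")
      have n2: "n \<noteq> 2" using n3 by simp
      have p: "(i, k) \<in> set (positions n)" "(i, k) \<noteq> (2, 1)"
        using position_in_set[OF n1 n2 1(1) j(1,2)] 1(2) ik by auto
      \<comment> \<open>The only coordinate in the last row is the corner entry, whose name d is
        excluded in this case.\<close>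
      have i: "i \<noteq> n + 1"
      proof
        assume i: "i = n + 1"
        then have o: "odd n" "k = 1" using p by (auto simp: mem_positions split: if_splits)
        have "position n j = position n (top_index n)" using position_top(1)[OF o(1) n3] ik i o(2) by simp
        moreover have inj: "j' = j''" if "j' \<in> index_set n" "j' \<noteq> 1" "j' \<noteq> n + 2" "j'' \<in> index_set n" "j'' \<noteq> 1" "j'' \<noteq> n + 2"
          "position n j' = position n j''" for j' j''
          by (rule position_inj[OF n1 n2 that])
        ultimately have "j = top_index n" using 1(1) j(1,2) position_top(5,6,7)[OF o(1) n3] by blast
        then show False using j(3) o(1) by simp
      qed
      have f: "free_pos n i k"
        using p i unfolding mem_positions free_pos_def by (auto split: if_splits)
      have "chart v n j = s_entry i k" using j ik by (auto simp: chart_def coord_def)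
      moreover have "weight n j = int k + hw n i"
        using j n3 ik pos_weight_hw[OF n3, of i k] f by (simp add: weight_def free_pos_def)
      ultimately show ?thesis using that(3)[OF f] 1 by simp
    qed
  qed (use that in auto)
qed

lemma gens_cases_small:
  assumes n2: "n \<le> 2" and g: "(g, r) \<in> modular_gens v"
  obtains "g = t_one" "r = scale n" | "g = t_disc" "r = scale n * (int n + 2)"
    | "n = 2" "g = u_fn n" "r = 4" | "g = inv_fn n" "r = inv_weight n"
proof -
  have I: "index_set n - {2} = {1, n + 2}"
    using n1 n2 by (cases "n = 1") (auto simp: index_set_def top_index_def)
  show ?thesis
  proof (cases "n = 1")
    case True
    then show ?thesis
      using g that chart_1(1)[of v] chart_1(2) chart_N(1)[of v] chart_N(2) unfolding wt_gens_def I by auto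
  next
    case False
    then have n: "n = 2" using n1 n2 by linarith
    then have "u_weight n = 4" by (simp add: u_weight_def)
    then show ?thesis
      using n g that chart_1(1)[of v] chart_1(2) chart_N(1)[of v] chart_N(2) unfolding wt_gens_def I by auto
  qed
qed

lemma gens_reg: "(g, r) \<in> modular_gens v \<Longrightarrow> reg n W g"
proof (cases "3 \<le> n")
  case True
  assume g: "(g, r) \<in> modular_gens v"
  have s: "reg n W (s_entry i k)" if "free_pos n i k" for i k
  proof -
    have "s_entry i k \<in> fst ` modular_gens Option2" using gens_s[OF True that] by force
    then have "s_entry i k \<in> gens Option2 n (index_set n)" unfolding gens_def wt_gens_def by blast
    then show ?thesis by (rule reg_gen)
  qed
  have l: "reg n W (s_entry (n + 1) 1)" "reg n W (s_entry n 1)" if o: "odd n"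
  proof -
    show "reg n W (s_entry n 1)" using True by (intro s) (auto simp: free_pos_def)
    have "s_entry (n + 1) 1 \<in> fst ` modular_gens Option2" using gens_last[OF True o, of Option2] by force
    then have "s_entry (n + 1) 1 \<in> gens Option2 n (index_set n)" unfolding gens_def wt_gens_def by blast
    then show "reg n W (s_entry (n + 1) 1)" by (rule reg_gen)
  qed
  have l': "reg n W (\<lambda>p. s_entry (n + 1) 1 p + (if v = Option1 then t2 p * s_entry n 1 p else 0))" if "odd n"
  proof (intro reg_add l(1)[OF that])
    show "reg n W (\<lambda>p. if v = Option1 then t2 p * s_entry n 1 p else 0)"
      using reg_mult[OF reg_t2 l(2)[OF that]] reg_const[of n W 0] by (cases "v = Option1") simp_all
  qed
  show ?thesis
    by (rule gens_cases[OF True g]) (use reg_t_one reg_t_disc s l' u_reg inv_reg in auto)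
next
  case False
  assume g: "(g, r) \<in> modular_gens v"
  show ?thesis
    by (rule gens_cases_small[OF _ g]) (use False reg_t_one reg_t_disc u_reg inv_reg in auto)
qed

lemma all_gens: "wt_gens v n (index_set n) = insert (t2, 2) (modular_gens v)"
  using two_in_index chart_2[of v] weight_2 unfolding wt_gens_def by auto

end

section \<open>Entries of the period matrix up to the quasi-modular coordinate\<close>

lemma minus_half_eq:
  fixes x s :: complex
  assumes "0 = x + s + x"
  shows "- (1 / 2) * s = x"
proof -
  have "s = - (2 * x)" using assms by (simp add: eq_neg_iff_add_eq_0 algebra_simps)
  then show ?thesis by simp
qed

context dwork
begin

text \<open>The bilinear form with Gram matrix Omega. The rows of S, as vectors, have Gram matrix
  \<open>Phi\<close>.\<close>

definition pairing :: "(nat \<Rightarrow> complex) \<Rightarrow> (nat \<Rightarrow> complex) \<Rightarrow> fn" where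
  "pairing f g p = (\<Sum>k\<in>{1..n+1}. \<Sum>l\<in>{1..n+1}. f k * wf k l p * g l)"

lemma pairing_add_left: "pairing (\<lambda>k. f k + a * h k) g p = pairing f g p + a * pairing h g p"
  unfolding pairing_def by (simp add: algebra_simps sum.distrib sum_distrib_left del: sum.cl_ivl_Suc)

lemma pairing_add_right: "pairing f (\<lambda>k. g k + a * h k) p = pairing f g p + a * pairing f h p"
  unfolding pairing_def by (simp add: algebra_simps sum.distrib sum_distrib_left del: sum.cl_ivl_Suc)

lemma pairing_s:
  "p \<in> X \<Longrightarrow> 1 \<le> a \<Longrightarrow> a \<le> n + 1 \<Longrightarrow> 1 \<le> b \<Longrightarrow> b \<le> n + 1 \<Longrightarrow>
    pairing (\<lambda>k. s_entry a k p) (\<lambda>k. s_entry b k p) p = (if a + b = n + 2 then phi_sign n a else 0)"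
  unfolding pairing_def by (rule s_rel)

text \<open>The matrix \<open>q = exp(-t\<^sub>2 e) S\<close> for \<open>n \<ge> 3\<close>, where \<open>e = E\<^sub>2\<^sub>1 - E\<^bsub>n+1,n\<^esub>\<close> lies in the Lie algebra of
  matrices preserving \<open>\<Phi>\<close>. It has the same relations as \<open>S\<close>, and \<open>q\<^sub>2\<^sub>1 = 0\<close>.\<close>

definition q :: "nat \<Rightarrow> nat \<Rightarrow> fn" where
  "q a k p = (if a = 2 then s_entry 2 k p - t2 p * s_entry 1 k p
     else if a = n + 1 then s_entry (n + 1) k p + t2 p * s_entry n k p else s_entry a k p)"

context
  assumes n3: "3 \<le> n"
begin

lemma q_diag: "p \<in> X \<Longrightarrow> 1 \<le> a \<Longrightarrow> a \<le> n + 1 \<Longrightarrow> q a a p = s_entry a a p"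
  using n3 by (auto simp: q_def s_upper)

lemma q_upper: "p \<in> X \<Longrightarrow> 1 \<le> a \<Longrightarrow> a < k \<Longrightarrow> k \<le> n + 1 \<Longrightarrow> q a k p = 0"
  using n3 by (auto simp: q_def s_upper)

lemma q_21: "p \<in> X \<Longrightarrow> q 2 1 p = 0"
  using s_11[of p] by (simp add: q_def)

lemma phi_sign_low: "i \<le> 2 \<Longrightarrow> phi_sign n i = 1"
  using n3 by (auto simp: phi_sign_def half_dim_def elim!: oddE)

lemma phi_sign_high: "n \<le> i \<Longrightarrow> phi_sign n i = (if odd n then - 1 else 1)"
  using n3 by (auto simp: phi_sign_def half_dim_def elim!: oddE)

text \<open>The added multiples of rows 1 and n change a pairing only between rows 2 and n + 1, by
  t_2 (<s_2, s_n> - <s_1, s_{n+1}>) and its transpose. This is zero because \<open>phi_sign\<close>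
  agrees on rows 1 and 2, and on rows n and n + 1.\<close>

lemma pairing_q:
  assumes p: "p \<in> X" and a: "1 \<le> a" "a \<le> n + 1" and b: "1 \<le> b" "b \<le> n + 1"
  shows "pairing (\<lambda>k. q a k p) (\<lambda>k. q b k p) p = (if a + b = n + 2 then phi_sign n a else 0)"
proof -
  define \<alpha> where "\<alpha> a = (if a = 2 then - t2 p else if a = n + 1 then t2 p else 0)" for a
  define a' where "a' a = (if a = 1 then 1 else a - 1)" for a :: nat
  have q: "q a k p = s_entry a k p + \<alpha> a * s_entry (a' a) k p" if "1 \<le> a" for a k
    using that n3 by (auto simp: q_def \<alpha>_def a'_def)
  have a'_range: "1 \<le> a' a" "a' a \<le> n + 1" if "1 \<le> a" "a \<le> n + 1" for a
    using that by (auto simp: a'_def)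
  have "pairing (\<lambda>k. q a k p) (\<lambda>k. q b k p) p
     = pairing (\<lambda>k. s_entry a k p) (\<lambda>k. s_entry b k p) p
     + \<alpha> b * pairing (\<lambda>k. s_entry a k p) (\<lambda>k. s_entry (a' b) k p) p
     + \<alpha> a * (pairing (\<lambda>k. s_entry (a' a) k p) (\<lambda>k. s_entry b k p) p
       + \<alpha> b * pairing (\<lambda>k. s_entry (a' a) k p) (\<lambda>k. s_entry (a' b) k p) p)"
    unfolding q[OF a(1)] q[OF b(1)] pairing_add_left pairing_add_right by simp
  also have "\<dots> = (if a + b = n + 2 then phi_sign n a else 0)"
  proof -
    define \<phi> where "\<phi> i j = (if i + j = n + 2 then phi_sign n i else 0)" for i j
    have "\<phi> a b + \<alpha> b * \<phi> a (a' b) + \<alpha> a * (\<phi> (a' a) b + \<alpha> b * \<phi> (a' a) (a' b)) = \<phi> a b"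
    proof (cases "\<alpha> a = 0")
      case True
      show ?thesis
      proof (cases "\<alpha> b = 0")
        case False
        then have "b = 2 \<or> b = n + 1" by (auto simp: \<alpha>_def split: if_splits)
        moreover have "a \<noteq> 2" "a \<noteq> n + 1" using True False by (auto simp: \<alpha>_def split: if_splits)
        ultimately have "\<phi> a (a' b) = 0" using n3 a by (auto simp: \<phi>_def a'_def)
        then show ?thesis using True by simp
      qed (simp add: True)
    next
      case False
      then have t: "t2 p \<noteq> 0" and aa: "a = 2 \<or> a = n + 1" by (auto simp: \<alpha>_def split: if_splits)
      have nn: "\<not> n + 1 = 2" using n3 by simp
      consider "b = 2" | "b = n + 1" | "b \<noteq> 2" "b \<noteq> n + 1" by blast
      then show ?thesis
      proof cases
        case 3
        then have "\<alpha> b = 0" by (simp add: \<alpha>_def)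
        moreover have "\<phi> (a' a) b = 0" using aa 3 n3 b by (auto simp: \<phi>_def a'_def)
        ultimately show ?thesis by simp
      qed (use aa n3 phi_sign_low phi_sign_high in \<open>auto simp: \<phi>_def \<alpha>_def a'_def\<close>)
    qed
    then show ?thesis
      using pairing_s[OF p a b] pairing_s[OF p a a'_range[OF b]] pairing_s[OF p a'_range[OF a] b]
        pairing_s[OF p a'_range[OF a] a'_range[OF b]] by (simp only: \<phi>_def)
  qed
  finally show ?thesis .
qed

text \<open>By the two zero patterns, k = n + 2 - b is the first column of row a that meets row b at
  all, and it does so only through Omega_{k,b}.\<close>

lemma pairing_q_triangular:
  assumes p: "p \<in> X" and a: "1 \<le> a" "a \<le> n + 1" and b: "1 \<le> b" "b \<le> a" and kb: "k + b = n + 2" "k \<le> a"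
  shows "pairing (\<lambda>k. q a k p) (\<lambda>k. q b k p) p = q a k p * wf k b p * q b b p
     + (\<Sum>i\<in>{k+1..a}. \<Sum>l\<in>{1..b}. q a i p * wf i l p * q b l p)"
proof -
  let ?f = "\<lambda>i l. q a i p * wf i l p * q b l p"
  have bn: "b \<le> n + 1" using a b by simp
  have k1: "1 \<le> k" using kb a b by simp
  have "pairing (\<lambda>k. q a k p) (\<lambda>k. q b k p) p = (\<Sum>i\<in>{1..n+1}. \<Sum>l\<in>{1..b}. ?f i l)"
    unfolding pairing_def using bn b(1) by (intro sum.cong refl sum.mono_neutral_right) (auto simp: q_upper[OF p])
  also have "\<dots> = (\<Sum>i\<in>{k..a}. \<Sum>l\<in>{1..b}. ?f i l)"
  proof (rule sum.mono_neutral_right)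
    show "\<forall>i\<in>{1..n+1} - {k..a}. (\<Sum>l\<in>{1..b}. ?f i l) = 0"
    proof (intro ballI sum.neutral)
      fix i l assume i: "i \<in> {1..n+1} - {k..a}" and l: "l \<in> {1..b}"
      then consider "a < i" | "i + l \<le> n + 1" using kb by fastforce
      then show "?f i l = 0" using i l a by cases (auto simp: q_upper[OF p] wf_low[OF p])
    qed
  qed (use a k1 in auto)
  also have "\<dots> = (\<Sum>l\<in>{1..b}. ?f k l) + (\<Sum>i\<in>{k+1..a}. \<Sum>l\<in>{1..b}. ?f i l)"
    using kb(2) by (simp add: sum.atLeast_Suc_atMost)
  also have "(\<Sum>l\<in>{1..b}. ?f k l) = (\<Sum>l\<in>{1..b}. if l = b then ?f k b else 0)"
  proof (intro sum.cong refl)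
    fix l assume l: "l \<in> {1..b}"
    show "?f k l = (if l = b then ?f k b else 0)"
    proof (cases "l = b")
      case False
      then have "k + l \<le> n + 1" using l kb by auto
      then show ?thesis using False l k1 by (simp add: wf_low[OF p])
    qed simp
  qed
  also have "\<dots> = ?f k b" using b by simp
  finally show ?thesis .
qed

text \<open>By \<open>s_diag\<close> the factor in front of the unknown \<open>q a k\<close> has
  inverse \<open>phi_sign n k * s_entry k k\<close>. The right-hand side uses only later columns of
  row a and the earlier row b, which is the order of induction in \<open>mf_q\<close>.\<close>

lemma q_solve:
  assumes p: "p \<in> X" and a: "1 \<le> a" "a \<le> n + 1" and b: "1 \<le> b" "b < a" and kb: "k + b = n + 2" "k \<le> a"
  shows "q a k p = phi_sign n k * s_entry k k p * ((if a + b = n + 2 then phi_sign n a else 0)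
     - (\<Sum>i\<in>{k+1..a}. \<Sum>l\<in>{1..b}. q a i p * wf i l p * q b l p))"
proof -
  have k: "1 \<le> k" "k \<le> n + 1" using kb b a by auto
  have bn: "b \<le> n + 1" "b \<le> a" using a b by auto
  define s where "s = (\<Sum>i\<in>{k+1..a}. \<Sum>l\<in>{1..b}. q a i p * wf i l p * q b l p)"
  have "(if a + b = n + 2 then phi_sign n a else 0) - s = q a k p * wf k b p * s_entry b b p"
    using pairing_q_triangular[OF p a b(1) bn(2) kb] pairing_q[OF p a b(1) bn(1)] q_diag[OF p b(1) bn(1)]
    unfolding s_def by simp
  then have "phi_sign n k * s_entry k k p * ((if a + b = n + 2 then phi_sign n a else 0) - s)
      = phi_sign n k * (s_entry k k p * s_entry b b p * wf k b p) * q a k p" by (simp add: ac_simps)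
  also have "\<dots> = q a k p" unfolding s_diag[OF p k kb(1)] by (simp add: phi_sign_square)
  finally show ?thesis by (simp only: s_def)
qed

lemma wf_sym: "even n \<Longrightarrow> p \<in> X \<Longrightarrow> 1 \<le> i \<Longrightarrow> i \<le> n + 1 \<Longrightarrow> 1 \<le> j \<Longrightarrow> j \<le> n + 1 \<Longrightarrow> wf j i p = wf i j p"
  using w_sym[OF X_good] by (simp add: wf_def)

text \<open>For even \<open>n\<close> the remaining entry of a row is determined by the norm of that row.\<close>

lemma q_solve_norm:
  assumes p: "p \<in> X" and n: "even n" and a: "1 \<le> a" "a \<le> n + 1" and ka: "k + a = n + 2" "k < a"
  shows "q a k p = - (1 / 2) * phi_sign n k * s_entry k k p *
     (\<Sum>i\<in>{k+1..a}. \<Sum>l\<in>{k+1..a}. q a i p * wf i l p * q a l p)"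
proof -
  let ?f = "\<lambda>i l. q a i p * wf i l p * q a l p"
  have k: "1 \<le> k" "k \<le> n + 1" using ka a by auto
  have "0 = pairing (\<lambda>k. q a k p) (\<lambda>k. q a k p) p"
    using pairing_q[OF p a a] ka by simp
  also have "\<dots> = ?f k a + (\<Sum>i\<in>{k+1..a}. \<Sum>l\<in>{1..a}. ?f i l)"
    using pairing_q_triangular[OF p a a(1) order_refl ka(1)] ka by simp
  \<comment> \<open>The unknown \<open>q a k\<close> occurs a second time, as right factor in the
    summand i = a, l = k. Symmetry of Omega for even n makes the two occurrences equal, whence the
    factor 1/2.\<close>
  also have "(\<Sum>i\<in>{k+1..a}. \<Sum>l\<in>{1..a}. ?f i l) = (\<Sum>i\<in>{k+1..a}. (if i = a then ?f a k else 0) + (\<Sum>l\<in>{k+1..a}. ?f i l))"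
  proof (intro sum.cong refl)
    fix i assume i: "i \<in> {k+1..a}"
    have "(\<Sum>l\<in>{1..a}. ?f i l) = (\<Sum>l\<in>{k..a}. ?f i l)"
    proof (rule sum.mono_neutral_right)
      show "\<forall>l\<in>{1..a} - {k..a}. ?f i l = 0"
      proof
        fix l assume l: "l \<in> {1..a} - {k..a}"
        then have "i + l \<le> n + 1" using i ka by auto
        then show "?f i l = 0" using i l by (simp add: wf_low[OF p])
      qed
    qed (use k in auto)
    also have "\<dots> = ?f i k + (\<Sum>l\<in>{k+1..a}. ?f i l)"
      using ka(2) by (simp add: sum.atLeast_Suc_atMost)
    also have "?f i k = (if i = a then ?f a k else 0)"
    proof (cases "i = a")
      case False
      then have "i + k \<le> n + 1" using i ka by auto
      then show ?thesis using False i k by (simp add: wf_low[OF p])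
    qed simp
    finally show "(\<Sum>l\<in>{1..a}. ?f i l) = (if i = a then ?f a k else 0) + (\<Sum>l\<in>{k+1..a}. ?f i l)" .
  qed
  also have "?f k a + (\<Sum>i\<in>{k+1..a}. (if i = a then ?f a k else 0) + (\<Sum>l\<in>{k+1..a}. ?f i l))
      = ?f k a + (\<Sum>i\<in>{k+1..a}. \<Sum>l\<in>{k+1..a}. ?f i l) + ?f a k"
    using ka(2) by (simp add: sum.distrib)
  also have "?f a k = ?f k a" using wf_sym[OF n p k a] by simp
  finally have e: "- (1 / 2) * (\<Sum>i\<in>{k+1..a}. \<Sum>l\<in>{k+1..a}. ?f i l) = ?f k a" by (rule minus_half_eq)
  define s where "s = (\<Sum>i\<in>{k+1..a}. \<Sum>l\<in>{k+1..a}. ?f i l)"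
  have "- (1 / 2) * phi_sign n k * s_entry k k p * s = phi_sign n k * s_entry k k p * (- (1 / 2) * s)" by simp
  also have "\<dots> = phi_sign n k * s_entry k k p * (q a k p * wf k a p * s_entry a a p)"
    unfolding s_def e q_diag[OF p a] ..
  also have "\<dots> = phi_sign n k * (s_entry k k p * s_entry a a p * wf k a p) * q a k p" by (simp add: ac_simps)
  also have "\<dots> = q a k p" unfolding s_diag[OF p k ka(1)] by (simp add: phi_sign_square)
  finally show ?thesis by (simp only: s_def)
qed

end

section \<open>Modularity of Omega, of the diagonal of S and of the matrix q\<close>

abbreviation mf :: "version \<Rightarrow> int \<Rightarrow> fn \<Rightarrow> bool" where
  "mf v \<equiv> wm X (modular_gens v)"

lemma mf_xform:
  assumes d: "mf v (- (scale n * (int n + 2))) (\<lambda>p. 1 / disc p)" and F: "xform n r F"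
  shows "mf v (scale n * r) (\<lambda>p. F (t_one p) (t_disc p))"
  using F
proof induction
  case zero show ?case by (rule wm_zero)
next
  case (const a) show ?case using wm_const by simp
next
  case x show ?case using wm_gen[OF gens_t_one] by simp
next
  case inv
  have "scale n * - (int n + 2) = - (scale n * (int n + 2))" by (simp add: algebra_simps)
  then show ?case using d by (simp only: disc_def)
next
  case (add r F G) show ?case by (rule wm_add[OF add.IH])
next
  case (mult r F s G)
  show ?case using wm_mult[OF mult.IH] by (simp add: distrib_left)
qed

lemma mf_wf:
  assumes d: "mf v (- (scale n * (int n + 2))) (\<lambda>p. 1 / disc p)"
    and ij: "1 \<le> i" "i \<le> n + 1" "1 \<le> j" "j \<le> n + 1"
  shows "mf v (- (scale n * int (i + j))) (wf i j)"
proof -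
  obtain F where F: "xform n (- int (i + j)) F" "\<And>x y. good_param n x y \<Longrightarrow> w i j x y = F x y"
    using w_xform[OF ij] by blast
  show ?thesis
    by (rule wm_cong[OF mf_xform[OF d F(1)]]) (simp_all add: wf_def F(2) X_good algebra_simps)
qed

lemma mf_disc: "mf v (scale n * (int n + 2)) disc"
proof -
  have "mf v (scale n * (int n + 2)) (\<lambda>p. t_one p ^ (n + 2))"
    by (rule wm_weight[OF wm_power[OF wm_gen[OF gens_t_one]]]) (simp add: algebra_simps)
  from wm_diff[OF this wm_gen[OF gens_t_disc]] show ?thesis by (simp add: disc_def[abs_def])
qed

lemma inv_fn_eq: "inv_fn n p = - (1 / (t_disc p * disc p * t_check n p))"
proof -
  have "t_disc p * (t_disc p - t_one p ^ (n + 2)) * t_check n p = - (t_disc p * disc p * t_check n p)"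
    by (simp add: disc_def algebra_simps)
  then show ?thesis unfolding inv_fn_def by simp
qed

lemma half_dim_less: "half_dim n \<le> n"
  using n1 by (auto simp: half_dim_def elim: oddE)

lemma t_check_nz: "p \<in> X \<Longrightarrow> t_check n p \<noteq> 0"
  unfolding t_check_def using s_diag_nz half_dim_less by (auto simp: prod_zero_iff)

context
  fixes v :: version
  assumes n3: "3 \<le> n"
begin

lemma scale1: "scale n = 1"
  using n3 by (simp add: scale_def)

lemma mf_s: "free_pos n i k \<Longrightarrow> mf v (int k + hw n i) (s_entry i k)"
  by (rule wm_gen[OF gens_s[OF n3]])

lemma free_diag: "2 \<le> i \<Longrightarrow> i \<le> half_dim n \<Longrightarrow> free_pos n i i"
  using n3 by (auto simp: half_dim_def free_pos_def elim!: oddE evenE)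

lemma mf_prod_diag: "A \<subseteq> {2..half_dim n} \<Longrightarrow>
    mf v (\<Sum>i\<in>A. pos_weight n i i) (\<lambda>p. \<Prod>i\<in>A. s_entry i i p)"
proof (rule wm_prod)
  assume A: "A \<subseteq> {2..half_dim n}"
  show "finite A" using finite_subset[OF A] by simp
  fix i assume i: "i \<in> A"
  then have i': "2 \<le> i" "i \<le> half_dim n" using A by auto
  then have "pos_weight n i i = int i + hw n i" using half_dim_less n3 by (intro pos_weight_hw) auto
  then show "mf v (pos_weight n i i) (s_entry i i)" using mf_s[OF free_diag[OF i']] by simp
qed

lemma weight_N: "weight n (n + 2) = int n + 2"
  using chart_N(2) scale1 by simp

lemma inv_weight_eq: "inv_weight n = - (2 * (int n + 2) + (\<Sum>i\<in>{2..half_dim n}. pos_weight n i i))"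
  unfolding inv_weight_def weight_N ..

text \<open>Only the inverse of the whole product is a generator. Multiplying it by the other
  factors, all modular, isolates one inverse; the diagonal entries in \<open>mf_inv_low\<close> are
  treated alike.\<close>

lemma mf_inv_disc: "mf v (- (scale n * (int n + 2))) (\<lambda>p. 1 / disc p)"
proof (rule wm_cong)
  show "mf v (inv_weight n + ((int n + 2) + (\<Sum>i\<in>{2..half_dim n}. pos_weight n i i)))
      (\<lambda>p. inv_fn n p * (- 1 * (t_disc p * t_check n p)))"
    unfolding t_check_def
    by (intro wm_mult[OF wm_gen[OF gens_inv]] wm_scale wm_mult mf_prod_diag)
      (use wm_gen[OF gens_t_disc[of v]] in \<open>simp_all add: scale1\<close>)
  show "1 / disc p = inv_fn n p * (- 1 * (t_disc p * t_check n p))" if "p \<in> X" for p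
    unfolding inv_fn_eq using disc_nz[OF that] t_disc_nz[OF that] t_check_nz[OF that] by simp
qed (simp add: inv_weight_eq scale1)

lemma mf_w: "1 \<le> i \<Longrightarrow> i \<le> n + 1 \<Longrightarrow> 1 \<le> j \<Longrightarrow> j \<le> n + 1 \<Longrightarrow> mf v (- int (i + j)) (wf i j)"
  using mf_wf[OF mf_inv_disc, of i j] by (simp add: scale1)

lemma mf_inv_low:
  assumes b: "1 \<le> b" "b \<le> half_dim n"
  shows "mf v (- (int b + hw n b)) (\<lambda>p. 1 / s_entry b b p)"
proof (cases "b = 1")
  case True
  show ?thesis
    by (rule wm_cong[OF wm_const[of _ _ 1]]) (use True s_11 in \<open>simp_all add: hw_def\<close>)
next
  case False
  then have b2: "2 \<le> b" using b by simp
  let ?A = "{2..half_dim n} - {b}"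
  have S: "{2..half_dim n} = insert b ?A" using b b2 by auto
  have pw: "pos_weight n b b = int b + hw n b"
    using b b2 half_dim_less n3 by (intro pos_weight_hw) auto
  show ?thesis
  proof (rule wm_cong)
    show "mf v (inv_weight n + ((int n + 2) + ((int n + 2) + (\<Sum>i\<in>?A. pos_weight n i i))))
        (\<lambda>p. inv_fn n p * (- 1 * (t_disc p * (disc p * (\<Prod>i\<in>?A. s_entry i i p)))))"
      by (intro wm_mult[OF wm_gen[OF gens_inv]] wm_scale wm_mult mf_prod_diag)
        (use wm_gen[OF gens_t_disc[of v]] mf_disc[of v] in \<open>auto simp: scale1\<close>)
    show "1 / s_entry b b p = inv_fn n p * (- 1 * (t_disc p * (disc p * (\<Prod>i\<in>?A. s_entry i i p))))" if p: "p \<in> X" for p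
    proof -
      have t: "t_check n p = s_entry b b p * (\<Prod>i\<in>?A. s_entry i i p)"
        unfolding t_check_def by (subst S) (rule prod.insert; simp)
      then have "(\<Prod>i\<in>?A. s_entry i i p) \<noteq> 0" "s_entry b b p \<noteq> 0" using t_check_nz[OF p] by auto
      then show ?thesis unfolding inv_fn_eq t using disc_nz[OF p] t_disc_nz[OF p] by simp
    qed
    have "(\<Sum>i\<in>{2..half_dim n}. pos_weight n i i) = pos_weight n b b + (\<Sum>i\<in>?A. pos_weight n i i)"
      by (subst S) (rule sum.insert; simp)
    then show "inv_weight n + ((int n + 2) + ((int n + 2) + (\<Sum>i\<in>?A. pos_weight n i i))) = - (int b + hw n b)"
      by (simp add: inv_weight_eq pw)
  qed
qed

text \<open>The upper half of the diagonal consists of 1 and chart coordinates, and the middle entry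
  for even n is u. An entry in the lower half is, up to a constant, the discriminant divided by its
  mirror entry, by \<open>s_diag\<close>.\<close>

lemma mf_diag:
  assumes a: "1 \<le> a" "a \<le> n + 1"
  shows "mf v (int a + hw n a) (s_entry a a)"
proof -
  consider "a = 1" | "2 \<le> a" "a \<le> half_dim n" | "even n" "a = half_dim n + 1" | "half_dim n < a" "n + 2 - a \<le> half_dim n"
  proof -
    have "a = 1 \<or> (2 \<le> a \<and> a \<le> half_dim n) \<or> (even n \<and> a = half_dim n + 1) \<or> (half_dim n < a \<and> n + 2 - a \<le> half_dim n)"
      unfolding half_dim_def using a by presburger
    then show ?thesis using that by blast
  qed
  then show ?thesis
  proof cases
    case 1
    show ?thesis
      by (rule wm_cong[OF wm_const[of _ _ 1]]) (use 1 s_11 in \<open>simp_all add: hw_def\<close>)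
  next
    case 2
    then show ?thesis by (intro mf_s free_diag)
  next
    case 3
    then have "(n + 2) div 2 = a" "hw n a = 0" "u_weight n = int a"
      using n3 by (auto simp: half_dim_def hw_def u_weight_def elim!: evenE)
    then show ?thesis using wm_gen[OF gens_u[OF 3(1), of v]] by (simp add: u_fn_def)
  next
    case 4
    define b where "b = n + 2 - a"
    have ab: "a + b = n + 2" using a by (simp add: b_def)
    have b: "1 \<le> b" "b \<le> half_dim n" "b \<le> n + 1" using a 4 half_dim_less by (auto simp: b_def)
    show ?thesis
    proof (rule wm_cong)
      show "mf v ((int n + 2) + - (int b + hw n b))
          (\<lambda>p. phi_sign n a * (- 1) ^ (a - 1) / c' * (disc p * (1 / s_entry b b p)))"
        using wm_mult[OF mf_disc[of v] mf_inv_low[OF b(1,2)]] by (intro wm_scale) (simp add: scale1)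
      show "s_entry a a p = phi_sign n a * (- 1) ^ (a - 1) / c' * (disc p * (1 / s_entry b b p))" if p: "p \<in> X" for p
      proof -
        have "phi_sign n a * (- 1) ^ (a - 1) / c' * (disc p * (1 / s_entry b b p))
          = (s_entry a a p * s_entry b b p * ((- 1) ^ (a - 1) * c' * (1 / disc p))) * (- 1) ^ (a - 1) / c' * (disc p * (1 / s_entry b b p))"
          using s_diag[OF p a ab] wf_anti[OF p a ab] by simp
        also have "\<dots> = ((- 1) ^ (a - 1) * (- 1) ^ (a - 1)) * s_entry a a p"
          using c'0 disc_nz[OF p] s_diag_nz[OF p b(1,3)] by (simp add: divide_simps)
        also have "\<dots> = s_entry a a p" by (simp add: power_mult_distrib[symmetric])
        finally show ?thesis ..
      qed
      show "(int n + 2) + - (int b + hw n b) = int a + hw n a"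
        using hw_dual[OF n1 a(1) ab] ab by linarith
    qed
  qed
qed

text \<open>Up to sign the inverse of s_{aa} is the product of the mirror entry s_{bb} and
  Omega_{a,b}.\<close>

lemma mf_inv_diag:
  assumes a: "1 \<le> a" "a \<le> n + 1"
  shows "mf v (- (int a + hw n a)) (\<lambda>p. 1 / s_entry a a p)"
proof -
  define b where "b = n + 2 - a"
  have ab: "a + b = n + 2" using a by (simp add: b_def)
  have b: "1 \<le> b" "b \<le> n + 1" using a by (auto simp: b_def)
  show ?thesis
  proof (rule wm_cong)
    show "mf v ((int b + hw n b) + - int (a + b)) (\<lambda>p. phi_sign n a * (s_entry b b p * wf a b p))"
      by (intro wm_scale wm_mult mf_diag mf_w a b)
    show "1 / s_entry a a p = phi_sign n a * (s_entry b b p * wf a b p)" if p: "p \<in> X" for p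
    proof -
      have "phi_sign n a * (s_entry a a p * s_entry b b p * wf a b p) = 1"
        unfolding s_diag[OF p a ab] by (rule phi_sign_square)
      then have "s_entry a a p * (phi_sign n a * (s_entry b b p * wf a b p)) = 1" by (simp only: ac_simps)
      then show ?thesis using s_diag_nz[OF p a] by (simp add: divide_eq_eq mult.commute)
    qed
    show "(int b + hw n b) + - int (a + b) = - (int a + hw n a)"
      using hw_dual[OF n1 a(1) ab] by simp
  qed
qed

text \<open>Induction over rows, and within a row from the diagonal to the left. The excluded corner
  entry for odd n is a coordinate that no relation determines.\<close>

lemma mf_q:
  assumes "1 \<le> a" "a \<le> n + 1" "1 \<le> k" "k \<le> a" "odd n \<Longrightarrow> (a, k) \<noteq> (n + 1, 1)"
  shows "mf v (int k + hw n a) (q a k)"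
  using assms
proof (induction a arbitrary: k rule: less_induct)
  case outer: (less a)
  note a = outer.prems(1,2)
  show ?case using outer.prems(3-5)
  proof (induction "a - k" arbitrary: k rule: less_induct)
    case less
    note k = less.prems
    have k1: "k \<le> n + 1" using k a by simp
    have inner: "mf v (int i + hw n a) (q a i)" if "k < i" "i \<le> a" for i
      using that k by (intro less.hyps) auto
    \<comment> \<open>Besides the diagonal and q_{21} = 0: below the antidiagonal a + k = n + 2
      entries follow by pairing with row n + 2 - k; on it, for even n, by the norm of the row; all
      others are modular coordinates.\<close>
    consider (diag) "k = a" | (one) "a = 2" "k = 1" | (free) "free_pos n a k" "a \<noteq> 2"
      | (low) "k < a" "n + 2 < a + k" | (norm) "k < a" "even n" "a + k = n + 2"
    proof -
      have free: "free_pos n a k" if "k < a" "a \<noteq> 2" "a \<le> n" "if odd n then a + k \<le> n + 2 else a + k < n + 2"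
        using that a k(1,2) unfolding free_pos_def by simp
      have last: "even n \<or> n + 2 < a + k" if "\<not> a \<le> n"
        using that a k by (cases "k = 1") auto
      show ?thesis
      proof (cases "k = a \<or> a = 2")
        case True
        then show ?thesis
        proof
          assume "a = 2"
          then have "k = a \<or> k = 1" using k by auto
          then show ?thesis using that(1,2) \<open>a = 2\<close> by blast
        qed (use that(1) in blast)
      next
        case False
        then have "k < a" using k by simp
        have "a \<noteq> 2" using False by simp
        show ?thesis
        proof (cases "n + 2 < a + k")
          case True
          then show ?thesis using that(4) \<open>k < a\<close> by blast
        next
          case h: False
          show ?thesis
          proof (cases "even n \<and> a + k = n + 2")
            case True
            then show ?thesis using that(5) \<open>k < a\<close> by blast
          next
            case g: False
            have "a \<le> n"
            proof (rule ccontr)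
              assume "\<not> a \<le> n"
              then have "even n" "a + k = n + 2" using last h a k by auto
              then show False using g by blast
            qed
            moreover have "if odd n then a + k \<le> n + 2 else a + k < n + 2" using h g by auto
            ultimately show ?thesis using that(3) free \<open>a \<noteq> 2\<close> \<open>k < a\<close> by blast
          qed
        qed
      qed
    qed
    then show ?case
    proof cases
      case diag
      show ?thesis by (rule wm_cong[OF mf_diag[OF a]]) (use diag q_diag[OF n3] a in auto)
    next
      case one
      show ?thesis by (rule wm_cong[OF wm_zero]) (use one q_21[OF n3] in auto)
    next
      case free
      then have "q a k = s_entry a k" by (auto simp: q_def free_pos_def)
      then show ?thesis using mf_s[OF free(1)] by simp
    next
      case low
      define b where "b = n + 2 - k"
      have b: "1 \<le> b" "b < a" "k + b = n + 2" using low k1 k by (auto simp: b_def)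
      have hb: "hw n b = - hw n k" using hw_dual[OF n1 k(1) b(3)] .
      have bn: "b \<le> n + 1" using b a by simp
      have "mf v (hw n a + hw n b) (\<lambda>p. \<Sum>i\<in>{k+1..a}. \<Sum>l\<in>{1..b}. q a i p * wf i l p * q b l p)"
      proof (intro wm_sum)
        fix i l assume i: "i \<in> {k+1..a}" and l: "l \<in> {1..b}"
        have "mf v (int i + hw n a + - int (i + l) + (int l + hw n b)) (\<lambda>p. q a i p * wf i l p * q b l p)"
        proof (intro wm_mult)
          show "mf v (int i + hw n a) (q a i)" using i by (intro inner) auto
          show "mf v (- int (i + l)) (wf i l)" using i l a bn by (intro mf_w) auto
          show "mf v (int l + hw n b) (q b l)" using l b bn a by (intro outer.IH) auto
        qed
        then show "mf v (hw n a + hw n b) (\<lambda>p. q a i p * wf i l p * q b l p)" by (rule wm_weight) simp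
      qed
      moreover have "mf v (hw n a + hw n b) (\<lambda>p. if a + b = n + 2 then phi_sign n a else 0)"
      proof (cases "a + b = n + 2")
        case True
        then have "hw n a + hw n b = 0" using hw_dual[OF n1 a(1) True] by simp
        then show ?thesis using True wm_const[of X "modular_gens v" "phi_sign n a"] by simp
      next
        case False
        then show ?thesis using wm_zero by simp
      qed
      ultimately have m: "mf v (int k + hw n k + (hw n a + hw n b)) (\<lambda>p. phi_sign n k * s_entry k k p *
          ((if a + b = n + 2 then phi_sign n a else 0) - (\<Sum>i\<in>{k+1..a}. \<Sum>l\<in>{1..b}. q a i p * wf i l p * q b l p)))"
        by (intro wm_mult wm_scale wm_diff mf_diag k(1) k1)
      show ?thesis
        by (rule wm_cong[OF m]) (use q_solve[OF n3 _ a b k(2)] hb in auto)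
    next
      case norm
      have ka: "k + a = n + 2" using norm by simp
      have "mf v (hw n a + hw n a) (\<lambda>p. \<Sum>i\<in>{k+1..a}. \<Sum>l\<in>{k+1..a}. q a i p * wf i l p * q a l p)"
      proof (intro wm_sum)
        fix i l assume i: "i \<in> {k+1..a}" and l: "l \<in> {k+1..a}"
        have "mf v (int i + hw n a + - int (i + l) + (int l + hw n a)) (\<lambda>p. q a i p * wf i l p * q a l p)"
          using i l a by (intro wm_mult inner mf_w) auto
        then show "mf v (hw n a + hw n a) (\<lambda>p. q a i p * wf i l p * q a l p)" by (rule wm_weight) simp
      qed
      then have m: "mf v (int k + hw n k + (hw n a + hw n a)) (\<lambda>p. - (1 / 2) * phi_sign n k * s_entry k k p *
          (\<Sum>i\<in>{k+1..a}. \<Sum>l\<in>{k+1..a}. q a i p * wf i l p * q a l p))"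
        by (intro wm_mult wm_scale mf_diag k(1) k1)
      show ?thesis
        by (rule wm_cong[OF m]) (use q_solve_norm[OF n3 _ norm(2) a ka norm(1)] hw_dual[OF n1 k(1) ka] in auto)
    qed
  qed
qed

end

end

section \<open>The modular vector field on generators\<close>

context dwork
begin

definition kappa :: complex where "kappa = 1 / of_int (scale n)"

text \<open>The analogue of the Serre derivative of f, with -\<open>kappa\<close> t_2 in the role of
  E_2/12, is modular of weight r + 2.\<close>

definition std :: "version \<Rightarrow> (fn \<Rightarrow> fn) \<Rightarrow> int \<Rightarrow> fn \<Rightarrow> bool" where
  "std v E r f \<longleftrightarrow> mf v (r + 2) (\<lambda>p. ap n W E f p + kappa * of_int r * t2 p * f p)"

lemma stdI: "mf v (r + 2) m \<Longrightarrow> (\<And>p. p \<in> X \<Longrightarrow> ap n W E f p = m p - kappa * of_int r * t2 p * f p) \<Longrightarrow> std v E r f"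
  unfolding std_def by (rule wm_cong) auto

lemma scale_kappa: "of_int (scale n) * kappa = 1" "kappa * of_int (scale n) = 1"
  by (simp_all add: kappa_def scale_def)

section \<open>The modular vector field on t_1, t_{n+2} and the rows of S\<close>

context
  fixes R Y and v :: version
  assumes R: "vector_field n W R" and RY: "has_GM_matrix n W R (Y_mat n Y)"
begin

lemma std_R_t_one: "mf v (scale n + 2) (s_entry 2 2) \<Longrightarrow> std v R (scale n) t_one"
  by (erule stdI) (simp add: ap_R_t_one[OF R RY] scale_kappa)

text \<open>Here the Serre derivative is zero, as for the classical discriminant.\<close>

lemma std_R_t_disc: "std v R (scale n * (int n + 2)) t_disc"
proof (rule stdI[OF wm_zero])
  fix p assume p: "p \<in> X"
  have "kappa * of_int (scale n * (int n + 2)) = of_nat (n + 2)"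
    using scale_kappa by (simp add: mult.assoc[symmetric])
  then show "ap n W R t_disc p = 0 - kappa * of_int (scale n * (int n + 2)) * t2 p * t_disc p"
    unfolding ap_R_t_disc[OF R RY p] by (simp only:) (simp add: algebra_simps)
qed

lemma R_row:
  assumes "p \<in> X" "1 \<le> i" "i \<le> n" "1 \<le> j" "j \<le> n + 1"
  shows "ap n W R (s_entry i j) p = yv Y i p * s_entry (i + 1) j p
     - (if 2 \<le> j then s_entry 2 2 p * s_entry i (j - 1) p else 0) - of_nat j * t2 p * s_entry i j p"
  using ap_R_s[OF R RY assms(1,2) _ assms(4,5)] assms(3) bcoef_R[OF R RY assms(1)] acoef_R[OF R RY assms(1)]
  by simp

lemma R_last_row:
  assumes "p \<in> X"
  shows "ap n W R (s_entry (n + 1) 1) p = - t2 p * s_entry (n + 1) 1 p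
    + of_nat (Stirling (n + 2) 1) * (s_entry (n + 1) (n + 1) p * (t_one p * (s_entry 2 2 p * (1 / disc p))))"
  using ap_R_s[OF R RY assms, of "n + 1" 1] bcoef_R[OF R RY assms] acoef_R[OF R RY assms] by simp

section \<open>Dimension at least three\<close>

context
  assumes n3: "3 \<le> n"
begin

lemma kappa1: "kappa = 1"
  using n3 by (simp add: kappa_def scale_def)

lemma hw_mid: "3 \<le> i \<Longrightarrow> i < n \<Longrightarrow> hw n i = 0" and hw_2: "hw n 2 = 1" and hw_n: "hw n n = - 1"
  and hw_last: "hw n (n + 1) = 1"
  using n3 by (auto simp: hw_def)

lemma mf_s22: "mf v 3 (s_entry 2 2)"
  using mf_diag[OF n3, of 2 v] n3 hw_2 by simp

lemma mf_s_row: "3 \<le> i \<Longrightarrow> i \<le> n \<Longrightarrow> 1 \<le> k \<Longrightarrow> k \<le> i \<Longrightarrow> mf v (int k + hw n i) (s_entry i k)"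
proof -
  assume *: "3 \<le> i" "i \<le> n" "1 \<le> k" "k \<le> i"
  then have "q i k = s_entry i k" by (auto simp: q_def)
  then show ?thesis using mf_q[OF n3, of i k v] * by auto
qed

text \<open>By \<open>yv_R\<close>, Y_{i-1} equals s_{22} s_{ii} / s_{i+1,i+1}.\<close>

lemma mf_y:
  assumes "2 \<le> i" "i < n"
  shows "mf v (2 + hw n i - hw n (i + 1)) (yv Y i)"
proof (rule wm_cong)
  show "mf v (3 + (int i + hw n i) + - (int (i + 1) + hw n (i + 1))) (\<lambda>p. s_entry 2 2 p * s_entry i i p * (1 / s_entry (i + 1) (i + 1) p))"
    using assms by (intro wm_mult mf_s22 mf_diag mf_inv_diag n3) auto
  show "yv Y i p = s_entry 2 2 p * s_entry i i p * (1 / s_entry (i + 1) (i + 1) p)" if p: "p \<in> X" for p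
    using yv_R[OF R RY p, of i] s_diag_nz[OF p, of "i + 1"] assms by (simp add: eq_divide_eq)
qed simp

lemma std_R_row:
  assumes i: "3 \<le> i" "i < n" and k: "1 \<le> k" "k \<le> i"
  shows "std v R (int k + hw n i) (s_entry i k)"
proof (rule stdI)
  show "mf v (int k + hw n i + 2) (\<lambda>p. yv Y i p * s_entry (i + 1) k p - (if 2 \<le> k then s_entry 2 2 p * s_entry i (k - 1) p else 0))"
  proof (intro wm_diff)
    show "mf v (int k + hw n i + 2) (\<lambda>p. yv Y i p * s_entry (i + 1) k p)"
      by (rule wm_weight[OF wm_mult[OF mf_y mf_s_row]]) (use i k in auto)
    show "mf v (int k + hw n i + 2) (\<lambda>p. if 2 \<le> k then s_entry 2 2 p * s_entry i (k - 1) p else 0)"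
    proof (cases "2 \<le> k")
      case True
      have "mf v (3 + (int (k - 1) + hw n i)) (\<lambda>p. s_entry 2 2 p * s_entry i (k - 1) p)"
        using i k True by (intro wm_mult mf_s22 mf_s_row) auto
      then show ?thesis using True by (auto elim!: wm_weight simp: of_nat_diff)
    qed (simp add: wm_zero)
  qed
  show "ap n W R (s_entry i k) p = yv Y i p * s_entry (i + 1) k p - (if 2 \<le> k then s_entry 2 2 p * s_entry i (k - 1) p else 0)
      - kappa * of_int (int k + hw n i) * t2 p * s_entry i k p" if "p \<in> X" for p
    unfolding hw_mid[OF i] kappa1 using R_row[OF that, of i k] i k by simp
qed

text \<open>Two of the three multiples of t_2 come from the column index, the third from s_{21} =
  t_2 in the term s_{22} s_{21}.\<close>

lemma std_R_22: "std v R 3 (s_entry 2 2)"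
proof (rule stdI)
  show "mf v (3 + 2) (\<lambda>p. yv Y 2 p * s_entry 3 2 p)"
    by (rule wm_weight[OF wm_mult[OF mf_y mf_s_row]]) (use n3 hw_2 in auto)
  show "ap n W R (s_entry 2 2) p = yv Y 2 p * s_entry 3 2 p - kappa * of_int 3 * t2 p * s_entry 2 2 p" if "p \<in> X" for p
    using R_row[OF that, of 2 2] n3 unfolding kappa1 by (simp add: algebra_simps numeral_3_eq_3)
qed

text \<open>Expressing s_{n+1,2} through q_{n+1,2} returns one t_2 s_{n,2}, which lowers the
  coefficient from 2 to the weight 1.\<close>

lemma std_R_n2: "odd n \<Longrightarrow> std v R (int 2 + hw n n) (s_entry n 2)"
proof (rule stdI)
  assume n: "odd n"
  show "mf v (int 2 + hw n n + 2) (\<lambda>p. - q (n + 1) 2 p - s_entry 2 2 p * s_entry n 1 p)"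
  proof (intro wm_diff wm_minus)
    show "mf v (int 2 + hw n n + 2) (q (n + 1) 2)"
      by (rule wm_weight[OF mf_q[OF n3]]) (use n3 hw_n hw_last in auto)
    show "mf v (int 2 + hw n n + 2) (\<lambda>p. s_entry 2 2 p * s_entry n 1 p)"
      by (rule wm_weight[OF wm_mult[OF mf_s22 mf_s_row]]) (use n3 hw_n in auto)
  qed
  show "ap n W R (s_entry n 2) p = - q (n + 1) 2 p - s_entry 2 2 p * s_entry n 1 p
      - kappa * of_int (int 2 + hw n n) * t2 p * s_entry n 2 p" if "p \<in> X" for p
    using R_row[OF that, of n 2] n3 unfolding kappa1 hw_n q_def by (simp add: yv_def algebra_simps)
qed

lemma R_n1: "p \<in> X \<Longrightarrow> ap n W R (s_entry n 1) p = - s_entry (n + 1) 1 p - t2 p * s_entry n 1 p"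
  using R_row[of p n 1] n3 by (simp add: yv_def)

text \<open>In weight 0 no multiple of t_2 may remain: R s_{n,1} is exactly -q_{n+1,1}. The premise
  therefore asks for modularity of the corner entry.\<close>

lemma std_R_n1: "mf v 2 (q (n + 1) 1) \<Longrightarrow> std v R (int 1 + hw n n) (s_entry n 1)"
proof (rule stdI)
  assume "mf v 2 (q (n + 1) 1)"
  then show "mf v (int 1 + hw n n + 2) (\<lambda>p. - q (n + 1) 1 p)"
    using hw_n wm_minus by (simp del: One_nat_def)
  show "ap n W R (s_entry n 1) p = - q (n + 1) 1 p - kappa * of_int (int 1 + hw n n) * t2 p * s_entry n 1 p" if "p \<in> X" for p
    using R_n1[OF that] n3 unfolding kappa1 hw_n q_def by simp
qed

lemma mf_R_last: "mf v 4 (\<lambda>p. of_nat (Stirling (n + 2) 1) * (s_entry (n + 1) (n + 1) p * (t_one p * (s_entry 2 2 p * (1 / disc p)))))"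
proof -
  have "mf v ((int (n + 1) + hw n (n + 1)) + (1 + (3 + - (scale n * (int n + 2)))))
     (\<lambda>p. of_nat (Stirling (n + 2) 1) * (s_entry (n + 1) (n + 1) p * (t_one p * (s_entry 2 2 p * (1 / disc p)))))"
    using wm_gen[OF gens_t_one[of v]] scale1[OF n3]
    by (intro wm_scale wm_mult mf_diag mf_s22 mf_inv_disc n3) auto
  then show ?thesis by (rule wm_weight) (use hw_last scale1[OF n3] in simp)
qed

lemma mf_y2: "mf v 4 (\<lambda>p. yv Y 2 p * s_entry 3 1 p)"
proof -
  have "mf v ((2 + hw n 2 - hw n (2 + 1)) + (int 1 + hw n 3)) (\<lambda>p. yv Y 2 p * s_entry 3 1 p)"
    by (intro wm_mult mf_y mf_s_row) (use n3 in auto)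
  then show ?thesis by (rule wm_weight) (use hw_2 in simp)
qed

lemma R_t2: "p \<in> X \<Longrightarrow> ap n W R t2 p = yv Y 2 p * s_entry 3 1 p - t2 p * t2 p"
  using R_row[of p 2 1] n3 by (simp add: numeral_3_eq_3)

text \<open>Both R s_{n,1} and R t_2 contribute -t_2^2 s_{n,1}, and two terms -t_2 s_{n+1,1} arise.
  Together they are -2 t_2 q_{n+1,1}, as weight 2 demands.\<close>

lemma std_R_last:
  assumes n: "odd n"
  shows "std v R 2 (\<lambda>p. s_entry (n + 1) 1 p + t2 p * s_entry n 1 p)"
proof -
  have f: "free_pos n n 1" using n3 by (auto simp: free_pos_def)
  have regs: "reg n W (s_entry n 1)" "reg n W (s_entry (n + 1) 1)"
    using gens_reg[OF gens_s[OF n3 f]] gens_reg[OF gens_last[OF n3 n, of Option2]] by simp_all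
  show ?thesis
  proof (rule stdI)
    have "mf v (4 + (int 1 + hw n n)) (\<lambda>p. yv Y 2 p * s_entry 3 1 p * s_entry n 1 p)"
      by (intro wm_mult mf_y2 mf_s_row) (use n3 in auto)
    then have "mf v 4 (\<lambda>p. yv Y 2 p * s_entry 3 1 p * s_entry n 1 p)" by (rule wm_weight) (simp add: hw_n)
    from wm_add[OF mf_R_last this]
    show "mf v (2 + 2) (\<lambda>p. of_nat (Stirling (n + 2) 1) * (s_entry (n + 1) (n + 1) p * (t_one p * (s_entry 2 2 p * (1 / disc p))))
       + yv Y 2 p * s_entry 3 1 p * s_entry n 1 p)" by simp
    fix p assume p: "p \<in> X"
    have "ap n W R (\<lambda>p. s_entry (n + 1) 1 p + t2 p * s_entry n 1 p) p
      = ap n W R (s_entry (n + 1) 1) p + (t2 p * ap n W R (s_entry n 1) p + s_entry n 1 p * ap n W R t2 p)"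
      using ap_add[OF R regs(2) reg_mult[OF reg_t2 regs(1)]] ap_mult[OF R reg_t2 regs(1) p] by simp
    then show "ap n W R (\<lambda>p. s_entry (n + 1) 1 p + t2 p * s_entry n 1 p) p =
       of_nat (Stirling (n + 2) 1) * (s_entry (n + 1) (n + 1) p * (t_one p * (s_entry 2 2 p * (1 / disc p))))
       + yv Y 2 p * s_entry 3 1 p * s_entry n 1 p
       - kappa * of_int 2 * t2 p * (s_entry (n + 1) 1 p + t2 p * s_entry n 1 p)"
      unfolding R_last_row[OF p] R_n1[OF p] R_t2[OF p] kappa1 by (simp add: algebra_simps)
  qed
qed

text \<open>The exceptional generators are those on which the vector field of Option 2 differs from \<open>R\<close>.\<close>

lemma std_R_large:
  assumes g: "(g, r) \<in> modular_gens v"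
  shows "std v R r g \<or> g = inv_fn n \<and> r = inv_weight n \<or> v = Option2 \<and> odd n \<and>
    (g = s_entry n 1 \<and> r = 0 \<or> g = s_entry (n + 1) 1 \<and> r = 2)"
proof (rule gens_cases[OF n3 g])
  assume "g = t_one" "r = 1"
  then show ?thesis using std_R_t_one mf_s22 scale1[OF n3] by simp
next
  assume "g = t_disc" "r = int n + 2"
  then show ?thesis using std_R_t_disc scale1[OF n3] by simp
next
  fix i k assume f: "free_pos n i k" and gr: "g = s_entry i k" "r = int k + hw n i"
  have fk: "2 \<le> i" "i \<le> n" "1 \<le> k" "k \<le> i" "(i, k) \<noteq> (2, 1)" "if odd n then i + k \<le> n + 2 else i + k < n + 2"
    using f by (auto simp: free_pos_def)
  consider "i = 2" "k = 2" | "3 \<le> i" "i < n" | "i = n" "k = 1" | "i = n" "k = 2" "odd n"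
  proof -
    have "k = 1 \<or> (k = 2 \<and> odd n)" if "i = n" using fk(3,6) that by (auto split: if_splits)
    moreover have "k = 2" if "i = 2" using fk that by auto
    ultimately show ?thesis using that fk(1,2) by force
  qed
  then show ?thesis
  proof cases
    case 1
    then show ?thesis using std_R_22 hw_2 gr by simp
  next
    case 2
    then show ?thesis using std_R_row fk gr by simp
  next
    case 3
    consider "v = Option2" "odd n" | "mf v 2 (q (n + 1) 1)"
    proof (cases "odd n")
      case True
      have "q (n + 1) 1 = (\<lambda>p. s_entry (n + 1) 1 p + t2 p * s_entry n 1 p)"
        using n3 by (auto simp: q_def)
      then show ?thesis using that True wm_gen[OF gens_last[OF n3 True, of v]] by (cases v) simp_all
    next
      case False
      then show ?thesis using that mf_q[OF n3, of "n + 1" 1 v] n3 hw_last by simp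
    qed
    then show ?thesis using std_R_n1 3 gr hw_n by cases simp_all
  next
    case 4
    then show ?thesis using std_R_n2 gr by simp
  qed
next
  assume o: "odd n" and "g = (\<lambda>p. s_entry (n + 1) 1 p + (if v = Option1 then t2 p * s_entry n 1 p else 0))" "r = 2"
  then show ?thesis using std_R_last[OF o] by (cases v) auto
next
  assume e: "even n" and "g = u_fn n" "r = u_weight n"
  moreover have "3 \<le> (n + 2) div 2" "(n + 2) div 2 < n" using n3 e by presburger+
  moreover have "u_weight n = int ((n + 2) div 2)" using n3 by (simp add: u_weight_def zdiv_int)
  ultimately show ?thesis
    using std_R_row[of "(n + 2) div 2" "(n + 2) div 2"] hw_mid[of "(n + 2) div 2"] by (simp add: u_fn_def)
qed auto

lemma R_t2_large: "mf v 4 (\<lambda>p. ap n W R t2 p + kappa * t2 p * t2 p)"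
  by (rule wm_cong[OF mf_y2]) (use R_t2 kappa1 in simp_all)

end

section \<open>Dimensions one and two\<close>

context
  assumes n2: "n \<le> 2"
begin

lemma half_dim_small: "half_dim n = 1"
proof -
  have "n = 1 \<or> n = 2" using n1 n2 by linarith
  then show ?thesis by (auto simp: half_dim_def)
qed

lemma mf_inv_disc_small: "mf v (- (scale n * (int n + 2))) (\<lambda>p. 1 / disc p)"
proof (rule wm_cong)
  show "mf v (inv_weight n + scale n * (int n + 2)) (\<lambda>p. inv_fn n p * (- 1 * t_disc p))"
    by (intro wm_mult[OF wm_gen[OF gens_inv]] wm_scale wm_gen[OF gens_t_disc])
  show "1 / disc p = inv_fn n p * (- 1 * t_disc p)" if "p \<in> X" for p
    unfolding inv_fn_eq using disc_nz[OF that] t_disc_nz[OF that] by (simp add: t_check_def half_dim_small)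
  show "inv_weight n + scale n * (int n + 2) = - (scale n * (int n + 2))"
    unfolding inv_weight_def chart_N(2) half_dim_small by simp
qed

lemma s22_1:
  assumes "n = 1" "p \<in> X"
  shows "s_entry 2 2 p = 1 / c' * disc p"
proof -
  have "s_entry 2 2 p * (c' * (1 / disc p)) = 1"
    using s_diag[OF assms(2), of 1 2] wf_anti[OF assms(2), of 1 2] s_11[OF assms(2)] assms(1)
    by (simp add: phi_sign_def half_dim_def)
  then show ?thesis using c'0 disc_nz[OF assms(2)] by (simp add: field_simps)
qed

lemma mf_s22_1: "n = 1 \<Longrightarrow> mf v 3 (s_entry 2 2)"
  by (rule wm_cong[OF wm_scale[OF mf_disc, of _ "1 / c'"]]) (simp_all add: s22_1 scale_def)

lemma mf_s22_2: "n = 2 \<Longrightarrow> mf v 4 (s_entry 2 2)"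
  using wm_gen[OF gens_u[of v]] by (simp add: u_fn_def u_weight_def)

lemma R_t2_1: "n = 1 \<Longrightarrow> mf v 4 (\<lambda>p. ap n W R t2 p + kappa * t2 p * t2 p)"
proof (rule wm_cong)
  assume n: "n = 1"
  show "mf v (3 + (scale n + (3 + - (scale n * (int n + 2)))))
      (\<lambda>p. of_nat (Stirling (n + 2) 1) * (s_entry (n + 1) (n + 1) p * (t_one p * (s_entry 2 2 p * (1 / disc p)))))"
  proof -
    have e: "n + 1 = 2" using n by simp
    show ?thesis
      unfolding e by (intro wm_scale wm_mult mf_inv_disc_small mf_s22_1[OF n] wm_gen[OF gens_t_one])
  qed
  show "ap n W R t2 p + kappa * t2 p * t2 p =
      of_nat (Stirling (n + 2) 1) * (s_entry (n + 1) (n + 1) p * (t_one p * (s_entry 2 2 p * (1 / disc p))))" if "p \<in> X" for p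
  proof -
    have e: "n + 1 = 2" and k: "kappa = 1" unfolding kappa_def scale_def using n by simp_all
    show ?thesis using R_last_row[OF that] unfolding e k by simp
  qed
qed (simp add: scale_def)

text \<open>The case n = 2 of q = exp(-t_2 e) S: here e = E_21 - E_32 has nonzero square, and s_{32}
  + t_2 s_{22} and s_{31} + t_2^2 / 2 are entries of its last row. They are found directly from the
  pairing of rows 3 and 2 and the norm of row 3.\<close>

lemma relations_2:
  assumes n: "n = 2" and p: "p \<in> X"
  defines "u \<equiv> s_entry 2 2 p"
  shows "s_entry 3 2 p = u ^ 4 * wf 3 2 p - t2 p * u"
    "s_entry 3 1 p = (u ^ 6 * wf 3 2 p ^ 2 - u ^ 4 * wf 3 3 p) / 2 - t2 p * t2 p / 2"
proof -
  have set3: "{1..n+1} = {1, 2, 3}" using n by auto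
  have low: "wf 1 1 p = 0" "wf 1 2 p = 0" "wf 2 1 p = 0" using wf_low[OF p] n by auto
  have u0: "u \<noteq> 0" using s_diag_nz[OF p, of 2] n by (simp add: u_def)
  have d: "wf 2 2 p * (u * u) = 1" "s_entry 3 3 p * wf 1 3 p = 1"
    using s_diag[OF p, of 2 2] s_diag[OF p, of 1 3] s_11[OF p] n by (simp_all add: u_def phi_sign_def ac_simps)
  have w: "wf 2 2 p = - wf 1 3 p" "wf 3 1 p = wf 1 3 p" "wf 2 3 p = wf 3 2 p"
    using wf_anti[OF p, of 2 2] wf_anti[OF p, of 1 3] wf_anti[OF p, of 3 1] w_sym[OF X_good[OF p], of 3 2] n
    by (simp_all add: wf_def)
  have w22: "wf 2 2 p = 1 / (u * u)" using d(1) u0 by (simp add: eq_divide_eq)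
  have w13: "wf 1 3 p = - (1 / (u * u))" using w(1) w22 by simp
  have "wf 1 3 p * - (u * u) = 1" unfolding w13 using u0 by simp
  then have "s_entry 3 3 p = (s_entry 3 3 p * wf 1 3 p) * - (u * u)" by (simp only: mult.assoc mult_1_right)
  then have s33: "s_entry 3 3 p = - (u * u)" unfolding d(2) by simp
  have s23: "s_entry 2 3 p = 0" using s_upper[OF p, of 2 3] n by simp
  have "s_entry 3 2 p * wf 2 2 p * u + s_entry 3 3 p * wf 3 1 p * t2 p + s_entry 3 3 p * wf 3 2 p * u = 0"
    using s_rel[OF p, of 3 2] n unfolding set3 by (simp add: low[unfolded One_nat_def] s23 u_def add.assoc)
  then have "s_entry 3 2 p / u + t2 p - u ^ 3 * wf 3 2 p = 0"
    unfolding s33 w(2) w13 w22 using u0 by (simp add: field_simps power3_eq_cube)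
  then show s32: "s_entry 3 2 p = u ^ 4 * wf 3 2 p - t2 p * u"
    using u0 by (simp add: field_simps power_numeral_reduce)
  have "2 * (s_entry 3 1 p * (s_entry 3 3 p * wf 1 3 p)) + s_entry 3 2 p * s_entry 3 2 p * wf 2 2 p
      + 2 * (s_entry 3 2 p * s_entry 3 3 p * wf 3 2 p) + s_entry 3 3 p * s_entry 3 3 p * wf 3 3 p = 0"
    using s_rel[OF p, of 3 3] n unfolding set3 by (simp add: low[unfolded One_nat_def] w(2,3)[unfolded One_nat_def] algebra_simps)
  then have "2 * s_entry 3 1 p + s_entry 3 2 p * s_entry 3 2 p / (u * u)
      - 2 * (s_entry 3 2 p * (u * u) * wf 3 2 p) + u ^ 4 * wf 3 3 p = 0"
    unfolding d(2) unfolding s33 w22 by (simp add: power_numeral_reduce algebra_simps)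
  moreover have "s_entry 3 2 p * s_entry 3 2 p / (u * u) = (u ^ 3 * wf 3 2 p - t2 p) * (u ^ 3 * wf 3 2 p - t2 p)"
  proof -
    have "s_entry 3 2 p = u * (u ^ 3 * wf 3 2 p - t2 p)" unfolding s32 by (simp add: algebra_simps power_numeral_reduce)
    then show ?thesis using u0 by simp
  qed
  ultimately have "2 * s_entry 3 1 p = (u ^ 6 * wf 3 2 p ^ 2 - u ^ 4 * wf 3 3 p) - t2 p * t2 p"
    unfolding s32 by (simp add: algebra_simps power_numeral_reduce)
  then show "s_entry 3 1 p = (u ^ 6 * wf 3 2 p ^ 2 - u ^ 4 * wf 3 3 p) / 2 - t2 p * t2 p / 2"
    by (simp only: diff_divide_distrib[symmetric]) (simp add: eq_divide_eq mult.commute)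
qed

lemma yv_2: "n = 2 \<Longrightarrow> yv Y 2 p = - 1"
  unfolding yv_def by simp

text \<open>R t_2 = -s_{31} - t_2^2, and s_{31} contains -t_2^2 / 2, so the coefficient -1/2 =
  -\<open>kappa\<close> remains at t_2^2.\<close>

lemma R_t2_2: "n = 2 \<Longrightarrow> mf v 4 (\<lambda>p. ap n W R t2 p + kappa * t2 p * t2 p)"
proof (rule wm_cong)
  assume n: "n = 2"
  note w = mf_wf[OF mf_inv_disc_small]
  have "mf v 4 (\<lambda>p. s_entry 2 2 p ^ 4 * wf 3 3 p)"
    by (rule wm_weight[OF wm_mult[OF wm_power[OF mf_s22_2[OF n]] w]]) (use n in \<open>simp_all add: scale_def\<close>)
  moreover have "mf v 4 (\<lambda>p. s_entry 2 2 p ^ 6 * wf 3 2 p ^ 2)"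
    by (rule wm_weight[OF wm_mult[OF wm_power[OF mf_s22_2[OF n]] wm_power[OF w]]]) (use n in \<open>simp_all add: scale_def\<close>)
  ultimately show "mf v 4 (\<lambda>p. 1 / 2 * (s_entry 2 2 p ^ 4 * wf 3 3 p - s_entry 2 2 p ^ 6 * wf 3 2 p ^ 2))"
    by (intro wm_scale wm_diff)
  show "ap n W R t2 p + kappa * t2 p * t2 p = 1 / 2 * (s_entry 2 2 p ^ 4 * wf 3 3 p - s_entry 2 2 p ^ 6 * wf 3 2 p ^ 2)"
    if p: "p \<in> X" for p
  proof -
    have a: "ap n W R t2 p = - s_entry 3 1 p - t2 p * t2 p"
      using R_row[OF p, of 2 1] n yv_2[OF n] by simp
    have k: "kappa = 1 / 2" unfolding kappa_def scale_def using n by simp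
    show ?thesis unfolding a k relations_2(2)[OF n p] by (simp add: field_simps)
  qed
qed simp

lemma std_R_u_2: "n = 2 \<Longrightarrow> std v R 4 (u_fn n)"
proof (rule stdI)
  assume n: "n = 2"
  show "mf v (4 + 2) (\<lambda>p. - 1 * (s_entry 2 2 p ^ 4 * wf 3 2 p))"
    by (rule wm_scale, rule wm_weight[OF wm_mult[OF wm_power[OF mf_s22_2[OF n]] mf_wf[OF mf_inv_disc_small]]])
      (use n in \<open>simp_all add: scale_def\<close>)
  show "ap n W R (u_fn n) p = - 1 * (s_entry 2 2 p ^ 4 * wf 3 2 p) - kappa * of_int 4 * t2 p * u_fn n p"
    if p: "p \<in> X" for p
  proof -
    have a: "ap n W R (s_entry 2 2) p = - s_entry 3 2 p - s_entry 2 2 p * t2 p - 2 * t2 p * s_entry 2 2 p"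
      using R_row[OF p, of 2 2] n yv_2[OF n] by simp
    have k: "kappa = 1 / 2" unfolding kappa_def scale_def using n by simp
    have u: "u_fn n = s_entry 2 2" using n by (simp add: u_fn_def)
    show ?thesis unfolding u a k relations_2(1)[OF n p] by (simp add: algebra_simps)
  qed
qed

lemma std_R_small:
  assumes g: "(g, r) \<in> modular_gens v"
  shows "std v R r g \<or> g = inv_fn n \<and> r = inv_weight n"
proof (rule gens_cases_small[OF n2 g])
  assume "g = t_one" "r = scale n"
  moreover have "mf v (scale n + 2) (s_entry 2 2)"
  proof (cases "n = 1")
    case True
    then show ?thesis using mf_s22_1 by (simp add: scale_def)
  next
    case False
    then have "n = 2" using n1 n2 by linarith
    then show ?thesis using mf_s22_2 by (simp add: scale_def)
  qed
  ultimately show ?thesis using std_R_t_one by simp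
qed (use std_R_t_disc std_R_u_2 in auto)

lemma R_t2_small: "mf v 4 (\<lambda>p. ap n W R t2 p + kappa * t2 p * t2 p)"
proof (cases "n = 1")
  case True
  then show ?thesis by (rule R_t2_1)
next
  case False
  then have "n = 2" using n1 n2 by linarith
  then show ?thesis by (rule R_t2_2)
qed

end

end

end

section \<open>Derivations of Ramanujan type on modular forms\<close>

context dwork
begin

lemma gens_kinds:
  assumes "(g, r) \<in> modular_gens v"
  shows "g = inv_fn n \<and> r = inv_weight n \<or> even n \<and> g = u_fn n \<and> r = u_weight n
    \<or> (\<exists>j\<in>index_set n - {2}. g = chart v n j \<and> r = weight n j)"
  using assms unfolding wt_gens_def by (auto split: if_splits)

lemma mf_reg: "mf v r f \<Longrightarrow> reg n W f"
  by (erule reg_wm) (rule gens_reg)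

text \<open>A derivation is evaluated on u by differentiating this relation, since u is not a
  coordinate of the chart.\<close>

lemma u_square:
  assumes n: "even n"
  obtains a where "\<And>p. p \<in> X \<Longrightarrow> u_fn n p * u_fn n p = a * disc p" "\<And>p. p \<in> X \<Longrightarrow> u_fn n p \<noteq> 0"
proof
  define i where "i = (n + 2) div 2"
  have i: "1 \<le> i" "i \<le> n + 1" "i + i = n + 2" using n n1 by (auto simp: i_def elim!: evenE)
  fix p assume p: "p \<in> X"
  have u: "u_fn n p = s_entry i i p" by (simp add: u_fn_def i_def)
  show "u_fn n p \<noteq> 0" unfolding u by (rule s_diag_nz[OF p i(1,2)])
  have "u_fn n p * u_fn n p * ((- 1) ^ (i - 1) * c' * (1 / disc p)) = 1"
    using s_diag[OF p i(1,2,3)] wf_anti[OF p i(1,2,3)] n by (simp add: u phi_sign_def)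
  then show "u_fn n p * u_fn n p = (1 / ((- 1) ^ (i - 1) * c')) * disc p"
    using disc_nz[OF p] c'0 by (simp add: field_simps)
qed

lemma inv_fn_mult:
  assumes p: "p \<in> X"
  shows "inv_fn n p * (t_disc p * (t_disc p - t_one p ^ (n + 2)) * t_check n p) = 1"
proof -
  have "t_disc p - t_one p ^ (n + 2) \<noteq> 0" using disc_nz[OF p] unfolding disc_def by (metis eq_iff_diff_eq_0)
  then show ?thesis unfolding inv_fn_def using t_disc_nz[OF p] t_check_nz[OF p] by simp
qed

lemma t_check_reg: "reg n W (t_check n)" and inv_den_reg: "reg n W (\<lambda>p. t_disc p * (t_disc p - t_one p ^ (n + 2)) * t_check n p)"
proof -
  have "reg n W (\<lambda>p. \<Prod>i\<in>{2..half_dim n}. s_entry i i p)"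
  proof (rule reg_prod)
    fix i assume i: "i \<in> {2..half_dim n}"
    then have "2 \<le> half_dim n" by simp
    then have "3 \<le> n" unfolding half_dim_def by presburger
    then show "reg n W (s_entry i i)" using i gens_reg[OF gens_s[OF _ free_diag]] by auto
  qed
  then show t: "reg n W (t_check n)" by (simp add: t_check_def[abs_def])
  show "reg n W (\<lambda>p. t_disc p * (t_disc p - t_one p ^ (n + 2)) * t_check n p)"
    by (intro reg_mult reg_diff reg_power reg_t_one reg_t_disc t)
qed

section \<open>Propagation of the Ramanujan shape from the generators to all modular forms\<close>

context
  fixes v :: version and D :: "fn \<Rightarrow> fn"
  assumes D: "vector_field n W D"
begin

text \<open>Modularity is carried along because, by the Leibniz rule, the Serre derivative of a
  product multiplies that of one factor by the other factor.\<close>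

definition dst :: "int \<Rightarrow> fn \<Rightarrow> bool" where
  "dst r f \<longleftrightarrow> mf v r f \<and> std v D r f"

lemma dst_mult: "dst r f \<Longrightarrow> dst s g \<Longrightarrow> dst (r + s) (\<lambda>p. f p * g p)"
proof -
  assume f: "dst r f" and g: "dst s g"
  have m: "mf v r f" "mf v s g" and d: "mf v (r + 2) (\<lambda>p. ap n W D f p + kappa * of_int r * t2 p * f p)"
    "mf v (s + 2) (\<lambda>p. ap n W D g p + kappa * of_int s * t2 p * g p)"
    using f g by (auto simp: dst_def std_def)
  have "std v D (r + s) (\<lambda>p. f p * g p)" unfolding std_def
  proof (rule wm_cong[OF wm_add])
    show "mf v (r + s + 2) (\<lambda>p. f p * (ap n W D g p + kappa * of_int s * t2 p * g p))"
      by (rule wm_weight[OF wm_mult[OF m(1) d(2)]]) simp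
    show "mf v (r + s + 2) (\<lambda>p. g p * (ap n W D f p + kappa * of_int r * t2 p * f p))"
      by (rule wm_weight[OF wm_mult[OF m(2) d(1)]]) simp
    show "ap n W D (\<lambda>p. f p * g p) p + kappa * of_int (r + s) * t2 p * (f p * g p) =
       f p * (ap n W D g p + kappa * of_int s * t2 p * g p) + g p * (ap n W D f p + kappa * of_int r * t2 p * f p)"
      if "p \<in> X" for p
      unfolding ap_mult[OF D mf_reg[OF m(1)] mf_reg[OF m(2)] that] by (simp add: algebra_simps)
  qed simp
  then show ?thesis using wm_mult[OF m] by (simp add: dst_def)
qed

lemma dst_const: "dst 0 (\<lambda>p. a)"
proof -
  have "std v D 0 (\<lambda>p. a)" unfolding std_def
    by (rule wm_cong[OF wm_zero]) (simp_all add: ap_const[OF D])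
  then show ?thesis using wm_const by (simp add: dst_def)
qed

lemma dst_diff: "dst r f \<Longrightarrow> dst r g \<Longrightarrow> dst r (\<lambda>p. f p - g p)"
proof -
  assume f: "dst r f" and g: "dst r g"
  have m: "mf v r f" "mf v r g" and d: "mf v (r + 2) (\<lambda>p. ap n W D f p + kappa * of_int r * t2 p * f p)"
    "mf v (r + 2) (\<lambda>p. ap n W D g p + kappa * of_int r * t2 p * g p)"
    using f g by (auto simp: dst_def std_def)
  have "std v D r (\<lambda>p. f p - g p)" unfolding std_def
    by (rule wm_cong[OF wm_diff[OF d]])
      (simp_all add: ap_diff[OF D mf_reg[OF m(1)] mf_reg[OF m(2)]] algebra_simps)
  then show ?thesis using wm_diff[OF m] by (simp add: dst_def)
qed

lemma dst_weight: "dst r f \<Longrightarrow> r = s \<Longrightarrow> dst s f"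
  by simp

lemma dst_power: "dst r f \<Longrightarrow> dst (int k * r) (\<lambda>p. f p ^ k)"
proof (induction k)
  case 0 then show ?case using dst_const[of 1] by simp
next
  case (Suc k)
  from dst_mult[OF Suc.prems Suc.IH[OF Suc.prems]] show ?case by (simp add: algebra_simps)
qed

lemma dst_prod: "finite A \<Longrightarrow> (\<And>i. i \<in> A \<Longrightarrow> dst (r i) (f i)) \<Longrightarrow> dst (\<Sum>i\<in>A. r i) (\<lambda>p. \<Prod>i\<in>A. f i p)"
  by (induction A rule: finite_induct) (auto intro: dst_const dst_mult)

text \<open>The generator is 1/F for a product F of elements already treated. Differentiating (1/F)
  F = 1 shows that its Serre derivative is -1/F^2 times that of F.\<close>

lemma std_inv:
  assumes s: "\<And>i. 2 \<le> i \<Longrightarrow> i \<le> half_dim n \<Longrightarrow> std v D (pos_weight n i i) (s_entry i i) \<and> mf v (pos_weight n i i) (s_entry i i)"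
    and td: "std v D (scale n) t_one" "std v D (scale n * (int n + 2)) t_disc"
  shows "std v D (inv_weight n) (inv_fn n)"
proof -
  let ?F = "\<lambda>p. t_disc p * (t_disc p - t_one p ^ (n + 2)) * t_check n p"
  let ?N = "scale n * (int n + 2)" and ?S = "\<Sum>i\<in>{2..half_dim n}. pos_weight n i i"
  have d1: "dst (scale n) t_one" "dst ?N t_disc"
    using td wm_gen[OF gens_t_one] wm_gen[OF gens_t_disc] by (auto simp: dst_def)
  have "dst ?S (\<lambda>p. \<Prod>i\<in>{2..half_dim n}. s_entry i i p)"
    using s by (intro dst_prod) (auto simp: dst_def)
  moreover have "dst ?N (\<lambda>p. t_one p ^ (n + 2))"
    by (rule dst_weight[OF dst_power[OF d1(1)]]) (simp add: algebra_simps)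
  ultimately have "dst (?N + ?N + ?S) ?F"
    unfolding t_check_def by (intro dst_mult dst_diff d1)
  moreover have iw: "?N + ?N + ?S = - inv_weight n"
    unfolding inv_weight_def chart_N(2) by simp
  ultimately have F: "dst (- inv_weight n) ?F" by simp
  have inv: "mf v (inv_weight n) (inv_fn n)" by (rule wm_gen[OF gens_inv])
  have dF: "mf v (- inv_weight n + 2) (\<lambda>p. ap n W D ?F p + kappa * of_int (- inv_weight n) * t2 p * ?F p)"
    using F by (simp add: dst_def std_def)
  show ?thesis unfolding std_def
  proof (rule wm_cong)
    show "mf v (inv_weight n + (inv_weight n + (- inv_weight n + 2)))
        (\<lambda>p. inv_fn n p * (inv_fn n p * (-1 * (ap n W D ?F p + kappa * of_int (- inv_weight n) * t2 p * ?F p))))"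
      by (intro wm_mult inv wm_scale dF)
    fix p assume p: "p \<in> X"
    note e = inv_fn_mult[OF p]
    have "ap n W D (\<lambda>p. inv_fn n p * ?F p) p = 0"
      using ap_cong[of n W "\<lambda>p. inv_fn n p * ?F p" "\<lambda>p. 1" D] inv_fn_mult ap_const[OF D p, of 1] by simp
    then have z: "inv_fn n p * ap n W D ?F p + ?F p * ap n W D (inv_fn n) p = 0"
      using ap_mult[OF D inv_reg inv_den_reg p] by simp
    define i F dF di k where "i = inv_fn n p" and "F = ?F p" and "dF = ap n W D ?F p" and "di = ap n W D (inv_fn n) p"
      and "k = kappa * of_int (inv_weight n) * t2 p"
    have e: "i * F = 1" and z: "i * dF + F * di = 0" using e z by (simp_all only: i_def F_def dF_def di_def)
    have z': "F * di = - (i * dF)" using z by (simp add: eq_neg_iff_add_eq_0 add.commute)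
    have "di = i * F * di" using e by simp
    also have "\<dots> = i * (- (i * dF))" unfolding mult.assoc z' ..
    finally have "di + k * i = - (i * i * dF) + k * i * (i * F)" using e by simp
    also have "\<dots> = i * (i * (-1 * (dF + - k * F)))" by (simp add: algebra_simps)
    finally have r: "di + k * i = i * (i * (-1 * (dF + - k * F)))" .
    have kk: "kappa * of_int (- inv_weight n) * t2 p = - k" by (simp add: k_def)
    show "ap n W D (inv_fn n) p + kappa * of_int (inv_weight n) * t2 p * inv_fn n p
      = inv_fn n p * (inv_fn n p * (-1 * (ap n W D ?F p + kappa * of_int (- inv_weight n) * t2 p * ?F p)))"
      unfolding kk using r by (simp only: i_def F_def dF_def di_def k_def)
  qed simp
qed

lemma wt_part_std:
  assumes g: "\<And>g r. (g, r) \<in> modular_gens v \<Longrightarrow> std v D r g"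
  shows "wt_part X (modular_gens v) r f \<Longrightarrow> std v D r f"
proof -
  assume "wt_part X (modular_gens v) r f"
  then have "std v D r f \<and> mf v r f"
  proof induction
    case (zero r)
    have "std v D r (\<lambda>p. 0)" unfolding std_def
      by (rule wm_cong[OF wm_zero]) (simp_all add: ap_const[OF D])
    then show ?case using wm_zero by simp
  next
    case (const a)
    have "ap n W D (on X (\<lambda>p. a)) = ap n W D (\<lambda>p. a)" by (simp add: ap_def)
    then show ?case using dst_const[of a] by (simp add: dst_def std_def)
  next
    case (gen g r)
    have "std v D r (on X g)" unfolding std_def
      by (rule wm_cong[OF g[OF gen, unfolded std_def]]) (simp_all add: ap_def)
    then show ?case using wm_gen[OF gen] by simp
  next
    case (add r f h)
    then have f: "mf v r f" "mf v r h" by auto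
    have "std v D r (\<lambda>p. f p + h p)" unfolding std_def
      by (rule wm_cong[OF wm_add[OF add.IH(1)[THEN conjunct1, unfolded std_def] add.IH(2)[THEN conjunct1, unfolded std_def]]])
        (simp_all add: ap_add[OF D mf_reg[OF f(1)] mf_reg[OF f(2)]] algebra_simps)
    then show ?case using wm_add[OF f] by simp
  next
    case (mult r f s h)
    then have "dst r f" "dst s h" by (auto simp: dst_def)
    from dst_mult[OF this] show ?case by (simp add: dst_def)
  qed
  then show ?thesis by blast
qed

lemma bracket_of_std:
  assumes g: "\<And>g r. (g, r) \<in> modular_gens v \<Longrightarrow> std v D r g"
    and t: "mf v 4 (\<lambda>p. ap n W D t2 p + kappa * t2 p * t2 p)"
    and f: "wt_part X (modular_gens v) (int r) f" and h: "wt_part X (modular_gens v) (int s) h"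
  shows "wt_part X (modular_gens v) (int (r + s + 2 * k)) (RC_bracket D k r s f h)"
proof -
  define M where "M i = {f. wt_part X (modular_gens v) i f}" for i
  \<comment> \<open>The multiple of t_2 for which the equations of \<open>std\<close> take the
    normalised form of the locale, cut off to the moduli space so as to be a regular
    function.\<close>
  define \<phi> where "\<phi> = on X (\<lambda>p. kappa * t2 p)"
  have regM: "f \<in> regular_fns n W" if "f \<in> M i" for f i
    using mf_reg[OF wt_part_imp_wm, of v i f] that on_wt_part[of X _ i f] by (simp add: M_def reg_def)
  have reg_phi: "\<phi> \<in> regular_fns n W"
    using reg_scale[OF reg_t2, of kappa] by (simp add: reg_def \<phi>_def)
  have D_out: "D f p = 0" if "f \<in> regular_fns n W" "p \<notin> X" for f p
    using ap_out[OF D, of f p] that regular_on[OF that(1)] by (simp add: ap_def reg_def)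
  have D_ap: "D f p = ap n W D f p" if "f \<in> regular_fns n W" for f p
    using regular_on[OF that] by (simp add: ap_def)
  interpret ramanujan_derivation D "regular_fns n W" M \<phi>
  proof
    show "f \<in> M i \<Longrightarrow> g \<in> M i \<Longrightarrow> (\<lambda>p. f p + g p) \<in> M i" for f g i
      by (simp add: M_def wt_part.add)
    show "f \<in> M i \<Longrightarrow> g \<in> M j \<Longrightarrow> (\<lambda>p. f p * g p) \<in> M (i + j)" for f g i j
      by (simp add: M_def wt_part.mult)
    show "(\<lambda>p. a * f p) \<in> M i" if "f \<in> M i" for f i a
    proof -
      have "wt_part X (modular_gens v) (0 + i) (\<lambda>p. on X (\<lambda>p. a) p * f p)"
        using that by (intro wt_part.mult wt_part.const) (simp add: M_def)
      moreover have "f p = 0" if p: "p \<notin> X" for p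
      proof -
        have "on X f = f" by (rule on_wt_part) (use \<open>f \<in> M i\<close> in \<open>simp add: M_def\<close>)
        then show ?thesis using on_out[OF p, of f] by simp
      qed
      then have "(\<lambda>p. on X (\<lambda>p. a) p * f p) = (\<lambda>p. a * f p)" by (intro ext) (simp add: on_def)
      ultimately show ?thesis by (simp add: M_def)
    qed
    show "(\<lambda>p. D f p + of_int i * \<phi> p * f p) \<in> M (i + 2)" if f: "f \<in> M i" for f i
    proof -
      have "std v D i f" using wt_part_std[OF g] f by (simp add: M_def)
      then have "wt_part X (modular_gens v) (i + 2) (on X (\<lambda>p. ap n W D f p + kappa * of_int i * t2 p * f p))"
        by (simp add: std_def wm_def)
      moreover have "on X (\<lambda>p. ap n W D f p + kappa * of_int i * t2 p * f p) = (\<lambda>p. D f p + of_int i * \<phi> p * f p)"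
        using D_out[OF regM[OF f]] by (auto simp: on_def \<phi>_def D_ap[OF regM[OF f]])
      ultimately show ?thesis by (simp add: M_def)
    qed
    show "(\<lambda>p. D \<phi> p + \<phi> p * \<phi> p) \<in> M 4"
    proof -
      have "wt_part X (modular_gens v) 4 (on X (\<lambda>p. kappa * (ap n W D t2 p + kappa * t2 p * t2 p)))"
        using wm_scale[OF t, of kappa] by (simp add: wm_def)
      moreover have "on X (\<lambda>p. kappa * (ap n W D t2 p + kappa * t2 p * t2 p)) = (\<lambda>p. D \<phi> p + \<phi> p * \<phi> p)"
      proof
        fix p
        have "D \<phi> p = kappa * ap n W D t2 p"
          using ap_scale[OF D reg_t2, of kappa p] by (simp add: ap_def \<phi>_def)
        then show "on X (\<lambda>p. kappa * (ap n W D t2 p + kappa * t2 p * t2 p)) p = D \<phi> p + \<phi> p * \<phi> p"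
          using D_out[OF reg_phi, of p] by (auto simp: on_def \<phi>_def algebra_simps)
      qed
      ultimately show ?thesis by (simp add: M_def)
    qed
  qed (rule regular_add regular_mult regular_scale vf_add[OF D] vf_scale[OF D] vf_mult[OF D] reg_phi regM; assumption)+
  have "(\<lambda>p. \<Sum>j\<le>k. (-1) ^ j * (of_int (int k + int r - 1) gchoose (k - j))
      * (of_int (int k + int s - 1) gchoose j) * (D ^^ j) f p * (D ^^ (k - j)) h p) \<in> M (int (r + s + 2 * k))"
    by (rule bracket_M) (use f h in \<open>simp_all add: M_def\<close>)
  moreover have "RC_bracket D k r s f h = (\<lambda>p. \<Sum>j\<le>k. (-1) ^ j * (of_int (int k + int r - 1) gchoose (k - j))
      * (of_int (int k + int s - 1) gchoose j) * (D ^^ j) f p * (D ^^ (k - j)) h p)"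
    unfolding RC_bracket_def
    by (intro ext sum.reindex_bij_witness[of _ "\<lambda>j. (k - j, j)" snd]) auto
  ultimately show ?thesis by (simp add: M_def)
qed

end

section \<open>The partial derivative with respect to t_2\<close>

lemma coord_partial:
  assumes P: "is_partial n W 2 P" and j: "j \<in> index_set n" and p: "p \<in> X"
  shows "ap n W P (coord n j) p = (if j = 2 then 1 else 0)"
  using P j p unfolding is_partial_def ap_def by simp

text \<open>In Option 2 the chart is the original one, so coordinates other than t_2 are killed by
  definition. For u and the inverse generator the claim follows by differentiating u^2 = a
  \<open>disc\<close> and the equation (1/F) F = 1.\<close>

lemma partial_gens:
  assumes P: "is_partial n W 2 P" and g: "(g, r) \<in> modular_gens Option2" and p: "p \<in> X"
  shows "ap n W P g p = 0"
proof -
  have vf: "vector_field n W P" using P by (simp add: is_partial_def)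
  have c: "ap n W P (coord n j) q = 0" if "j \<in> index_set n" "j \<noteq> 2" "q \<in> X" for j q
    using coord_partial[OF P that(1,3)] that(2) by simp
  have P1: "ap n W P t_one q = 0" "ap n W P t_disc q = 0" if "q \<in> X" for q
    using c[OF index_1 _ that] c[OF index_N _ that] n1 by (simp_all add: coord_def)
  have Pdiff: "ap n W P (\<lambda>p. t_one p ^ (n + 2) - t_disc p) q = 0"
    "ap n W P (\<lambda>p. t_disc p - t_one p ^ (n + 2)) q = 0" if q: "q \<in> X" for q
    unfolding ap_diff[OF vf reg_power[OF reg_t_one] reg_t_disc] ap_diff[OF vf reg_t_disc reg_power[OF reg_t_one]]
      ap_power[OF vf reg_t_one q] P1[OF q] by simp_all
  have Ps: "ap n W P (s_entry i i) q = 0" if i: "2 \<le> i" "i \<le> half_dim n" and q: "q \<in> X" for i q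
  proof -
    have n3: "3 \<le> n" using i unfolding half_dim_def by presburger
    have pos: "(i, i) \<in> set (positions n)" using free_diag[OF n3 i] by (auto simp: mem_positions free_pos_def)
    have n2: "n \<noteq> 2" using n3 by simp
    obtain j where j: "j \<in> index_set n" "j \<noteq> 1" "j \<noteq> n + 2" "position n j = (i, i)"
      by (rule ex_position[OF n1 n2 pos])
    have "j \<noteq> 2" using j(4) position_2[OF n1] by auto
    moreover have "coord n j = s_entry i i" using j by (simp add: coord_def)
    ultimately show ?thesis using c[OF j(1) _ q] by simp
  qed
  have Pprod: "ap n W P (\<lambda>p. \<Prod>i\<in>A. s_entry i i p) q = 0" if "A \<subseteq> {2..half_dim n}" "q \<in> X" for A q
  proof -
    have "finite A" using finite_subset[OF that(1)] by simp
    then show ?thesis using that(1)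
    proof induction
      case empty
      show ?case using ap_const[OF vf that(2), of 1] by simp
    next
      case (insert i A)
      have r: "reg n W (s_entry i i)" if i: "2 \<le> i" "i \<le> half_dim n" for i
      proof -
        have n3: "3 \<le> n" using i unfolding half_dim_def by presburger
        show ?thesis by (rule gens_reg[OF gens_s[OF n3 free_diag[OF n3 i], of v]])
      qed
      have rA: "reg n W (\<lambda>p. \<Prod>i\<in>A. s_entry i i p)" using insert.prems by (intro reg_prod r) auto
      show ?case
        using ap_mult[OF vf r rA that(2), of i] insert Ps[of i q] that(2) by simp
    qed
  qed
  consider "g = inv_fn n" | "even n" "g = u_fn n" | j where "j \<in> index_set n - {2}" "g = chart Option2 n j"
    using gens_kinds[OF g] by blast
  then show ?thesis
  proof cases
    case 1
    let ?F = "\<lambda>p. t_disc p * (t_disc p - t_one p ^ (n + 2)) * t_check n p"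
    have "ap n W P (t_check n) p = 0"
      using Pprod[OF order_refl p] by (simp add: t_check_def[abs_def])
    then have F: "ap n W P ?F p = 0"
      using ap_mult[OF vf reg_mult[OF reg_t_disc reg_diff[OF reg_t_disc reg_power[OF reg_t_one]]] t_check_reg p]
        ap_mult[OF vf reg_t_disc reg_diff[OF reg_t_disc reg_power[OF reg_t_one]] p] Pdiff[OF p] P1[OF p] by (simp del: add_2_eq_Suc')
    have "ap n W P (\<lambda>p. inv_fn n p * ?F p) p = 0"
      using ap_cong[of n W "\<lambda>p. inv_fn n p * ?F p" "\<lambda>p. 1" P] inv_fn_mult ap_const[OF vf p, of 1] by (simp del: add_2_eq_Suc')
    then have "?F p * ap n W P (inv_fn n) p = 0"
      using ap_mult[OF vf inv_reg inv_den_reg p] F by (simp del: add_2_eq_Suc')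
    moreover have "?F p \<noteq> 0" using inv_fn_mult[OF p] by force
    ultimately show ?thesis using 1 by simp
  next
    case 2
    obtain a where a: "\<And>p. p \<in> X \<Longrightarrow> u_fn n p * u_fn n p = a * disc p" "\<And>p. p \<in> X \<Longrightarrow> u_fn n p \<noteq> 0"
      by (rule u_square[OF 2(1)]) (rule that, assumption+)
    have rd: "reg n W (\<lambda>p. t_one p ^ (n + 2) - t_disc p)" by (intro reg_diff reg_power reg_t_one reg_t_disc)
    have "ap n W P (\<lambda>p. u_fn n p * u_fn n p) p = ap n W P (\<lambda>p. a * (t_one p ^ (n + 2) - t_disc p)) p"
      using ap_cong[of n W "\<lambda>p. u_fn n p * u_fn n p" "\<lambda>p. a * (t_one p ^ (n + 2) - t_disc p)" P] a(1)
      by (simp add: disc_def)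
    also have "\<dots> = 0" using ap_scale[OF vf rd, of a p] Pdiff(1)[OF p] by (simp del: add_2_eq_Suc')
    finally have "2 * (u_fn n p * ap n W P (u_fn n) p) = 0"
      using ap_mult[OF vf u_reg[OF 2(1)] u_reg[OF 2(1)] p] by simp
    then show ?thesis using a(2)[OF p] 2(2) by simp
  next
    case 3
    have "chart Option2 n j = coord n j" by (simp add: chart_def)
    then show ?thesis using c[of j p] 3 p by simp
  qed
qed

lemma partial_mf:
  assumes P: "is_partial n W 2 P" and f: "mf Option2 r f" and p: "p \<in> X"
  shows "ap n W P f p = 0"
proof -
  have vf: "vector_field n W P" using P by (simp add: is_partial_def)
  have "wt_part X (modular_gens Option2) r (on X f)" using f by (simp add: wm_def)
  then have "mf Option2 r (on X f) \<and> (\<forall>p\<in>X. ap n W P (on X f) p = 0)"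
  proof induction
    case (zero r)
    show ?case using wm_zero ap_const[OF vf, of _ 0] by simp
  next
    case (const a)
    have "ap n W P (on X (\<lambda>p. a)) = ap n W P (\<lambda>p. a)" by (simp add: ap_def)
    then show ?case using wm_const[of X _ a] ap_const[OF vf, of _ a] by simp
  next
    case (gen g r)
    have "ap n W P (on X g) = ap n W P g" by (simp add: ap_def)
    then show ?case using wm_gen[OF gen] partial_gens[OF P gen] by simp
  next
    case (add r f g)
    then have m: "mf Option2 r f" "mf Option2 r g" by auto
    show ?case using wm_add[OF m] add.IH ap_add[OF vf mf_reg[OF m(1)] mf_reg[OF m(2)]] by simp
  next
    case (mult r f s g)
    then have m: "mf Option2 r f" "mf Option2 s g" by auto
    show ?case using wm_mult[OF m] mult.IH ap_mult[OF vf mf_reg[OF m(1)] mf_reg[OF m(2)]] by simp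
  qed
  moreover have "ap n W P (on X f) = ap n W P f" by (simp add: ap_def)
  ultimately show ?thesis using p by simp
qed

lemma partial_t2: "is_partial n W 2 P \<Longrightarrow> p \<in> X \<Longrightarrow> ap n W P t2 p = 1"
  using coord_partial[OF _ two_in_index] coord_2 by simp

end

section \<open>The Rankin-Cohen brackets\<close>

lemma power_int_sum_prod:
  "z \<noteq> 0 \<Longrightarrow> z powi (\<Sum>i\<in>A. f i) = (\<Prod>i\<in>A. z powi f i)" for z :: complex
  by (induction A rule: infinite_finite_induct) (auto simp: power_int_add)

context dwork
begin

text \<open>Separates the other generators from the exceptional one in the case distinctions. As
  functions they are defined on all triples, so test points off the moduli space serve; at p and r
  the convention 1/0 = 0 enters.\<close>

lemma t_one_ne_inv: "t_one \<noteq> inv_fn n" and t_disc_ne_inv: "t_disc \<noteq> inv_fn n"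
  and s_diag_ne_inv: "1 \<le> i \<Longrightarrow> i \<le> n + 1 \<Longrightarrow> s_entry i i \<noteq> inv_fn n"
proof -
  define p q r :: pt where "p = (1, 0, 1\<^sub>m (n + 1))" and "q = (0, 2, 1\<^sub>m (n + 1))" and "r = (0, 0, 1\<^sub>m (n + 1))"
  have "t_check n q = 1"
    unfolding t_check_def using half_dim_less by (intro prod.neutral) (auto simp: q_def entry_def)
  then have "t_disc q \<noteq> inv_fn n q" by (simp add: inv_fn_def q_def)
  moreover have "t_one p \<noteq> inv_fn n p" by (simp add: inv_fn_def p_def)
  moreover have "s_entry i i r \<noteq> inv_fn n r" if "1 \<le> i" "i \<le> n + 1" using that by (simp add: inv_fn_def r_def entry_def)
  ultimately show "t_one \<noteq> inv_fn n" "t_disc \<noteq> inv_fn n" "1 \<le> i \<Longrightarrow> i \<le> n + 1 \<Longrightarrow> s_entry i i \<noteq> inv_fn n" by metis+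
qed

text \<open>The inverse generator may be left open in the premise, because \<open>std_inv\<close>
  derives its shape from that of t_1, t_{n+2} and the diagonal coordinates.\<close>

lemma std_inv_gens:
  assumes D: "vector_field n W D"
    and g: "\<And>g r. (g, r) \<in> modular_gens v \<Longrightarrow> std v D r g \<or> g = inv_fn n \<and> r = inv_weight n"
    and gr: "(g, r) \<in> modular_gens v"
  shows "std v D r g"
proof -
  have s: "std v D (pos_weight n i i) (s_entry i i) \<and> mf v (pos_weight n i i) (s_entry i i)" if i: "2 \<le> i" "i \<le> half_dim n" for i
  proof -
    have n3: "3 \<le> n" using i unfolding half_dim_def by presburger
    have le: "1 \<le> i" "i \<le> n + 1" using i half_dim_less by auto
    note G = gens_s[OF n3 free_diag[OF n3 i], of v]
    have "pos_weight n i i = int i + hw n i" by (rule pos_weight_hw[OF n3 i(1) le(2)])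
    then show ?thesis using g[OF G] s_diag_ne_inv[OF le] wm_gen[OF G] by simp
  qed
  have "std v D (inv_weight n) (inv_fn n)"
    by (rule std_inv[OF D s])
      (use g[OF gens_t_one] t_one_ne_inv g[OF gens_t_disc] t_disc_ne_inv in simp_all)
  then show ?thesis using g[OF gr] by blast
qed

lemma is_modular_vf_cases:
  assumes R: "is_modular_vf n W R"
  shows "vector_field n W R"
    and "(g, r) \<in> modular_gens v \<Longrightarrow> std v R r g \<or> g = inv_fn n \<and> r = inv_weight n \<or>
      3 \<le> n \<and> v = Option2 \<and> odd n \<and> (g = s_entry n 1 \<and> r = 0 \<or> g = s_entry (n + 1) 1 \<and> r = 2)"
    and "mf v 4 (\<lambda>p. ap n W R t2 p + kappa * t2 p * t2 p)"
    and "3 \<le> n \<Longrightarrow> p \<in> X \<Longrightarrow> ap n W R (s_entry n 1) p = - s_entry (n + 1) 1 p - t2 p * s_entry n 1 p"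
    and "3 \<le> n \<Longrightarrow> mf v 4 (\<lambda>p. ap n W R (s_entry (n + 1) 1) p + t2 p * s_entry (n + 1) 1 p)"
proof -
  obtain Y where vf: "vector_field n W R" and GM: "has_GM_matrix n W R (Y_mat n Y)"
    using R unfolding is_modular_vf_def by blast
  show "vector_field n W R" by (rule vf)
  show "std v R r g \<or> g = inv_fn n \<and> r = inv_weight n \<or>
      3 \<le> n \<and> v = Option2 \<and> odd n \<and> (g = s_entry n 1 \<and> r = 0 \<or> g = s_entry (n + 1) 1 \<and> r = 2)"
    if "(g, r) \<in> modular_gens v"
    using std_R_large[OF vf GM _ that] std_R_small[OF vf GM _ that] by (cases "3 \<le> n") auto
  show "mf v 4 (\<lambda>p. ap n W R t2 p + kappa * t2 p * t2 p)"
  proof (cases "3 \<le> n")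
    case True
    then show ?thesis by (rule R_t2_large[OF vf GM])
  next
    case False
    then have "n \<le> 2" by simp
    then show ?thesis by (rule R_t2_small[OF vf GM])
  qed
  show "ap n W R (s_entry n 1) p = - s_entry (n + 1) 1 p - t2 p * s_entry n 1 p" if "3 \<le> n" "p \<in> X"
    by (rule R_n1[OF vf GM that])
  show "mf v 4 (\<lambda>p. ap n W R (s_entry (n + 1) 1) p + t2 p * s_entry (n + 1) 1 p)" if "3 \<le> n"
    by (rule wm_cong[OF mf_R_last[OF vf GM that, of v]]) (simp_all only: R_last_row[OF vf GM], simp)
qed

lemma H_gens:
  assumes H: "is_H n W H" and g: "(g, r) \<in> modular_gens v" and v: "v = Option2" and p: "p \<in> X"
  shows "ap n W H g p = of_int r * g p \<or> g = inv_fn n \<and> r = inv_weight n"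
proof -
  have t1: "ap n W H t_one p = of_int (scale n) * t_one p"
    and td: "ap n W H t_disc p = of_int (scale n * (int n + 2)) * t_disc p"
    using H_vals(2,3)[OF H p] by auto
  have s: "ap n W H (s_entry i j) p = of_int (scale n * (int j + hw n i)) * s_entry i j p"
    if "1 \<le> i" "i \<le> n + 1" "1 \<le> j" "j \<le> n + 1" "reg n W (s_entry i j)" for i j
    by (rule H_vals(4)[OF H p that])
  show ?thesis
  proof (cases "3 \<le> n")
    case True
    note sc = scale1[OF True]
    show ?thesis
    proof (rule gens_cases[OF True g])
      fix i k assume f: "free_pos n i k" and gr: "g = s_entry i k" "r = int k + hw n i"
      have "1 \<le> i" "i \<le> n + 1" "1 \<le> k" "k \<le> n + 1" using f by (auto simp: free_pos_def)
      from s[OF this] gens_reg[OF g] gr sc show ?thesis by simp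
    next
      assume "odd n" and e: "g = (\<lambda>p. s_entry (n + 1) 1 p + (if v = Option1 then t2 p * s_entry n 1 p else 0))" "r = 2"
      then have "g = s_entry (n + 1) 1" using v by simp
      moreover have "hw n (n + 1) = 1" using True by (simp add: hw_def)
      ultimately show ?thesis using s[of "n + 1" 1] gens_reg[OF g] e(2) sc by simp
    next
      assume e: "even n" and gr: "g = u_fn n" "r = u_weight n"
      define i where "i = (n + 2) div 2"
      have i: "3 \<le> i" "i < n" using True e unfolding i_def by presburger+
      then have "hw n i = 0" by (simp add: hw_def)
      moreover have "u_weight n = int i" using True by (simp add: u_weight_def zdiv_int i_def)
      moreover have "g = s_entry i i" using gr by (simp add: u_fn_def i_def)
      ultimately show ?thesis using s[of i i] gens_reg[OF g] gr i sc by simp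
    qed (use t1 td sc in auto)
  next
    case False
    then have n2: "n \<le> 2" by simp
    show ?thesis
    proof (rule gens_cases_small[OF n2 g])
      assume n: "n = 2" and gr: "g = u_fn n" "r = 4"
      have "g = s_entry 2 2" using gr n by (simp add: u_fn_def)
      moreover have "scale n * (int 2 + hw n 2) = 4" unfolding scale_def hw_def using n by simp
      ultimately show ?thesis using s[of 2 2] gens_reg[OF g] gr(2) n by simp
    qed (use t1 td in auto)
  qed
qed

lemma Option2_std:
  assumes D: "is_D Option2 n W D"
  shows "vector_field n W D" and "(g, r) \<in> modular_gens Option2 \<Longrightarrow> std Option2 D r g"
    and "mf Option2 4 (\<lambda>p. ap n W D t2 p + kappa * t2 p * t2 p)"
proof -
  define \<sigma> :: complex where "\<sigma> = of_int (scale n)"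
  have \<sigma>: "\<sigma> * kappa = 1" "\<sigma> = (if n = 2 then 2 else 1)" using scale_kappa by (auto simp: \<sigma>_def scale_def)
  obtain R P H where R: "is_modular_vf n W R" and P: "is_partial n W 2 P" and H: "is_H n W H"
    and De': "\<forall>f\<in>regular_fns n W. D f = (\<lambda>p. R f p + t2 p * (\<sigma> * (R (P f) p - P (R f) p) - H f p))"
    using D unfolding is_D_def version.case coord_2 \<sigma>(2)[symmetric] by (elim exE conjE) (rule that)
  note De = bspec[OF De']
  note vR = is_modular_vf_cases(1)[OF R]
  have vP: "vector_field n W P" using P by (simp add: is_partial_def)
  note vH = H_vals(1)[OF H]
  define C where "C f = (\<lambda>p. R (P f) p - P (R f) p)" for f
  have vC: "vector_field n W C"
    by (rule vector_field_commutator[OF vR vP]) (simp add: C_def)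
  define K where "K f = (\<lambda>p. \<sigma> * C f p + -1 * H f p)" for f
  have vK: "vector_field n W K"
    by (rule vector_field_lincomb[OF vC vH reg_const[of n W "-1"], where a = \<sigma>]) (simp add: K_def)
  show vD: "vector_field n W D"
    by (rule vector_field_lincomb[OF vR vK reg_t2, where a = 1]) (simp add: De K_def C_def)
  have apD: "ap n W D f p = ap n W R f p + t2 p * (\<sigma> * (ap n W R (ap n W P f) p - ap n W P (ap n W R f) p) - ap n W H f p)"
    if "reg n W f" for f p
  proof -
    have f: "on X f \<in> regular_fns n W" using that by (simp add: reg_def)
    show ?thesis
      unfolding ap_def De[OF f] regular_on[OF vf_closed[OF vP f]] regular_on[OF vf_closed[OF vR f]] ..
  qed
  \<comment> \<open>If R g = m + t_2 nu with m and nu killed by d/dt_2, then [R, d/dt_2] g = -nu and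
    D g = m + t_2 ((1 - \<sigma>) nu - r g). The condition \<open>c\<close> turns this into m -
    kappa r t_2 g. For n other than 2 it reads 0 = 0 and leaves nu arbitrary, which repairs the
    exceptional generators.\<close>
  have std_split: "std Option2 D r g"
    if m: "mf Option2 (r + 2) m" and \<nu>: "mf Option2 s \<nu>" and Rg: "\<And>p. p \<in> X \<Longrightarrow> ap n W R g p = m p + t2 p * \<nu> p"
      and Hg: "\<And>p. p \<in> X \<Longrightarrow> ap n W H g p = of_int r * g p" and g: "mf Option2 r g"
      and c: "\<And>p. p \<in> X \<Longrightarrow> (1 - \<sigma>) * \<nu> p = (1 - kappa) * (of_int r * g p)" for m \<nu> g r s
  proof (rule stdI[OF m])
    fix p assume p: "p \<in> X"
    have "ap n W R (ap n W P g) p = 0"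
      using ap_cong[of n W "ap n W P g" "\<lambda>p. 0" R] partial_mf[OF P g] ap_const[OF vR p, of 0] by simp
    moreover have "ap n W P (ap n W R g) p = \<nu> p"
    proof -
      have "ap n W P (ap n W R g) p = ap n W P (\<lambda>p. m p + t2 p * \<nu> p) p"
        using ap_cong[of n W "ap n W R g" "\<lambda>p. m p + t2 p * \<nu> p" P] Rg by simp
      also have "\<dots> = ap n W P m p + (t2 p * ap n W P \<nu> p + \<nu> p * ap n W P t2 p)"
        using ap_add[OF vP mf_reg[OF m] reg_mult[OF reg_t2 mf_reg[OF \<nu>]]] ap_mult[OF vP reg_t2 mf_reg[OF \<nu>] p] by simp
      finally show ?thesis using partial_mf[OF P m p] partial_mf[OF P \<nu> p] partial_t2[OF P p] by simp
    qed
    ultimately have "ap n W D g p = m p + t2 p * ((1 - \<sigma>) * \<nu> p) - t2 p * (of_int r * g p)"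
      unfolding apD[OF mf_reg[OF g]] Rg[OF p] Hg[OF p] by (simp add: algebra_simps)
    then show "ap n W D g p = m p - kappa * of_int r * t2 p * g p"
      unfolding c[OF p] by (simp add: algebra_simps)
  qed
  show "std Option2 D r g" if gr: "(g, r) \<in> modular_gens Option2"
  proof (rule std_inv_gens[OF vD _ gr])
    fix g r assume gr: "(g, r) \<in> modular_gens Option2"
    note mg = wm_gen[OF gr, of X]
    show "std Option2 D r g \<or> g = inv_fn n \<and> r = inv_weight n"
    proof (rule disjCI)
      assume ni: "\<not> (g = inv_fn n \<and> r = inv_weight n)"
      then have Hg: "ap n W H g p = of_int r * g p" if "p \<in> X" for p
        using H_gens[OF H gr refl that] by blast
      consider "std Option2 R r g" | "3 \<le> n" "odd n" "g = s_entry n 1" "r = 0" | "3 \<le> n" "g = s_entry (n + 1) 1" "r = 2"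
        using is_modular_vf_cases(2)[OF R gr] ni by blast
      then show "std Option2 D r g"
      proof cases
        case 1
        show ?thesis
        proof (rule std_split[OF 1[unfolded std_def] wm_scale[OF mg, of "- (kappa * of_int r)"] _ Hg mg])
          show "ap n W R g p = ap n W R g p + kappa * of_int r * t2 p * g p + t2 p * (- (kappa * of_int r) * g p)" for p
            by simp
          \<comment> \<open>For n = 2 the condition does restrict nu, and the Ramanujan shape nu =
            -kappa r g of R satisfies it because \<sigma> kappa = 1.\<close>
          show "(1 - \<sigma>) * (- (kappa * of_int r) * g p) = (1 - kappa) * (of_int r * g p)" for p
          proof -
            have "(1 - \<sigma>) * (- (kappa * of_int r) * g p) = (\<sigma> * kappa - kappa) * (of_int r * g p)"
              by (simp add: algebra_simps)
            then show ?thesis unfolding \<sigma>(1) .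
          qed
        qed
      next
        case 2
        have m: "mf Option2 2 (s_entry (n + 1) 1)"
          using wm_gen[OF gens_last[OF 2(1,2), of Option2]] by simp
        have s1: "\<sigma> = 1" using 2 \<sigma>(2) by auto
        show ?thesis
        proof (rule std_split[OF _ wm_minus[OF mg] _ Hg mg])
          show "mf Option2 (r + 2) (\<lambda>p. - s_entry (n + 1) 1 p)" using wm_minus[OF m] 2(4) by simp
          show "ap n W R g p = - s_entry (n + 1) 1 p + t2 p * - g p" if "p \<in> X" for p
            using is_modular_vf_cases(4)[OF R 2(1) that] 2(3) by simp
        qed (use s1 2(4) in simp_all)
      next
        case 3
        have s1: "\<sigma> = 1" "kappa = 1" using 3(1) \<sigma> by auto
        show ?thesis
        proof (rule std_split[OF _ wm_minus[OF mg] _ Hg mg])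
          show "mf Option2 (r + 2) (\<lambda>p. ap n W R (s_entry (n + 1) 1) p + t2 p * s_entry (n + 1) 1 p)"
            using is_modular_vf_cases(5)[OF R 3(1), of Option2] 3(3) by simp
          show "ap n W R g p = ap n W R (s_entry (n + 1) 1) p + t2 p * s_entry (n + 1) 1 p + t2 p * - g p" for p
            using 3(2) by simp
        qed (use s1 in simp_all)
      qed
    qed
  qed
  \<comment> \<open>On t_2 the correction vanishes: the quadratic term -kappa t_2^2 of R t_2 gives
    [R, d/dt_2] t_2 = 2 kappa t_2, and \<sigma> times this equals H t_2 = 2 t_2.\<close>
  show "mf Option2 4 (\<lambda>p. ap n W D t2 p + kappa * t2 p * t2 p)"
  proof (rule wm_cong[OF is_modular_vf_cases(3)[OF R]])
    fix p assume p: "p \<in> X"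
    define b where "b p = ap n W R t2 p + kappa * t2 p * t2 p" for p
    have b: "mf Option2 4 b" unfolding b_def by (rule is_modular_vf_cases(3)[OF R])
    have "ap n W R (ap n W P t2) p = 0"
      using ap_cong[of n W "ap n W P t2" "\<lambda>p. 1" R] partial_t2[OF P] ap_const[OF vR p, of 1] by simp
    moreover have "ap n W P (ap n W R t2) p = - (2 * kappa * t2 p)"
    proof -
      have "ap n W P (ap n W R t2) p = ap n W P (\<lambda>p. b p - kappa * (t2 p * t2 p)) p"
        using ap_cong[of n W "ap n W R t2" "\<lambda>p. b p - kappa * (t2 p * t2 p)" P] by (simp add: b_def)
      also have "\<dots> = ap n W P b p - kappa * (t2 p * ap n W P t2 p + t2 p * ap n W P t2 p)"
        using ap_diff[OF vP mf_reg[OF b] reg_scale[OF reg_mult[OF reg_t2 reg_t2]]]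
          ap_scale[OF vP reg_mult[OF reg_t2 reg_t2], of kappa p] ap_mult[OF vP reg_t2 reg_t2 p] by simp
      finally show ?thesis using partial_mf[OF P b p] partial_t2[OF P p] by simp
    qed
    moreover have "ap n W H t2 p = 2 * t2 p"
    proof -
      have "scale n * (int 1 + hw n 2) = 2" using weight_2 by simp
      then show ?thesis using H_vals(4)[OF H p _ _ _ _ reg_t2] n1 by (simp del: of_int_mult of_int_add)
    qed
    ultimately have "ap n W D t2 p = ap n W R t2 p + t2 p * (2 * (\<sigma> * kappa) * t2 p - 2 * t2 p)"
      unfolding apD[OF reg_t2] by (simp add: algebra_simps)
    then show "ap n W D t2 p + kappa * t2 p * t2 p = ap n W R t2 p + kappa * t2 p * t2 p"
      unfolding \<sigma>(1) by simp
  qed simp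
qed

lemma D_std:
  assumes D: "is_D v n W D"
  shows "vector_field n W D" and "(g, r) \<in> modular_gens v \<Longrightarrow> std v D r g"
    and "mf v 4 (\<lambda>p. ap n W D t2 p + kappa * t2 p * t2 p)"
proof -
  have "vector_field n W D \<and> ((g, r) \<in> modular_gens v \<longrightarrow> std v D r g) \<and> mf v 4 (\<lambda>p. ap n W D t2 p + kappa * t2 p * t2 p)"
  proof (cases v)
    case Option1
    then have R: "is_modular_vf n W D" using D by (simp add: is_D_def)
    note vf = is_modular_vf_cases(1)[OF R]
    have "std v D r g" if "(g, r) \<in> modular_gens v"
      by (rule std_inv_gens[OF vf _ that]) (use is_modular_vf_cases(2)[OF R] Option1 in blast)
    then show ?thesis using vf is_modular_vf_cases(3)[OF R] by blast
  next
    case Option2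
    then show ?thesis using Option2_std[of D] D by blast
  qed
  then show "vector_field n W D" "(g, r) \<in> modular_gens v \<Longrightarrow> std v D r g"
    "mf v 4 (\<lambda>p. ap n W D t2 p + kappa * t2 p * t2 p)" by blast+
qed

section \<open>Homogeneous modular forms and the scaling action\<close>

lemma torus_inv:
  assumes z: "z \<noteq> 0"
  shows "inv_fn n (torus z p) = z powi inv_weight n * inv_fn n p"
proof -
  define S where "S = (\<Sum>i\<in>{2..half_dim n}. pos_weight n i i)"
  define N where "N = scale n * (int n + 2)"
  have "t_check n (torus z p) = (\<Prod>i\<in>{2..half_dim n}. z powi pos_weight n i i * s_entry i i p)"
    unfolding t_check_def
  proof (intro prod.cong refl)
    fix i assume "i \<in> {2..half_dim n}"
    then have i: "2 \<le> i" "i \<le> half_dim n" by auto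
    have n3: "3 \<le> n" using i unfolding half_dim_def by presburger
    have le: "1 \<le> i" "i \<le> n + 1" using i half_dim_less by auto
    show "s_entry i i (torus z p) = z powi pos_weight n i i * s_entry i i p"
      unfolding torus_s[OF z le le] scale1[OF n3] pos_weight_hw[OF n3 i(1) le(2)] by simp
  qed
  also have "\<dots> = z powi S * t_check n p"
    unfolding prod.distrib t_check_def S_def
    by (subst power_int_sum_prod[OF z]) simp_all
  finally have tc: "t_check n (torus z p) = z powi S * t_check n p" .
  have td: "t_disc (torus z p) = z powi N * t_disc p" unfolding N_def by (rule torus_t_disc[OF z])
  have "t_one (torus z p) ^ (n + 2) = z powi N * t_one p ^ (n + 2)"
  proof -
    have "(z powi scale n) ^ (n + 2) = z powi N"
      using powi_scale[OF z, of "int (n + 2)"] unfolding power_int_of_nat N_def by (simp add: add.commute)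
    then show ?thesis unfolding torus_t_one[OF z] power_mult_distrib by (simp only:)
  qed
  then have d: "t_disc (torus z p) - t_one (torus z p) ^ (n + 2) = z powi N * (t_disc p - t_one p ^ (n + 2))"
    unfolding td by (simp only: right_diff_distrib)
  define E where "E = t_disc p - t_one p ^ (n + 2)"
  have "inv_fn n (torus z p) = 1 / ((z powi N * t_disc p) * (z powi N * E) * (z powi S * t_check n p))"
    unfolding inv_fn_def tc td d[unfolded td] E_def ..
  also have "\<dots> = inverse (z powi N * z powi N * z powi S) * (1 / (t_disc p * E * t_check n p))"
    by (simp add: divide_inverse ac_simps)
  also have "z powi N * z powi N * z powi S = z powi (N + N + S)" using z by (simp only: power_int_add simp_thms)
  also have "1 / (t_disc p * E * t_check n p) = inv_fn n p" by (simp only: inv_fn_def E_def)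
  also have "inverse (z powi (N + N + S)) = z powi inv_weight n"
    unfolding power_int_minus[symmetric] inv_weight_def chart_N(2) N_def S_def by simp
  finally show ?thesis .
qed

lemma torus_gens:
  assumes g: "(g, r) \<in> wt_gens v n (index_set n)" and z: "z \<noteq> 0"
  shows "g (torus z p) = z powi r * g p"
proof -
  have t2: "t2 (torus z p) = z powi 2 * t2 p"
    using torus_s[OF z, of 2 1 p] weight_2 n1 by simp
  consider "g = t2" "r = 2" | "(g, r) \<in> modular_gens v" using g unfolding all_gens by blast
  then show ?thesis
  proof cases
    case 1
    then show ?thesis using t2 by simp
  next
    case gr: 2
    show ?thesis
    proof (cases "3 \<le> n")
      case True
      note sc = scale1[OF True]
      show ?thesis
      proof (rule gens_cases[OF True gr])
        fix i k assume f: "free_pos n i k" and e: "g = s_entry i k" "r = int k + hw n i"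
        have "1 \<le> i" "i \<le> n + 1" "1 \<le> k" "k \<le> n + 1" using f by (auto simp: free_pos_def)
        from torus_s[OF z this] show ?thesis by (simp add: e sc)
      next
        assume "odd n" and e: "g = (\<lambda>p. s_entry (n + 1) 1 p + (if v = Option1 then t2 p * s_entry n 1 p else 0))" "r = 2"
        have h: "hw n (n + 1) = 1" "hw n n = - 1" using True by (auto simp: hw_def)
        have "s_entry (n + 1) 1 (torus z p) = z powi 2 * s_entry (n + 1) 1 p" "s_entry n 1 (torus z p) = s_entry n 1 p"
          using torus_s[OF z, of "n + 1" 1 p] torus_s[OF z, of n 1 p] h n1 sc by simp_all
        then show ?thesis unfolding e t2 by (simp add: algebra_simps)
      next
        assume e: "even n" and gr: "g = u_fn n" "r = u_weight n"
        define i where "i = (n + 2) div 2"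
        have i: "3 \<le> i" "i < n" using True e unfolding i_def by presburger+
        then have "hw n i = 0" by (simp add: hw_def)
        moreover have "u_weight n = int i" using True by (simp add: u_weight_def zdiv_int i_def)
        moreover have "g = s_entry i i" using gr by (simp add: u_fn_def i_def)
        ultimately show ?thesis using torus_s[OF z, of i i p] gr i sc by simp
      next
        assume "g = t_one" "r = 1"
        then show ?thesis using torus_t_one[OF z] sc by simp
      next
        assume "g = t_disc" "r = int n + 2"
        then show ?thesis using torus_t_disc[OF z] sc by simp
      next
        assume "g = inv_fn n" "r = inv_weight n"
        then show ?thesis using torus_inv[OF z] by simp
      qed
    next
      case False
      then have n2: "n \<le> 2" by simp
      show ?thesis
      proof (rule gens_cases_small[OF n2 gr])
        assume n: "n = 2" and e: "g = u_fn n" "r = 4"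
        have "g = s_entry 2 2" using e n by (simp add: u_fn_def)
        moreover have "scale n * (int 2 + hw n 2) = 4" unfolding scale_def hw_def using n by simp
        ultimately show ?thesis using torus_s[OF z, of 2 2 p] e(2) n by simp
      qed (use torus_t_one[OF z] torus_t_disc[OF z] torus_inv[OF z] in simp_all)
    qed
  qed
qed

text \<open>In \<open>MF_wt\<close> the weight is measured with t_2 among the generators, and
  membership in \<open>MF\<close> is a separate condition. The scaling action shows that such an f
  is already homogeneous in the generators without t_2.\<close>

lemma MF_wt_wt_part:
  assumes "f \<in> MF_wt v n W r"
  shows "wt_part X (modular_gens v) r f"
proof (rule wt_part_of_subalgebra[where act = torus and G = "wt_gens v n (index_set n)"])
  show "modular_gens v \<subseteq> wt_gens v n (index_set n)" unfolding all_gens by blast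
  show "f \<in> alg_gen X (fst ` modular_gens v)"
    using assms by (simp add: MF_wt_def MF_def gens_def)
  show "wt_part X (wt_gens v n (index_set n)) r f"
    using assms by (simp add: MF_wt_def QM_wt_def)
qed (auto intro: torus_X torus_gens)

lemma wt_part_MF_wt:
  assumes f: "wt_part X (modular_gens v) r f"
  shows "f \<in> MF_wt v n W r"
proof -
  have sub: "modular_gens v \<subseteq> wt_gens v n (index_set n)" unfolding all_gens by blast
  have "f \<in> MF v n W" using wt_part_alg_gen[OF f] by (simp add: MF_def gens_def)
  moreover have "f \<in> QM v n W"
    using alg_gen_mono[OF wt_part_alg_gen[OF f] image_mono[OF sub]] by (simp add: QM_def gens_def)
  ultimately show ?thesis using wt_part_mono[OF f sub] by (simp add: MF_wt_def QM_wt_def)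
qed

end

theorem theorem1p2:
  fixes n r s k :: nat
    and c :: complex
    and W :: "complex \<Rightarrow> complex \<Rightarrow> complex mat"
    and v :: version
    and D :: "(pt \<Rightarrow> complex) \<Rightarrow> pt \<Rightarrow> complex"
    and f g :: "pt \<Rightarrow> complex"
  assumes "n \<ge> 1"
    and "c \<noteq> 0"
    and "is_intersection_matrix n c W"
    and "is_D v n W D"
    and "f \<in> MF_wt v n W (int r)"
    and "g \<in> MF_wt v n W (int s)"
  shows "RC_bracket D k r s f g \<in> MF_wt v n W (int (r + s + 2 * k))"
proof -
  interpret dwork n c W using assms(1-3) by unfold_locales
  note std = D_std[OF assms(4)]
  show ?thesis
    by (rule wt_part_MF_wt[OF bracket_of_std[OF std(1) std(2) std(3) MF_wt_wt_part[OF assms(5)] MF_wt_wt_part[OF assms(6)]]])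
qed

end
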